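(* Let $\mathtt{I}$ be the icosian ring, let $$a_1=1,\quad a_2=\tfrac12(-1+i-j-k),\quad a_3=-i,\quad a_4=\tfrac12(i+\sigma j+\tau k)$$ be the $A_4$ simple roots in $\mathtt{I}$, with $\tau=\tfrac12(1+\sqrt5)$, $\sigma=\tfrac12(1-\sqrt5)$, and let $Q=\sum_{i=1}^4\mathbb{Z}a_i$. Then the even Weyl group of the hyperbolic Kac--Moody algebra $A_4^{++}$ satisfies $$W^+(A_4^{++})\cong PSL_2^{(0)}(\mathtt{I}).$$ Here $PSL_2^{(0)}(\mathtt{I})$ is defined as the discrete subgroup of $PSL_2(\mathtt{I})$ consisting of matrices $S=\begin{pmatrix}a&b\\c&d\end{pmatrix}$ satisfying $$a\bar a,\ b\bar b,\ c\bar c,\ d\bar d\in\mathbb{Z},\qquad c\bar a,\ d\bar b\in Q,$$ $$aa_i\bar b+b\bar a_i\bar a\in\mathbb{Z},\quad ca_i\bar d+d\bar a_i\bar c\in\mathbb{Z},\quad aa_i\bar d+b\bar a_i\bar c\in Q\qquad(i=1,2,3,4),$$ where the superscript $(0)$ indicates that additionally the $\mathbb{Z}_2$ outer automorphism of the $A_4$ Dynkin diagram has to be removed; this outer automorphism acts as $z\mapsto -z$ on $z\in Q$, and the corresponding matrix, which has to be quotiented out, is $\mathrm{diag}(1,-1)$.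
   Context: For a Kac--Moody algebra with Cartan matrix $[A_{IJ}]$, the Weyl group $W$ is the Coxeter group with generators $w_I$ and relations $w_I^2=1$, $(w_Iw_J)^{m_{IJ}}=1$ for $I\ne J$, where $m_{IJ}=2,3,4,6,\infty$ according as $A_{IJ}A_{JI}=0,1,2,3,\ge4$. $W^+\subset W$ is the index 2 subgroup of products of an even number of generators. $A_4^{++}$ is the over-extension of $A_4$ (the untwisted affine extension with one more node attached by a single line to the affine node). Its nodes are $-1,0,1,2,3,4$, with single edges ($m_{IJ}=3$) exactly $\{-1,0\},\{0,1\},\{1,2\},\{2,3\},\{3,4\},\{4,0\}$, and $m_{IJ}=2$ for the other pairs. The icosian ring $\mathtt{I}$ is the subring of the quaternions $\mathbb{H}$ equal to the integral span of the 120 icosian units: the 24 Hurwitz units $\pm1,\pm i,\pm j,\pm k,\tfrac12(\pm1\pm i\pm j\pm k)$ together with the 96 elements obtained from $\tfrac12(\pm i\pm\sigma j\pm\tau k)$ by even permutations of $(1,i,j,k)$. Bars denote quaternionic conjugation. $SL_2(\mathbb{H})$ is the group of $2\times2$ quaternionic matrices $S$ with $\det(SS^\dagger)=1$, where $S^\dagger$ is the conjugate transpose and the determinant of a Hermitian quaternionic matrix $\begin{pmatrix}p&q\\\bar q&r\end{pmatrix}$ ($p,r\in\mathbb{R}$) is $pr-q\bar q$; $PSL_2(\mathbb{H})=SL_2(\mathbb{H})/\{\pm1\}$, and $PSL_2(\mathtt{I})$ consists of the classes of matrices with all entries in $\mathtt{I}$. The listed conditions on $a,b,c,d$ are those for $X\mapsto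 SXS^\dagger$ to map the root lattice $\Lambda=\Big\{\begin{pmatrix}x^+&z\\\bar z&x^-\end{pmatrix}:x^\pm\in\mathbb{Z},\,z\in Q\Big\}$ to itself; $W^+(A_4^{++})$ acts on $\Lambda$ by such transformations. What the removal of the outer automorphism leaves: for $a=a_0+a_1i+a_2j+a_3k\in\mathtt{I}$ (real components $a_0,\dots,a_3$) put $a^*=a_0'-a_1'i-a_3'j-a_2'k$, where $(p+\sqrt5\,q)'=p-\sqrt5\,q$ for $p,q\in\mathbb{Q}$. The diagonal and off-diagonal matrices that remain after solving the conditions and taking the quotient are exactly $\begin{pmatrix}a&0\\0&a^*\end{pmatrix}$ and $\begin{pmatrix}0&a\\-a^*&0\end{pmatrix}$ with $a$ an icosian unit (60 of each type modulo $\pm1$, matching $|W(A_4)|=120$), and among the general matrices there remains in particular $\begin{pmatrix}1&\theta\\0&1\end{pmatrix}$ with $\theta=a_1+a_2+a_3+a_4=\tfrac12(1-\tau j-\sigma k)$ the highest root built from the simple roots. The full $W^+(A_4^{++})$ is obtained by adjoining this last matrix to the diagonal and off-diagonal ones. *)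

theory Defs
  imports
    "HOL-Analysis.Analysis"
    "HOL-Algebra.Coset"
    "HOL-Combinatorics.Permutations"
    "HOL-Library.Extended_Nat"
begin

section \<open>Quaternions\<close>

datatype quat = Quat (qRe: real) (qIm1: real) (qIm2: real) (qIm3: real)

lemma quat_eq_iff:
  "x = y \<longleftrightarrow> qRe x = qRe y \<and> qIm1 x = qIm1 y \<and> qIm2 x = qIm2 y \<and> qIm3 x = qIm3 y"
  by (cases x; cases y) simp

instantiation quat :: real_algebra_1
begin

definition "0 = Quat 0 0 0 0"
definition "1 = Quat 1 0 0 0"
definition "x + y = Quat (qRe x + qRe y) (qIm1 x + qIm1 y) (qIm2 x + qIm2 y) (qIm3 x + qIm3 y)"
definition "- x = Quat (- qRe x) (- qIm1 x) (- qIm2 x) (- qIm3 x)"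
definition "x - y = Quat (qRe x - qRe y) (qIm1 x - qIm1 y) (qIm2 x - qIm2 y) (qIm3 x - qIm3 y)"
definition "r *\<^sub>R x = Quat (r * qRe x) (r * qIm1 x) (r * qIm2 x) (r * qIm3 x)"
definition "x * y = Quat
  (qRe x * qRe y - qIm1 x * qIm1 y - qIm2 x * qIm2 y - qIm3 x * qIm3 y)
  (qRe x * qIm1 y + qIm1 x * qRe y + qIm2 x * qIm3 y - qIm3 x * qIm2 y)
  (qRe x * qIm2 y - qIm1 x * qIm3 y + qIm2 x * qRe y + qIm3 x * qIm1 y)
  (qRe x * qIm3 y + qIm1 x * qIm2 y - qIm2 x * qIm1 y + qIm3 x * qRe y)"

instance
  by standard
    (simp_all add: quat_eq_iff zero_quat_def one_quat_def plus_quat_def uminus_quat_def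
      minus_quat_def scaleR_quat_def times_quat_def algebra_simps)

end

instantiation quat :: real_inner
begin

definition inner_quat :: "quat \<Rightarrow> quat \<Rightarrow> real" where
  "inner_quat x y = qRe x * qRe y + qIm1 x * qIm1 y + qIm2 x * qIm2 y + qIm3 x * qIm3 y"
definition norm_quat :: "quat \<Rightarrow> real" where
  "norm_quat x = sqrt (inner x x)"
definition sgn_quat :: "quat \<Rightarrow> quat" where
  "sgn_quat x = x /\<^sub>R norm x"
definition dist_quat :: "quat \<Rightarrow> quat \<Rightarrow> real" where
  "dist_quat x y = norm (x - y)"
definition uniformity_quat :: "(quat \<times> quat) filter" where
  "uniformity_quat = (INF e\<in>{0<..}. principal {(x, y). dist x y < e})"
definition open_quat :: "quat set \<Rightarrow> bool" where
  "open_quat U \<longleftrightarrow> (\<forall>x\<in>U. eventually (\<lambda>(x', y). x' = x \<longrightarrow> y \<in> U) uniformity)"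

instance
proof
  fix x y z :: quat and r :: real
  show "inner x x = 0 \<longleftrightarrow> x = 0"
  proof
    assume "inner x x = 0"
    then have "(qRe x)\<^sup>2 + (qIm1 x)\<^sup>2 + ((qIm2 x)\<^sup>2 + (qIm3 x)\<^sup>2) = 0"
      by (simp add: inner_quat_def power2_eq_square)
    then show "x = 0"
      by (simp add: add_nonneg_eq_0_iff quat_eq_iff zero_quat_def)
  qed (simp add: inner_quat_def zero_quat_def)
qed (simp_all add: inner_quat_def norm_quat_def sgn_quat_def dist_quat_def
      uniformity_quat_def open_quat_def plus_quat_def scaleR_quat_def algebra_simps)

end

definition qi :: quat where "qi = Quat 0 1 0 0"
definition qj :: quat where "qj = Quat 0 0 1 0"
definition qk :: quat where "qk = Quat 0 0 0 1"

definition qcnj :: "quat \<Rightarrow> quat" where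
  "qcnj x = Quat (qRe x) (- qIm1 x) (- qIm2 x) (- qIm3 x)"


section \<open>Icosians and the \<open>A\<^sub>4\<close> root lattice\<close>

definition \<tau> :: real where "\<tau> = (1 + sqrt 5) / 2"
definition \<sigma> :: real where "\<sigma> = (1 - sqrt 5) / 2"

definition hurwitz_units :: "quat set" where
  "hurwitz_units =
     {s *\<^sub>R u | s u. s \<in> {1, -1} \<and> u \<in> {1, qi, qj, qk}} \<union>
     {(1/2) *\<^sub>R Quat s0 s1 s2 s3 | s0 s1 s2 s3. {s0, s1, s2, s3} \<subseteq> {1, -1}}"

definition icosian_units :: "quat set" where
  "icosian_units = hurwitz_units \<union>
     {(1/2) *\<^sub>R Quat (v (p 0)) (v (p 1)) (v (p 2)) (v (p 3)) | v p s1 s2 s3.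
        {s1, s2, s3} \<subseteq> {1, -1 :: real} \<and>
        v = (\<lambda>_ :: nat. 0 :: real)(1 := s1, 2 := s2 * \<sigma>, 3 := s3 * \<tau>) \<and>
        p permutes {0..3} \<and> evenperm p}"

definition icosians :: "quat set" where
  "icosians = {\<Sum>u\<in>icosian_units. of_int (n u) * u | n :: quat \<Rightarrow> int. True}"

definition simple_root :: "nat \<Rightarrow> quat" where
  "simple_root i =
     (if i = 1 then 1
      else if i = 2 then (1/2) *\<^sub>R (- 1 + qi - qj - qk)
      else if i = 3 then - qi
      else (1/2) *\<^sub>R (qi + \<sigma> *\<^sub>R qj + \<tau> *\<^sub>R qk))"

definition A4_lattice :: "quat set" where
  "A4_lattice = {\<Sum>i=1..4. of_int (n i) * simple_root i | n :: nat \<Rightarrow> int. True}"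

definition highest_root :: quat where
  "highest_root = (\<Sum>i=1..4. simple_root i)"

text \<open>Galois conjugation of \<open>\<rat>(\<surd>5)\<close>; only its values on that subfield of the reals are meaningful.\<close>

definition galois_conj :: "real \<Rightarrow> real" where
  "galois_conj x = (THE y. \<exists>p\<in>\<rat>. \<exists>q\<in>\<rat>. x = p + sqrt 5 * q \<and> y = p - sqrt 5 * q)"

text \<open>The \<open>j\<close> and \<open>k\<close> components are interchanged on purpose: Galois conjugation swaps
  \<open>\<sigma>\<close> and \<open>\<tau>\<close>, so without this the icosian units would not be preserved.\<close>

definition icosian_star :: "quat \<Rightarrow> quat" where
  "icosian_star a =
     Quat (galois_conj (qRe a)) (- galois_conj (qIm1 a)) (- galois_conj (qIm3 a)) (- galois_conj (qIm2 a))"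


section \<open>Quaternionic matrix groups\<close>

type_synonym qmat = "quat^2^2"

definition mat2 :: "quat \<Rightarrow> quat \<Rightarrow> quat \<Rightarrow> quat \<Rightarrow> qmat" where
  "mat2 a b c d = vector [vector [a, b], vector [c, d]]"

definition qadjoint :: "qmat \<Rightarrow> qmat" where
  "qadjoint S = (\<chi> i j. qcnj (S $ j $ i))"

text \<open>Determinant of a Hermitian matrix with rows \<open>(p, q)\<close> and \<open>(qcnj q, r)\<close>.\<close>

definition hermitian_det :: "qmat \<Rightarrow> quat" where
  "hermitian_det X = X $ 1 $ 1 * X $ 2 $ 2 - X $ 1 $ 2 * qcnj (X $ 1 $ 2)"

definition SL2_H :: "qmat monoid" where
  "SL2_H = \<lparr>carrier = {S. hermitian_det (S ** qadjoint S) = 1},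
            mult = (**), one = mat 1\<rparr>"

definition PSL2_H :: "qmat set monoid" where
  "PSL2_H = SL2_H Mod {mat 1, - mat 1}"

definition PSL_class :: "qmat \<Rightarrow> qmat set" where
  "PSL_class S = {mat 1, - mat 1} #>\<^bsub>SL2_H\<^esub> S"

definition PSL2_I :: "qmat set monoid" where
  "PSL2_I = PSL2_H \<lparr>carrier :=
     PSL_class ` {S \<in> carrier SL2_H. \<forall>i j. S $ i $ j \<in> icosians}\<rparr>"

definition lattice_conditions :: "quat \<Rightarrow> quat \<Rightarrow> quat \<Rightarrow> quat \<Rightarrow> bool" where
  "lattice_conditions a b c d \<longleftrightarrow>
     a * qcnj a \<in> \<int> \<and> b * qcnj b \<in> \<int> \<and> c * qcnj c \<in> \<int> \<and> d * qcnj d \<in> \<int> \<and>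
     c * qcnj a \<in> A4_lattice \<and> d * qcnj b \<in> A4_lattice \<and>
     (\<forall>i\<in>{1..4}.
        a * simple_root i * qcnj b + b * qcnj (simple_root i) * qcnj a \<in> \<int> \<and>
        c * simple_root i * qcnj d + d * qcnj (simple_root i) * qcnj c \<in> \<int> \<and>
        a * simple_root i * qcnj d + b * qcnj (simple_root i) * qcnj c \<in> A4_lattice)"

text \<open>The classes satisfying the lattice conditions, before the outer automorphism is removed.\<close>

definition PSL2_I_lattice :: "qmat set set" where
  "PSL2_I_lattice = {C \<in> carrier PSL2_I.
     \<exists>S\<in>C. lattice_conditions (S $ 1 $ 1) (S $ 1 $ 2) (S $ 2 $ 1) (S $ 2 $ 2)}"

definition outer_aut :: "qmat set" where
  "outer_aut = PSL_class (mat2 1 0 0 (- 1))"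

definition remaining_matrices :: "qmat set" where
  "remaining_matrices =
     {mat2 a 0 0 (icosian_star a) | a. a \<in> icosian_units} \<union>
     {mat2 0 a (- icosian_star a) 0 | a. a \<in> icosian_units} \<union>
     {mat2 1 highest_root 0 1}"

text \<open>The subgroup \<open>{1, outer_aut}\<close> is not normal in the group \<open>PSL2_I_lattice\<close>, so removing the
  outer automorphism cannot be a factor group. It means passing to a subgroup that contains exactly
  one of \<open>C\<close> and \<open>C \<cdot> outer_aut\<close> for every class \<open>C\<close>, the representatives in
  \<open>remaining_matrices\<close> being the ones that are kept.\<close>

definition outer_aut_removed :: "qmat set set \<Rightarrow> bool" where
  "outer_aut_removed K \<longleftrightarrow>
     subgroup K PSL2_H \<and> K \<subseteq> PSL2_I_lattice \<and>
     (\<forall>C\<in>PSL2_I_lattice. C \<in> K \<longleftrightarrow> C \<otimes>\<^bsub>PSL2_H\<^esub> outer_aut \<notin> K) \<and>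
     PSL_class ` remaining_matrices \<subseteq> K"

definition PSL2_0_I :: "qmat set monoid" where
  "PSL2_0_I = PSL2_H \<lparr>carrier := (THE K. outer_aut_removed K)\<rparr>"


section \<open>Weyl groups of Kac--Moody algebras\<close>

definition coxeter_exponent :: "int \<Rightarrow> enat" where
  "coxeter_exponent p =
     (if p = 0 then 2 else if p = 1 then 3 else if p = 2 then 4 else if p = 3 then 6 else \<infinity>)"

text \<open>Words in the generators modulo the Coxeter relations. As every generator is its own inverse,
  no letters for inverses are needed, and the monoid with this presentation is the group with
  this presentation.\<close>

inductive weyl_eq :: "'a set \<Rightarrow> ('a \<Rightarrow> 'a \<Rightarrow> int) \<Rightarrow> 'a list \<Rightarrow> 'a list \<Rightarrow> bool"
  for N :: "'a set" and A :: "'a \<Rightarrow> 'a \<Rightarrow> int" where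
  refl: "w \<in> lists N \<Longrightarrow> weyl_eq N A w w"
| sym: "weyl_eq N A u v \<Longrightarrow> weyl_eq N A v u"
| trans: "weyl_eq N A u v \<Longrightarrow> weyl_eq N A v w \<Longrightarrow> weyl_eq N A u w"
| append: "weyl_eq N A u u' \<Longrightarrow> weyl_eq N A v v' \<Longrightarrow> weyl_eq N A (u @ v) (u' @ v')"
| square: "I \<in> N \<Longrightarrow> weyl_eq N A [I, I] []"
| braid: "I \<in> N \<Longrightarrow> J \<in> N \<Longrightarrow> I \<noteq> J \<Longrightarrow> coxeter_exponent (A I J * A J I) = enat m \<Longrightarrow>
    weyl_eq N A (concat (replicate m [I, J])) []"

definition weyl_class :: "'a set \<Rightarrow> ('a \<Rightarrow> 'a \<Rightarrow> int) \<Rightarrow> 'a list \<Rightarrow> 'a list set" where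
  "weyl_class N A w = {v. weyl_eq N A w v}"

definition weyl_group :: "'a set \<Rightarrow> ('a \<Rightarrow> 'a \<Rightarrow> int) \<Rightarrow> 'a list set monoid" where
  "weyl_group N A =
     \<lparr>carrier = weyl_class N A ` lists N,
      mult = (\<lambda>X Y. {w. \<exists>u\<in>X. \<exists>v\<in>Y. weyl_eq N A (u @ v) w}),
      one = weyl_class N A []\<rparr>"

definition even_weyl_group :: "'a set \<Rightarrow> ('a \<Rightarrow> 'a \<Rightarrow> int) \<Rightarrow> 'a list set monoid" where
  "even_weyl_group N A =
     weyl_group N A \<lparr>carrier := weyl_class N A ` {w \<in> lists N. even (length w)}\<rparr>"

definition A4pp_nodes :: "int set" where
  "A4pp_nodes = {-1, 0, 1, 2, 3, 4}"

definition A4pp_cartan :: "int \<Rightarrow> int \<Rightarrow> int" where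
  "A4pp_cartan I J =
     (if I = J then 2
      else if {I, J} \<in> {{-1, 0}, {0, 1}, {1, 2}, {2, 3}, {3, 4}, {4, 0}} then -1
      else 0)"

end

theory Submission
  imports Defs
begin

text \<open>Hermitian quaternionic matrices \<open>X\<close> with the form \<open>-2 det X\<close> are a quadratic space of
signature \<open>(5, 1)\<close>, and the root lattice \<open>\<Lambda>\<close> of \<open>A\<^sub>4\<^sup>+\<^sup>+\<close> lies in it. The proof rests on one
identity (\<open>act_hmat_hadj\<close>): for a matrix \<open>R\<close> of determinant \<open>-1\<close> the reflection in \<open>R\<close> is
\<open>X \<mapsto> R adj(X) R\<close>. A product of two reflections is therefore \<open>X \<mapsto> S X S\<^sup>\<dagger>\<close> with
\<open>S = R adj(R')\<close>, and an even word in the simple reflections becomes an alternating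
product of simple roots and their adjugates (\<open>rotor\<close>), whose entries are icosians because the
entries of the simple roots are. An element of \<open>PSL\<^sub>2\<close> is determined by its action on Hermitian
matrices (\<open>PSL_class_eqI\<close>), so words that are equal in the Weyl group have the same class.

The map from even words to classes is injective because the Weyl group acts faithfully on the
root space (\<open>weyl_eq_iff_word_act\<close>). This is the theorem of Tits; its proof by the length
function is short for a simply laced diagram, where all exponents are 2 or 3.

The conditions on \<open>a, b, c, d\<close> say exactly that \<open>X \<mapsto> S X S\<^sup>\<dagger>\<close> maps \<open>\<Lambda>\<close> into itself
(\<open>lattice_conditions_iff\<close>). By \<open>lattice_matrix_cases\<close> such an \<open>S\<close> is up to sign the matrix of an
even word, possibly multiplied by \<open>diag(1, -1)\<close>. For this, a word is chosen that returns the
image of the Weyl vector to the fundamental chamber. The Weyl vector is orthogonal to no lattice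
vector of norm 2 and the simple roots are the lattice vectors of norm 2 and height 1; hence
what remains is a symmetry of the diagram. The diagram has one nontrivial symmetry, and it is
\<open>diag(1, -1)\<close> followed by the longest element of \<open>W(A\<^sub>4)\<close>. Odd words do not occur, because
\<open>X \<mapsto> adj(X)\<close> is not of the form \<open>X \<mapsto> S X S\<^sup>\<dagger>\<close>.

So the classes of even words and their translates by the outer automorphism are disjoint and
exhaust the classes that satisfy the conditions. The diagonal, off-diagonal and translation
matrices that are kept represent even words (\<open>remaining_subset_even\<close>), and they generate all
of them (\<open>remaining_generate\<close>). This leaves the even words as the only subgroup from which the
outer automorphism has been removed. It is discrete because its action on \<open>\<Lambda>\<close> has integral
matrix entries that are continuous in \<open>S\<close> and determine \<open>S\<close> up to sign.\<close>


section \<open>The reflection representation of a simply laced Weyl group\<close>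

text \<open>The vector \<open>h\<close> plays the part of a linear functional that is positive on the simple roots. It
guarantees that a sum of simple roots is never the negative of such a sum.\<close>

locale simply_laced_roots =
  fixes N :: "'a set" and A :: "'a \<Rightarrow> 'a \<Rightarrow> int"
    and B :: "'v::real_vector \<Rightarrow> 'v \<Rightarrow> real" and \<alpha> :: "'a \<Rightarrow> 'v" and h :: 'v
  assumes form_add: "B (x + y) z = B x z + B y z"
    and form_scale: "B (r *\<^sub>R x) z = r * B x z"
    and form_sym: "B x y = B y x"
    and root_form: "I \<in> N \<Longrightarrow> J \<in> N \<Longrightarrow> B (\<alpha> I) (\<alpha> J) = of_int (A I J)"
    and cartan_diag: "I \<in> N \<Longrightarrow> A I I = 2"
    and cartan_off_diag: "I \<in> N \<Longrightarrow> J \<in> N \<Longrightarrow> I \<noteq> J \<Longrightarrow> A I J \<in> {0, -1}"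
    and height_pos: "I \<in> N \<Longrightarrow> B h (\<alpha> I) > 0"
begin

definition reflect :: "'v \<Rightarrow> 'v \<Rightarrow> 'v" where
  "reflect r x = x - B x r *\<^sub>R r"

definition word_act :: "'a list \<Rightarrow> 'v \<Rightarrow> 'v" where
  "word_act w = foldr (\<lambda>I. reflect (\<alpha> I)) w"

lemma form_diff: "B (x - y) z = B x z - B y z"
  using form_add[of "x - y" y z] by simp

lemma form_add_right: "B z (x + y) = B z x + B z y"
  by (metis form_add form_sym)

lemma form_diff_right: "B z (x - y) = B z x - B z y"
  by (metis form_diff form_sym)

lemma form_scale_right: "B z (r *\<^sub>R x) = r * B z x"
  by (metis form_scale form_sym)

lemma word_act_Nil [simp]: "word_act [] = id"
  by (simp add: word_act_def)

lemma word_act_Cons [simp]: "word_act (I # w) = reflect (\<alpha> I) \<circ> word_act w"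
  by (simp add: word_act_def)

lemma word_act_append: "word_act (u @ v) = word_act u \<circ> word_act v"
  by (induction u) (simp_all add: comp_assoc)

lemma reflect_add: "reflect r (x + y) = reflect r x + reflect r y"
  by (simp add: reflect_def form_add algebra_simps)

lemma reflect_scale: "reflect r (c *\<^sub>R x) = c *\<^sub>R reflect r x"
  by (simp add: reflect_def form_scale algebra_simps)

lemma linear_word_act: "linear (word_act w)"
  by (induction w)
     (auto simp: linear_iff reflect_add reflect_scale)

lemma reflect_reflect:
  assumes "B r r = 2"
  shows "reflect r (reflect r x) = x"
proof -
  have "B (reflect r x) r = - B x r"
    using assms by (simp add: reflect_def form_diff form_scale)
  then show ?thesis by (simp add: reflect_def[of r "reflect r x"]) (simp add: reflect_def)
qed

lemma form_reflect: "B r r = 2 \<Longrightarrow> B (reflect r x) (reflect r y) = B x y"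
  by (simp add: reflect_def form_diff form_scale form_diff_right form_scale_right
      form_sym[of r y] algebra_simps)

lemma root_norm: "I \<in> N \<Longrightarrow> B (\<alpha> I) (\<alpha> I) = 2"
  by (simp add: root_form cartan_diag)

lemma form_word_act: "w \<in> lists N \<Longrightarrow> B (word_act w x) (word_act w y) = B x y"
  by (induction w) (auto simp: form_reflect root_norm)

lemma word_act_rev:
  assumes "w \<in> lists N"
  shows "word_act (rev w) (word_act w x) = x" "word_act w (word_act (rev w) x) = x"
  using assms
  by (induction w arbitrary: x) (auto simp: word_act_append reflect_reflect root_norm)

lemma weyl_eq_lists: "weyl_eq N A u v \<Longrightarrow> u \<in> lists N \<and> v \<in> lists N"
proof (induction rule: weyl_eq.induct)
  case (braid I J m)
  then show ?case by (auto simp: in_lists_conv_set split: if_splits)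
qed auto

lemma cartan_sym: "I \<in> N \<Longrightarrow> J \<in> N \<Longrightarrow> A I J = A J I"
  by (metis root_form form_sym of_int_eq_iff)

lemma reflect_orthogonal: "B r s = 0 \<Longrightarrow> reflect r (reflect s x) = reflect s (reflect r x)"
  by (simp add: reflect_def form_diff form_scale form_sym[of s r] algebra_simps)

text \<open>Both sides are the reflection in the root \<open>r + s\<close>.\<close>

lemma reflect_braid:
  assumes "B r r = 2" "B s s = 2" "B r s = -1"
  shows "reflect r (reflect s (reflect r x)) = reflect s (reflect r (reflect s x))"
  using assms
  by (simp add: reflect_def form_add form_diff form_scale form_sym[of s r] algebra_simps)

lemma word_act_cong: "weyl_eq N A u v \<Longrightarrow> word_act u = word_act v"
proof (induction rule: weyl_eq.induct)
  case (square I)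
  then show ?case by (simp add: fun_eq_iff reflect_reflect root_norm)
next
  case (braid I J m)
  have form: "B (\<alpha> I) (\<alpha> J) = of_int (A I J)" "B (\<alpha> I) (\<alpha> I) = 2" "B (\<alpha> J) (\<alpha> J) = 2"
    using root_form[OF braid(1,2)] root_norm[OF braid(1)] root_norm[OF braid(2)] by simp_all
  have "A I J = 0 \<or> A I J = -1"
    using cartan_off_diag[of I J] braid by auto
  then show ?case
  proof
    assume A0: "A I J = 0"
    then have "coxeter_exponent (A I J * A J I) = 2"
      by (simp add: coxeter_exponent_def)
    with braid(4) have "m = 2" by (metis enat.inject numeral_eq_enat)
    with form A0 reflect_orthogonal[of "\<alpha> I" "\<alpha> J"] show ?thesis
      by (simp add: fun_eq_iff numeral_2_eq_2 reflect_reflect)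
  next
    assume A1: "A I J = -1"
    then have "coxeter_exponent (A I J * A J I) = 3"
      using cartan_sym[of I J] braid by (simp add: coxeter_exponent_def)
    with braid(4) have "m = 3" by (metis enat.inject numeral_eq_enat)
    with form A1 reflect_braid[of "\<alpha> I" "\<alpha> J"] show ?thesis
      by (simp add: fun_eq_iff numeral_3_eq_3 reflect_reflect)
  qed
qed (simp_all add: word_act_append)

lemma weyl_cong:
  assumes "weyl_eq N A u v" "p \<in> lists N" "q \<in> lists N"
  shows "weyl_eq N A (p @ u @ q) (p @ v @ q)"
  by (intro weyl_eq.append weyl_eq.refl assms)

lemma weyl_eq_cancel_right:
  assumes "weyl_eq N A (u @ [s]) v" "s \<in> N"
  shows "weyl_eq N A u (v @ [s])"
proof -
  have "u \<in> lists N" using weyl_eq_lists[OF assms(1)] by simp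
  then have "weyl_eq N A (u @ [s, s] @ []) (u @ [] @ [])"
    by (intro weyl_cong weyl_eq.square assms) auto
  moreover have "weyl_eq N A (u @ [s, s]) (v @ [s])"
    using weyl_cong[OF assms(1), of "[]" "[s]"] assms(2) by simp
  ultimately show ?thesis
    by (metis append_Nil2 weyl_eq.sym weyl_eq.trans)
qed

lemma weyl_eq_commute:
  assumes "s \<in> N" "t \<in> N" "s \<noteq> t" "A s t = 0"
  shows "weyl_eq N A [s, t] [t, s]"
proof -
  have "coxeter_exponent (A s t * A t s) = enat 2"
    using assms by (simp add: coxeter_exponent_def numeral_eq_enat)
  from weyl_eq.braid[OF assms(1-3) this]
  have "weyl_eq N A [s, t, s, t] []" by (simp add: numeral_2_eq_2)
  then have "weyl_eq N A ([s, t, s] @ [t]) []" by simp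
  from weyl_eq_cancel_right[OF this assms(2)]
  have "weyl_eq N A ([s, t] @ [s]) [t]" by simp
  from weyl_eq_cancel_right[OF this assms(1)] show ?thesis by simp
qed

lemma weyl_eq_braid3:
  assumes "s \<in> N" "t \<in> N" "s \<noteq> t" "A s t = -1"
  shows "weyl_eq N A [s, t, s] [t, s, t]"
proof -
  have "coxeter_exponent (A s t * A t s) = enat 3"
    using assms cartan_sym[of s t] by (simp add: coxeter_exponent_def numeral_eq_enat)
  from weyl_eq.braid[OF assms(1-3) this]
  have "weyl_eq N A ([s, t, s, t, s] @ [t]) []" by (simp add: numeral_3_eq_3)
  from weyl_eq_cancel_right[OF this assms(2)]
  have "weyl_eq N A ([s, t, s, t] @ [s]) [t]" by simp
  from weyl_eq_cancel_right[OF this assms(1)]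
  have "weyl_eq N A ([s, t, s] @ [t]) [t, s]" by simp
  from weyl_eq_cancel_right[OF this assms(2)] show ?thesis by simp
qed

text \<open>The empty sum is left out, so that every element has positive height.\<close>

inductive_set pos_cone :: "'v set" where
  root: "I \<in> N \<Longrightarrow> \<alpha> I \<in> pos_cone"
| sum: "x \<in> pos_cone \<Longrightarrow> y \<in> pos_cone \<Longrightarrow> x + y \<in> pos_cone"

lemma height_pos_cone: "x \<in> pos_cone \<Longrightarrow> B h x > 0"
  by (induction rule: pos_cone.induct) (simp_all add: height_pos form_add_right)

definition reduced :: "'a list \<Rightarrow> bool" where
  "reduced w \<longleftrightarrow> w \<in> lists N \<and> (\<forall>v. weyl_eq N A w v \<longrightarrow> length w \<le> length v)"

text \<open>For a reduced word \<open>w\<close> this says that \<open>s\<close> is not a right descent of \<open>w\<close>.\<close>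

definition no_descent :: "'a list \<Rightarrow> 'a \<Rightarrow> bool" where
  "no_descent w s \<longleftrightarrow> (\<forall>v. weyl_eq N A (w @ [s]) v \<longrightarrow> length w \<le> length v)"

lemma exists_reduced:
  assumes "w \<in> lists N"
  obtains v where "weyl_eq N A w v" "reduced v"
proof -
  obtain v where v: "weyl_eq N A w v" "\<And>u. weyl_eq N A w u \<Longrightarrow> length v \<le> length u"
    using ex_has_least_nat[of "weyl_eq N A w" w length, OF weyl_eq.refl[OF assms]] by auto
  have "reduced v"
    unfolding reduced_def
  proof (intro conjI allI impI)
    show "v \<in> lists N" using weyl_eq_lists[OF v(1)] ..
    show "length v \<le> length u" if "weyl_eq N A v u" for u
      by (rule v(2)[OF weyl_eq.trans[OF v(1) that]])
  qed
  from that[OF v(1) this] show ?thesis .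
qed

lemma reduced_butlast:
  assumes "reduced (u @ [t])"
  shows "reduced u"
  unfolding reduced_def
proof (intro conjI allI impI)
  show "u \<in> lists N" using assms by (simp add: reduced_def)
  fix v assume "weyl_eq N A u v"
  then have "weyl_eq N A (u @ [t]) (v @ [t])"
    using weyl_cong[of u v "[]" "[t]"] assms by (simp add: reduced_def)
  then have "length (u @ [t]) \<le> length (v @ [t])"
    using assms unfolding reduced_def by blast
  then show "length u \<le> length v" by simp
qed

text \<open>Induction on the length. Write \<open>w = u t\<close> with \<open>t \<noteq> s\<close>. If \<open>s\<close> and \<open>t\<close> commute, then \<open>s\<close> is not a
descent of \<open>u\<close> and \<open>w \<alpha>\<^sub>s = u \<alpha>\<^sub>s\<close>. Otherwise \<open>w \<alpha>\<^sub>s = u \<alpha>\<^sub>s + u \<alpha>\<^sub>t\<close>, which settles the case that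
\<open>s\<close> is not a descent of \<open>u\<close>. If it is one, then \<open>u = v s\<close> and \<open>w \<alpha>\<^sub>s = v s t \<alpha>\<^sub>s = v \<alpha>\<^sub>t\<close>; here
\<open>t\<close> is not a descent of \<open>v\<close>, since \<open>w s = v s t s = v t s t\<close> would otherwise be too short.\<close>

theorem no_descent_imp_pos:
  assumes "reduced w" "s \<in> N" "no_descent w s"
  shows "word_act w (\<alpha> s) \<in> pos_cone"
  using assms
proof (induction "length w" arbitrary: w s rule: less_induct)
  case less
  show ?case
  proof (cases w rule: rev_cases)
    case Nil
    then show ?thesis using less.prems by (simp add: pos_cone.root)
  next
    case (snoc u t)
    have u: "reduced u" "u \<in> lists N" and t: "t \<in> N"
      using less.prems(1) reduced_butlast snoc by (auto simp: reduced_def)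
    have s: "s \<in> N" by fact
    have min: "length w \<le> length v" if "weyl_eq N A (u @ [t, s]) v" for v
      using less.prems(3) that by (simp add: snoc no_descent_def)
    have "t \<noteq> s"
    proof
      assume "t = s"
      then have "weyl_eq N A (u @ [t, s]) u"
        using weyl_cong[OF weyl_eq.square[OF s], of u "[]"] u by simp
      from min[OF this] show False by (simp add: snoc)
    qed
    then consider (orth) "A s t = 0" | (braid) "A s t = -1"
      using cartan_off_diag[OF s t] by auto
    then show ?thesis
    proof cases
      case orth
      have "no_descent u s"
        unfolding no_descent_def
      proof (intro allI impI)
        fix v assume v: "weyl_eq N A (u @ [s]) v"
        have "weyl_eq N A (u @ [t, s]) (u @ [s, t])"
          using weyl_cong[OF weyl_eq.sym[OF weyl_eq_commute[OF s t]], of u "[]"] orth u \<open>t \<noteq> s\<close>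
          by simp
        moreover have "weyl_eq N A (u @ [s, t]) (v @ [t])"
          using weyl_cong[OF v, of "[]" "[t]"] t by simp
        ultimately have "length w \<le> length (v @ [t])"
          using min weyl_eq.trans by blast
        then show "length u \<le> length v" by (simp add: snoc)
      qed
      then have "word_act u (\<alpha> s) \<in> pos_cone"
        using less.hyps u s by (simp add: snoc)
      moreover have "reflect (\<alpha> t) (\<alpha> s) = \<alpha> s"
        using orth s t by (simp add: reflect_def root_form)
      ultimately show ?thesis by (simp add: snoc word_act_append)
    next
      case braid
      have ts: "reflect (\<alpha> t) (\<alpha> s) = \<alpha> s + \<alpha> t"
        using braid s t by (simp add: reflect_def root_form)
      show ?thesis
      proof (cases "no_descent u s")
        case True
        have "no_descent u t"
          using less.prems(1) unfolding snoc no_descent_def reduced_def by auto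
        with True have "word_act u (\<alpha> s) + word_act u (\<alpha> t) \<in> pos_cone"
          using less.hyps u s t by (simp add: snoc pos_cone.sum)
        then show ?thesis
          using linear_add[OF linear_word_act[of u]] by (simp add: snoc word_act_append ts)
      next
        case False
        then obtain v where v: "weyl_eq N A (u @ [s]) v" "length v < length u"
          by (auto simp: no_descent_def)
        have uv: "weyl_eq N A u (v @ [s])"
          using weyl_eq_cancel_right v(1) s by blast
        have vN: "v \<in> lists N" using weyl_eq_lists[OF v(1)] by simp
        have len: "length u \<le> Suc (length v')" if "weyl_eq N A v v'" for v'
        proof -
          have "weyl_eq N A u (v' @ [s])"
            using weyl_eq.trans[OF uv] weyl_cong[OF that, of "[]" "[s]"] s by simp
          then have "length u \<le> length (v' @ [s])" using u(1) unfolding reduced_def by blast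
          then show ?thesis by simp
        qed
        with v(2) vN have red: "reduced v"
          unfolding reduced_def by force
        have "no_descent v t"
          unfolding no_descent_def
        proof (intro allI impI)
          fix y assume y: "weyl_eq N A (v @ [t]) y"
          have "weyl_eq N A (u @ [t, s]) (v @ [s, t, s])"
            using weyl_cong[OF uv, of "[]" "[t, s]"] s t by simp
          moreover have "weyl_eq N A (v @ [s, t, s]) (v @ [t, s, t])"
            using weyl_cong[OF weyl_eq_braid3[OF s t], of v "[]"] braid vN \<open>t \<noteq> s\<close> by simp
          moreover have "weyl_eq N A (v @ [t, s, t]) (y @ [s, t])"
            using weyl_cong[OF y, of "[]" "[s, t]"] s t by simp
          ultimately have "weyl_eq N A (u @ [t, s]) (y @ [s, t])"
            by (blast intro: weyl_eq.trans)
          from min[OF this] show "length v \<le> length y"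
            using len[OF weyl_eq.refl[OF vN]] v(2) by (simp add: snoc)
        qed
        then have "word_act v (\<alpha> t) \<in> pos_cone"
          using less.hyps red t v(2) by (simp add: snoc)
        moreover have "reflect (\<alpha> s) (\<alpha> s + \<alpha> t) = \<alpha> t"
          using braid s t
          by (simp add: reflect_def form_add root_form cartan_sym[of t s] cartan_diag)
        ultimately show ?thesis
          by (simp add: snoc word_act_append ts word_act_cong[OF uv])
      qed
    qed
  qed
qed

text \<open>A nonempty reduced word \<open>u t\<close> maps \<open>\<alpha>\<^sub>t\<close> to \<open>- u \<alpha>\<^sub>t\<close>, the negative of a positive vector.\<close>

theorem word_act_pos_imp_trivial:
  assumes "w \<in> lists N" and pos: "\<And>s. s \<in> N \<Longrightarrow> word_act w (\<alpha> s) \<in> pos_cone"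
  shows "weyl_eq N A w []"
proof -
  obtain v where v: "weyl_eq N A w v" "reduced v"
    using exists_reduced[OF assms(1)] .
  have "v = []"
  proof (cases v rule: rev_cases)
    case (snoc u t)
    have t: "t \<in> N" using v snoc by (simp add: reduced_def)
    have "no_descent u t"
      using v(2) unfolding snoc no_descent_def reduced_def by auto
    then have "word_act u (\<alpha> t) \<in> pos_cone"
      using no_descent_imp_pos reduced_butlast v(2) snoc t by blast
    moreover have "word_act v (\<alpha> t) = - word_act u (\<alpha> t)"
    proof -
      have "reflect (\<alpha> t) (\<alpha> t) = - \<alpha> t"
        by (simp add: reflect_def root_norm[OF t] scaleR_2)
      then show ?thesis
        using linear_neg[OF linear_word_act[of u]] by (simp add: snoc word_act_append)
    qed
    ultimately have "B h (word_act v (\<alpha> t)) < 0"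
      using height_pos_cone form_scale_right[of h "-1"] by simp
    moreover have "word_act v (\<alpha> t) \<in> pos_cone"
      using pos[OF t] word_act_cong[OF v(1)] by simp
    ultimately show ?thesis using height_pos_cone by (meson not_less_iff_gr_or_eq)
  qed
  with v show ?thesis by simp
qed

lemma weyl_eq_rev:
  assumes "w \<in> lists N"
  shows "weyl_eq N A (w @ rev w) []"
  using assms
proof (induction w)
  case (Cons I w)
  then have "weyl_eq N A ([I] @ (w @ rev w) @ [I]) ([I] @ [] @ [I])"
    by (intro weyl_cong) auto
  moreover have "weyl_eq N A [I, I] []" using Cons by (intro weyl_eq.square) auto
  ultimately show ?case by (auto intro: weyl_eq.trans)
qed (auto intro: weyl_eq.refl)

text \<open>The geometric representation is faithful.\<close>

theorem weyl_eq_iff_word_act: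
  assumes "u \<in> lists N" "v \<in> lists N"
  shows "weyl_eq N A u v \<longleftrightarrow> word_act u = word_act v"
proof
  assume eq: "word_act u = word_act v"
  have "word_act (rev v @ u) (\<alpha> s) = \<alpha> s" for s
    by (simp add: word_act_append eq word_act_rev[OF assms(2)])
  then have "weyl_eq N A (rev v @ u) []"
    using assms by (intro word_act_pos_imp_trivial) (auto simp: in_lists_conv_set pos_cone.root)
  then have "weyl_eq N A (v @ (rev v @ u) @ []) (v @ [] @ [])"
    using assms by (intro weyl_cong) auto
  moreover have "weyl_eq N A ([] @ (v @ rev v) @ u) ([] @ [] @ u)"
    using assms by (intro weyl_cong weyl_eq_rev) auto
  ultimately show "weyl_eq N A u v"
    by (metis append.assoc append_Nil append_Nil2 weyl_eq.sym weyl_eq.trans)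
qed (rule word_act_cong)

end


section \<open>Hermitian matrices as a quadratic space\<close>

lemmas quat_comps = quat_eq_iff zero_quat_def one_quat_def plus_quat_def uminus_quat_def
  minus_quat_def scaleR_quat_def times_quat_def inner_quat_def qcnj_def

lemma of_real_quat: "(of_real r :: quat) = Quat r 0 0 0"
  by (simp add: of_real_def scaleR_quat_def one_quat_def)

lemma of_int_quat: "(of_int n :: quat) = Quat (of_int n) 0 0 0"
  using of_real_quat[of "of_int n"] by simp

lemma qcnj_mult: "qcnj (x * y) = qcnj y * qcnj x"
  by (simp add: quat_comps algebra_simps)

lemma qcnj_simps [simp]: "qcnj (x + y) = qcnj x + qcnj y" "qcnj (x - y) = qcnj x - qcnj y"
  "qcnj (- x) = - qcnj x" "qcnj (qcnj x) = x" "qcnj 0 = 0" "qcnj 1 = 1"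
  "qcnj (r *\<^sub>R x) = r *\<^sub>R qcnj x" "qcnj (of_real r) = of_real r"
  by (simp_all add: quat_comps of_real_quat)

lemma quat_mult_qcnj: "x * qcnj x = of_real (inner x x)" "qcnj x * x = of_real (inner x x)"
  by (simp_all add: quat_comps of_real_quat algebra_simps)

lemma inner_quat_mult: "inner (x * y) (x * y) = inner x x * inner y (y :: quat)"
  by (simp add: quat_comps algebra_simps)

lemma inner_quat_qcnj [simp]: "inner (qcnj x) (qcnj y) = inner x y"
  by (simp add: quat_comps)

lemma inner_quat_mult_left: "inner (a * x) (a * y) = inner a a * inner x (y :: quat)"
  by (simp add: quat_comps algebra_simps)

lemma inner_quat_mult_right: "inner (x * a) (y * a) = inner a a * inner x (y :: quat)"
  by (simp add: quat_comps algebra_simps)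

lemma inner_quat_eq_qRe: "inner x y = qRe (x * qcnj y)"
  by (simp add: quat_comps)

lemma qRe_mult_commute: "qRe (x * y) = qRe (y * x)"
  by (simp add: quat_comps algebra_simps)

lemma quat_zero_one_comps [simp]: "qRe 0 = 0" "qIm1 0 = 0" "qIm2 0 = 0" "qIm3 0 = 0"
  "qRe 1 = 1" "qIm1 1 = 0" "qIm2 1 = 0" "qIm3 1 = 0"
  by (simp_all add: zero_quat_def one_quat_def)

lemma inner_quat_one [simp]: "inner x (1 :: quat) = qRe x" "inner (1 :: quat) x = qRe x"
  by (simp_all add: quat_comps)

lemma mat2_nth [simp]: "mat2 a b c d $ 1 $ 1 = a" "mat2 a b c d $ 1 $ 2 = b"
  "mat2 a b c d $ 2 $ 1 = c" "mat2 a b c d $ 2 $ 2 = d"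
  by (simp_all add: mat2_def)

lemma qmat_eq_iff: "(S :: qmat) = T \<longleftrightarrow> S $ 1 $ 1 = T $ 1 $ 1 \<and> S $ 1 $ 2 = T $ 1 $ 2 \<and>
    S $ 2 $ 1 = T $ 2 $ 1 \<and> S $ 2 $ 2 = T $ 2 $ 2"
  by (auto simp: vec_eq_iff forall_2)

lemma qmat_cases: obtains a b c d where "S = mat2 a b c d"
  by (metis mat2_nth qmat_eq_iff)

lemma mat2_mult: "mat2 a b c d ** mat2 a' b' c' d' =
    mat2 (a * a' + b * c') (a * b' + b * d') (c * a' + d * c') (c * b' + d * d')"
  by (simp add: qmat_eq_iff matrix_matrix_mult_def sum_2)

lemma mat2_one: "mat 1 = mat2 1 0 0 1"
  by (simp add: qmat_eq_iff mat_def)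

lemma mat2_uminus: "- mat2 a b c d = mat2 (- a) (- b) (- c) (- d)"
  by (simp add: qmat_eq_iff)

lemma qadjoint_mat2: "qadjoint (mat2 a b c d) = mat2 (qcnj a) (qcnj c) (qcnj b) (qcnj d)"
  by (simp add: qmat_eq_iff qadjoint_def)

lemma mat2_eq_iff: "mat2 a b c d = mat2 a' b' c' d' \<longleftrightarrow> a = a' \<and> b = b' \<and> c = c' \<and> d = d'"
  by (simp add: qmat_eq_iff)

lemma qadjoint_mult: "qadjoint (S ** T) = qadjoint T ** qadjoint S"
  by (cases S rule: qmat_cases; cases T rule: qmat_cases)
     (simp add: mat2_mult qadjoint_mat2 qcnj_mult)

lemma qmat_mult_minus: "(- S) ** T = - (S ** (T :: qmat))" "S ** (- T) = - (S ** (T :: qmat))"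
  by (simp_all add: vec_eq_iff matrix_matrix_mult_def sum_2)

type_synonym herm = "real \<times> quat \<times> real"

definition hmat :: "herm \<Rightarrow> qmat" where
  "hmat X = (case X of (p, z, r) \<Rightarrow> mat2 (of_real p) z (qcnj z) (of_real r))"

definition hdet :: "herm \<Rightarrow> real" where
  "hdet X = (case X of (p, z, r) \<Rightarrow> p * r - inner z z)"

text \<open>The polar form of \<open>- hdet\<close>, scaled so that matrices of determinant \<open>-1\<close> have norm 2.\<close>

definition hform :: "herm \<Rightarrow> herm \<Rightarrow> real" where
  "hform X Y = (case (X, Y) of ((p, z, r), (q, w, s)) \<Rightarrow> 2 * inner z w - p * s - r * q)"

text \<open>The adjugate matrix.\<close>

definition hadj :: "herm \<Rightarrow> herm" where
  "hadj X = (case X of (p, z, r) \<Rightarrow> (r, - z, p))"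

text \<open>The coordinates of \<open>S X S\<^sup>\<dagger>\<close>; see \<open>hmat_act\<close>.\<close>

definition act :: "qmat \<Rightarrow> herm \<Rightarrow> herm" where
  "act S X = (let a = S $ 1 $ 1; b = S $ 1 $ 2; c = S $ 2 $ 1; d = S $ 2 $ 2 in
     case X of (p, z, r) \<Rightarrow>
       (p * inner a a + r * inner b b + 2 * inner (a * z) b,
        p *\<^sub>R (a * qcnj c) + r *\<^sub>R (b * qcnj d) + a * z * qcnj d + b * qcnj z * qcnj c,
        p * inner c c + r * inner d d + 2 * inner (c * z) d))"

lemma herm_simps [simp]:
  "hmat (p, z, r) = mat2 (of_real p) z (qcnj z) (of_real r)"
  "hdet (p, z, r) = p * r - inner z z"
  "hform (p, z, r) (q, w, s) = 2 * inner z w - p * s - r * q"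
  "hadj (p, z, r) = (r, - z, p)"
  "act (mat2 a b c d) (p, z, r) =
     (p * inner a a + r * inner b b + 2 * inner (a * z) b,
      p *\<^sub>R (a * qcnj c) + r *\<^sub>R (b * qcnj d) + a * z * qcnj d + b * qcnj z * qcnj c,
      p * inner c c + r * inner d d + 2 * inner (c * z) d)"
  by (simp_all add: hmat_def hdet_def hform_def hadj_def act_def)

lemma hmat_eq_iff [simp]: "hmat X = hmat Y \<longleftrightarrow> X = Y"
  by (cases X; cases Y) (auto simp: mat2_eq_iff)

lemma quat_mult_qcnj_sum: "x * qcnj y + y * qcnj x = of_real (2 * inner x y)"
  by (simp add: quat_comps of_real_quat algebra_simps)

lemma hmat_act: "hmat (act S X) = S ** hmat X ** qadjoint S"
proof (cases S rule: qmat_cases; cases X)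
  fix a b c d p z r assume S: "S = mat2 a b c d" and X: "X = (p, z, r)"
  have diag: "of_real (p * inner u u + r * inner v v + 2 * inner (u * z) v) =
     (u * of_real p + v * qcnj z) * qcnj u + (u * z + v * of_real r) * qcnj v" for u v
    by (simp add: quat_comps of_real_quat algebra_simps)
  have off: "p *\<^sub>R (u * qcnj x) + r *\<^sub>R (v * qcnj y) + u * z * qcnj y + v * qcnj z * qcnj x =
     (u * of_real p + v * qcnj z) * qcnj x + (u * z + v * of_real r) * qcnj y" for u v x y
    by (simp add: algebra_simps scaleR_conv_of_real) (simp add: quat_comps of_real_quat algebra_simps)
  show ?thesis
    unfolding S X herm_simps mat2_mult qadjoint_mat2 mat2_eq_iff
    by (intro conjI diag off, simp only: off[symmetric], simp add: qcnj_mult algebra_simps)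
qed

lemma act_mult: "act (S ** T) X = act S (act T X)"
proof -
  have "hmat (act (S ** T) X) = hmat (act S (act T X))"
    by (simp only: hmat_act qadjoint_mult matrix_mul_assoc)
  then show ?thesis by simp
qed

lemma act_one [simp]: "act (mat 1) X = X"
  by (cases X) (simp add: mat2_one)

lemma act_uminus [simp]: "act (- S) X = act S X"
  by (cases S rule: qmat_cases; cases X) (simp add: mat2_uminus)

lemma linear_act: "linear (act S)"
  by (cases S rule: qmat_cases)
     (auto simp: linear_iff algebra_simps)

lemma hform_add: "hform (X + Y) Z = hform X Z + hform Y Z"
  by (cases X; cases Y; cases Z) (simp add: algebra_simps inner_add_left)

lemma hform_scale: "hform (c *\<^sub>R X) Z = c * hform X Z"
  by (cases X; cases Z) (simp add: algebra_simps)

lemma hform_sym: "hform X Y = hform Y X"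
  by (cases X; cases Y) (simp add: algebra_simps inner_commute)

lemma hform_self: "hform X X = - 2 * hdet X"
  by (cases X) simp

lemma hform_polar: "hform X Y = hdet X + hdet Y - hdet (X + Y)"
  by (cases X; cases Y) (simp add: algebra_simps inner_add_left inner_add_right inner_commute)

lemma inner_sum4:
  fixes u v s t :: "'a::real_inner"
  shows "inner (p *\<^sub>R u + r *\<^sub>R v + s + t) (p *\<^sub>R u + r *\<^sub>R v + s + t) =
     p\<^sup>2 * inner u u + r\<^sup>2 * inner v v + inner s s + inner t t + 2 * p * r * inner u v +
     2 * p * inner u s + 2 * p * inner u t + 2 * r * inner v s + 2 * r * inner v t +
     2 * inner s t"
  by (simp add: inner_add_left inner_add_right inner_commute[of v u] inner_commute[of s u]
      inner_commute[of t u] inner_commute[of s v] inner_commute[of t v] inner_commute[of t s]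
      power2_eq_square algebra_simps)

text \<open>The identity \<open>2 Re u Re v - Re (u v) = Re (u \<cdot> qcnj v)\<close> with \<open>u = x z\<close> and \<open>v = y z\<close>.\<close>

lemma hdet_act_aux:
  fixes x y z :: quat
  shows "2 * qRe (x * z) * qRe (y * z) - qRe (x * z * (y * z)) = inner z z * inner x y"
  by (simp add: quat_comps algebra_simps)

text \<open>A determinant of \<open>S\<close> itself is not at hand, since quaternions do not commute; the determinant of
\<open>S S\<^sup>\<dagger>\<close> takes the place of its squared modulus. After expansion, all products of four entries of \<open>S\<close> reduce to
the squared norms of the entries and to \<open>x = qcnj b * a\<close> and \<open>y = qcnj d * c\<close>.\<close>

theorem hdet_act: "hdet (act S X) = hdet (act S (1, 0, 1)) * hdet X"
proof (cases S rule: qmat_cases; cases X)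
  fix a b c d p z r assume S: "S = mat2 a b c d" and X: "X = (p, z, r)"
  define x y where "x = qcnj b * a" and "y = qcnj d * c"
  have xz: "inner (a * z) b = qRe (x * z)" and yz: "inner (c * z) d = qRe (y * z)"
    unfolding x_def y_def by (simp_all add: quat_comps algebra_simps)
  let ?u = "a * qcnj c" and ?v = "b * qcnj d" and ?s = "a * z * qcnj d" and ?t = "b * qcnj z * qcnj c"
  have norms: "inner ?u ?u = inner a a * inner c c" "inner ?v ?v = inner b b * inner d d"
    "inner ?s ?s = inner a a * inner z z * inner d d"
    "inner ?t ?t = inner b b * inner z z * inner c c"
    by (simp_all add: inner_quat_mult)
  have re: "inner (qcnj c) (z * qcnj d) = qRe (y * z)" "inner (qcnj d) (qcnj z * qcnj c) = qRe (y * z)"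
    "inner a (b * qcnj z) = qRe (x * z)" "inner b (a * z) = qRe (x * z)"
    unfolding x_def y_def by (simp_all add: quat_comps algebra_simps)
  have us: "inner ?u ?s = inner a a * qRe (y * z)" and vt: "inner ?v ?t = inner b b * qRe (y * z)"
    using inner_quat_mult_left[of a "qcnj c" "z * qcnj d"]
      inner_quat_mult_left[of b "qcnj d" "qcnj z * qcnj c"]
    by (simp_all only: re mult.assoc)
  have ut: "inner ?u ?t = inner c c * qRe (x * z)" and vs: "inner ?v ?s = inner d d * qRe (x * z)"
    using inner_quat_mult_right[of a "qcnj c" "b * qcnj z"] inner_quat_mult_right[of b "qcnj d" "a * z"]
    by (simp_all only: re inner_quat_qcnj)
  have "inner ?u ?v = qRe (a * (qcnj c * d * qcnj b))"
    by (simp add: inner_quat_eq_qRe qcnj_mult mult.assoc)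
  also have "\<dots> = qRe (qcnj c * d * qcnj b * a)"
    by (rule qRe_mult_commute)
  also have "\<dots> = qRe (qcnj y * x)"
    by (simp add: x_def y_def qcnj_mult mult.assoc)
  also have "\<dots> = inner x y"
    unfolding inner_quat_eq_qRe by (rule qRe_mult_commute)
  finally have uv: "inner ?u ?v = inner x y" .
  have "inner ?s ?t = qRe (a * z * qcnj d * c * z * qcnj b)"
    by (simp add: inner_quat_eq_qRe qcnj_mult mult.assoc)
  also have "\<dots> = qRe (qcnj b * (a * z * qcnj d * c * z))"
    by (rule qRe_mult_commute)
  finally have st: "inner ?s ?t = qRe (x * z * (y * z))"
    by (simp add: x_def y_def mult.assoc)
  then have st': "inner ?s ?t = 2 * qRe (x * z) * qRe (y * z) - inner z z * inner x y"
    using hdet_act_aux[of x z y] by linarith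
  have norm: "inner (p *\<^sub>R ?u + r *\<^sub>R ?v + ?s + ?t) (p *\<^sub>R ?u + r *\<^sub>R ?v + ?s + ?t) =
     p\<^sup>2 * (inner a a * inner c c) + r\<^sup>2 * (inner b b * inner d d) +
     inner z z * (inner a a * inner d d + inner b b * inner c c) + 2 * p * r * inner x y +
     2 * p * inner a a * qRe (y * z) + 2 * p * inner c c * qRe (x * z) +
     2 * r * inner d d * qRe (x * z) + 2 * r * inner b b * qRe (y * z) +
     2 * (2 * qRe (x * z) * qRe (y * z) - inner z z * inner x y)"
    unfolding inner_sum4 norms us vt ut vs uv st' by algebra
  have "inner (?u + ?v) (?u + ?v) = inner a a * inner c c + inner b b * inner d d + 2 * inner x y"
    by (simp add: inner_add_left inner_add_right inner_commute[of ?v ?u] norms uv)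
  then have one: "hdet (act S (1, 0, 1)) = inner a a * inner d d + inner b b * inner c c - 2 * inner x y"
    by (simp add: S algebra_simps)
  show ?thesis
    unfolding one unfolding S X herm_simps norm xz yz
    by (simp add: algebra_simps power2_eq_square)
qed

lemma SL2_H_iff: "S \<in> carrier SL2_H \<longleftrightarrow> hdet (act S (1, 0, 1)) = 1"
proof -
  have "hermitian_det (hmat X) = of_real (hdet X)" for X
    by (cases X) (simp add: hermitian_det_def quat_mult_qcnj)
  moreover have "S ** qadjoint S = hmat (act S (1, 0, 1))"
    by (simp add: hmat_act flip: mat2_one)
  ultimately show ?thesis by (simp add: SL2_H_def)
qed

lemma hdet_act_SL2: "S \<in> carrier SL2_H \<Longrightarrow> hdet (act S X) = hdet X"
  using hdet_act[of S X] by (simp add: SL2_H_iff)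

lemma hform_act:
  assumes "S \<in> carrier SL2_H"
  shows "hform (act S X) (act S Y) = hform X Y"
  using assms by (simp add: hform_polar hdet_act_SL2 flip: linear_add[OF linear_act])

lemma hmat_mult_hadj: "hmat X ** hmat (hadj X) = hdet X *\<^sub>R mat 1"
  by (cases X) (simp add: mat2_mult mat2_one qmat_eq_iff quat_mult_qcnj of_real_def algebra_simps)

text \<open>As \<open>S S\<^sup>\<dagger>\<close> is Hermitian of determinant 1, its inverse is its adjugate, and \<open>S\<^sup>\<dagger> adj(S S\<^sup>\<dagger>)\<close> is the
inverse of \<open>S\<close>.\<close>

lemma SL2_H_right_inverse:
  assumes "S \<in> carrier SL2_H"
  obtains T where "T \<in> carrier SL2_H" "S ** T = mat 1"
proof
  let ?Y = "act S (1, 0, 1)"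
  let ?T = "qadjoint S ** hmat (hadj ?Y)"
  have "S ** qadjoint S = hmat ?Y"
    by (simp add: hmat_act flip: mat2_one)
  then show inv: "S ** ?T = mat 1"
    using assms hmat_mult_hadj[of ?Y] by (simp add: matrix_mul_assoc SL2_H_iff)
  have "hdet (act S (act ?T (1, 0, 1))) = 1"
    by (simp add: inv flip: act_mult)
  then show "?T \<in> carrier SL2_H"
    using assms by (simp add: SL2_H_iff hdet_act_SL2)
qed

text \<open>For \<open>hdet R = -1\<close> this is the reflection in the norm 2 vector \<open>R\<close>.\<close>

lemma act_hmat_hadj: "act (hmat R) (hadj X) = - hform X R *\<^sub>R R - hdet R *\<^sub>R X"
  by (cases R; cases X)
     (simp add: quat_comps of_real_quat algebra_simps)

lemma hadj_hadj [simp]: "hadj (hadj X) = X"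
  by (cases X) simp

lemma hadj_combine: "hadj (s *\<^sub>R X - t *\<^sub>R Y) = s *\<^sub>R hadj X - t *\<^sub>R hadj Y"
  by (cases X; cases Y) simp

text \<open>Both sides are combinations of \<open>hadj R\<close> and \<open>X\<close> by \<open>act_hmat_hadj\<close>. This is what turns a product
of two reflections into the action of a single matrix.\<close>

lemma hadj_act: "hadj (act (hmat R) X) = act (hmat (hadj R)) (hadj X)"
proof -
  have "hadj (act (hmat R) X) = hadj (- hform (hadj X) R *\<^sub>R R - hdet R *\<^sub>R hadj X)"
    using act_hmat_hadj[of R "hadj X"] by simp
  also have "\<dots> = - hform (hadj X) R *\<^sub>R hadj R - hdet R *\<^sub>R X"
    by (simp only: hadj_combine hadj_hadj)
  also have "hform (hadj X) R = hform X (hadj R)"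
    by (cases X; cases R) simp
  also have "hdet R = hdet (hadj R)"
    by (cases R) simp
  finally show ?thesis by (simp only: act_hmat_hadj)
qed

text \<open>The images of the two diagonal matrix units force \<open>T = mat2 a 0 0 d\<close>; from the off-diagonal ones
\<open>d = a\<close>, and \<open>a\<close> commutes with \<open>i\<close> and \<open>j\<close>.\<close>

lemma act_faithful:
  assumes "\<And>X. act T X = X"
  shows "T = mat 1 \<or> T = - mat 1"
proof (cases T rule: qmat_cases)
  case (1 a b c d)
  have "act T (1, 0, 0) = (1, 0, 0)" "act T (0, 0, 1) = (0, 0, 1)"
    by (simp_all only: assms)
  then have bc: "b = 0" "c = 0" and ad: "inner a a = 1" "inner d d = 1"
    by (simp_all add: 1)
  have z: "a * z * qcnj d = z" for z
    using assms[of "(0, z, 0)"] by (simp add: 1 bc)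
  have "a = a * qcnj d * d"
    by (simp add: mult.assoc quat_mult_qcnj ad)
  also have "\<dots> = d" using z[of 1] by simp
  finally have "a = d" .
  have comm: "a * z = z * a" for z
  proof -
    have "a * z = a * z * (qcnj d * d)" by (simp add: quat_mult_qcnj ad)
    also have "\<dots> = z * a" using z[of z] by (simp add: \<open>a = d\<close> flip: mult.assoc)
    finally show ?thesis .
  qed
  from comm[of qi] comm[of qj] have "qIm1 a = 0" "qIm2 a = 0" "qIm3 a = 0"
    by (simp_all add: quat_comps qi_def qj_def)
  with ad(1) have "a = of_real (qRe a)" "(qRe a)\<^sup>2 = 1"
    by (simp_all add: quat_comps of_real_quat power2_eq_square)
  then have "a = 1 \<or> a = - 1"
    by (metis of_real_1 of_real_minus power2_eq_1_iff)
  then show ?thesis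
    using 1 bc \<open>a = d\<close> by (auto simp: mat2_one mat2_uminus)
qed

text \<open>This is the reason why a product of an odd number of reflections is not the action of a
  matrix. A matrix acting as \<open>hadj\<close> would have the form \<open>mat2 0 b c 0\<close> with
  \<open>b z\<^sup>* = z b\<close> for all \<open>z\<close>; for \<open>z = i, j, k\<close> this makes all components of \<open>b\<close> vanish.\<close>

lemma act_neq_hadj: "\<exists>X. act T X \<noteq> hadj X"
proof (rule ccontr)
  assume "\<not> ?thesis"
  then have T: "act T X = hadj X" for X by blast
  obtain a b c d where abcd: "T = mat2 a b c d" by (rule qmat_cases)
  have ad: "a = 0" "d = 0" and bc: "inner b b = 1" "inner c c = 1"
    using T[of "(1, 0, 0)"] T[of "(0, 0, 1)"] by (simp_all add: abcd)
  have z: "b * qcnj z * qcnj c = - z" for z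
    using T[of "(0, z, 0)"] by (simp add: abcd ad)
  have comm: "b * qcnj z = z * b" for z
  proof -
    have "c = qcnj (qcnj b * (b * qcnj c))"
      by (simp add: qcnj_mult quat_mult_qcnj bc mult.assoc)
    also have "\<dots> = - b" using z[of 1] by simp
    finally have "c = - b" .
    have "b * qcnj z = b * qcnj z * (qcnj c * c)" by (simp add: quat_mult_qcnj bc)
    also have "\<dots> = - z * c" using z[of z] by (simp flip: mult.assoc)
    finally show ?thesis using \<open>c = - b\<close> by simp
  qed
  have "b = 0"
    using comm[of qi] comm[of qj] comm[of qk] by (simp add: quat_comps qi_def qj_def qk_def)
  with bc show False by simp
qed

text \<open>Positive definiteness of a Hermitian matrix.\<close>

definition hpos :: "herm \<Rightarrow> bool" where
  "hpos X \<longleftrightarrow> fst X > 0 \<and> hdet X > 0"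

lemma hpos_hadj: "hpos X \<Longrightarrow> hpos (hadj X)"
proof (cases X)
  fix p z r assume X: "X = (p, z, r)" and "hpos X"
  then have "p > 0" "p * r > inner z z" by (simp_all add: hpos_def)
  moreover from this have "p * r > 0" using inner_ge_zero[of z] by linarith
  ultimately show ?thesis by (simp add: X hpos_def zero_less_mult_iff mult.commute)
qed

lemma hpos_act:
  assumes "S \<in> carrier SL2_H" "hpos X"
  shows "hpos (act S X)"
proof (cases S rule: qmat_cases; cases X)
  fix a b c d p z r assume S: "S = mat2 a b c d" and X: "X = (p, z, r)"
  obtain p' z' r' where Y: "act S X = (p', z', r')" by (cases "act S X")
  have det: "hdet (act S X) > 0"
    using assms by (simp add: hdet_act_SL2 hpos_def)
  have p: "p > 0" "hdet X > 0" using assms(2) by (simp_all add: X hpos_def)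
  have "p * p' = inner (p *\<^sub>R a + b * qcnj z) (p *\<^sub>R a + b * qcnj z) + inner b b * hdet X"
    using Y by (auto simp: S X) (simp add: quat_comps algebra_simps)
  moreover have "inner b b * hdet X \<ge> 0" using p by (intro mult_nonneg_nonneg) auto
  ultimately have "p * p' \<ge> 0"
    using inner_ge_zero[of "p *\<^sub>R a + b * qcnj z"] by linarith
  then have "p' \<ge> 0" using p by (simp add: zero_le_mult_iff)
  moreover have "p' \<noteq> 0"
  proof
    assume "p' = 0"
    then have "inner z' z' < 0" using det by (simp add: Y)
    then show False using inner_ge_zero[of z'] by linarith
  qed
  ultimately show ?thesis using det by (simp add: hpos_def Y)
qed

text \<open>The reversed Cauchy-Schwarz inequality inside the light cone.\<close>

lemma hform_hpos_neg:
  assumes "hpos X" "hpos Y"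
  shows "hform X Y < 0"
proof (cases X; cases Y)
  fix p z r q w s assume X: "X = (p, z, r)" and Y: "Y = (q, w, s)"
  have pq: "p > 0" "q > 0" and det: "p * r > inner z z" "q * s > inner w w"
    using assms by (simp_all add: X Y hpos_def)
  have "0 \<le> inner (p *\<^sub>R w - q *\<^sub>R z) (p *\<^sub>R w - q *\<^sub>R z)" by simp
  also have "\<dots> = p\<^sup>2 * inner w w + q\<^sup>2 * inner z z - 2 * p * q * inner z w"
    by (simp add: inner_diff_left inner_diff_right inner_commute[of w z] algebra_simps power2_eq_square)
  also have "\<dots> < p\<^sup>2 * (q * s) + q\<^sup>2 * (p * r) - 2 * p * q * inner z w"
    using add_strict_mono[OF mult_strict_left_mono[OF det(2), of "p\<^sup>2"]
        mult_strict_left_mono[OF det(1), of "q\<^sup>2"]] pq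
    by simp
  also have "\<dots> = p * q * - hform X Y"
    by (simp add: X Y algebra_simps power2_eq_square)
  finally show ?thesis using pq by (simp add: zero_less_mult_iff mult_less_0_iff)
qed


section \<open>The groups \<open>SL\<^sub>2\<close> and \<open>PSL\<^sub>2\<close> over the quaternions\<close>

lemma SL2_H_simps [simp]: "mult SL2_H = (**)" "one SL2_H = mat 1"
  by (simp_all add: SL2_H_def)

lemma SL2_H_one: "mat 1 \<in> carrier SL2_H"
  by (simp add: SL2_H_iff)

lemma SL2_H_mult: "S \<in> carrier SL2_H \<Longrightarrow> T \<in> carrier SL2_H \<Longrightarrow> S ** T \<in> carrier SL2_H"
  by (simp add: SL2_H_iff[of "S ** T"] act_mult hdet_act_SL2)

lemma SL2_H_uminus: "- S \<in> carrier SL2_H \<longleftrightarrow> S \<in> carrier SL2_H"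
  by (simp add: SL2_H_iff)

interpretation SL2_H: group SL2_H
proof (rule groupI)
  fix S assume S: "S \<in> carrier SL2_H"
  obtain T where T: "T \<in> carrier SL2_H" "S ** T = mat 1"
    using SL2_H_right_inverse[OF S] .
  obtain U where U: "U \<in> carrier SL2_H" "T ** U = mat 1"
    using SL2_H_right_inverse[OF T(1)] .
  have "S = S ** (T ** U)" by (simp add: U)
  also have "\<dots> = U" by (simp add: T matrix_mul_assoc)
  finally show "\<exists>T\<in>carrier SL2_H. T \<otimes>\<^bsub>SL2_H\<^esub> S = \<one>\<^bsub>SL2_H\<^esub>"
    using T U by auto
qed (simp_all add: SL2_H_mult SL2_H_one matrix_mul_assoc)

interpretation SL2_H_centre: normal "{mat 1, - mat 1}" SL2_H
proof -
  have sub: "subgroup {mat 1, - mat 1} SL2_H"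
  proof (rule SL2_H.subgroupI)
    fix S assume S: "S \<in> {mat 1, - mat 1 :: qmat}"
    then have "inv\<^bsub>SL2_H\<^esub> S = S"
      by (intro SL2_H.inv_equality) (auto simp: qmat_mult_minus SL2_H_one SL2_H_uminus)
    with S show "inv\<^bsub>SL2_H\<^esub> S \<in> {mat 1, - mat 1}" by simp
  qed (auto simp: qmat_mult_minus SL2_H_one SL2_H_uminus)
  have "S \<otimes>\<^bsub>SL2_H\<^esub> C \<otimes>\<^bsub>SL2_H\<^esub> inv\<^bsub>SL2_H\<^esub> S \<in> {mat 1, - mat 1}"
    if "S \<in> carrier SL2_H" "C \<in> {mat 1, - mat 1}" for S C
    using that SL2_H.r_inv[OF that(1)] by (auto simp: qmat_mult_minus)
  with sub show "{mat 1, - mat 1} \<lhd> SL2_H"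
    by (subst SL2_H.normal_inv_iff) blast
qed

lemma PSL_class_eq: "PSL_class S = {S, - S}"
  by (auto simp: PSL_class_def r_coset_def qmat_mult_minus)

lemma PSL_class_eq_iff: "PSL_class S = PSL_class T \<longleftrightarrow> S = T \<or> S = - T"
  by (auto simp: PSL_class_eq doubleton_eq_iff)

lemma group_PSL2_H: "group PSL2_H"
  unfolding PSL2_H_def by (rule SL2_H_centre.factorgroup_is_group)

lemma carrier_PSL2_H: "carrier PSL2_H = PSL_class ` carrier SL2_H"
  by (auto simp: PSL2_H_def FactGroup_def RCOSETS_def PSL_class_def)

lemma PSL_class_mult:
  "S \<in> carrier SL2_H \<Longrightarrow> T \<in> carrier SL2_H \<Longrightarrow>
   PSL_class S \<otimes>\<^bsub>PSL2_H\<^esub> PSL_class T = PSL_class (S ** T)"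
  using SL2_H_centre.rcos_sum[of S T] by (simp add: PSL2_H_def FactGroup_def PSL_class_def)

lemma one_PSL2_H: "\<one>\<^bsub>PSL2_H\<^esub> = PSL_class (mat 1)"
  by (auto simp: PSL2_H_def FactGroup_def PSL_class_eq)

text \<open>The kernel of the action on Hermitian matrices is \<open>{1, -1}\<close>.\<close>

lemma PSL_class_eqI:
  assumes "S \<in> carrier SL2_H" "T \<in> carrier SL2_H" "\<And>X. act S X = act T X"
  shows "PSL_class S = PSL_class T"
proof -
  obtain U where U: "U \<in> carrier SL2_H" "T ** U = mat 1"
    using SL2_H_right_inverse[OF assms(2)] .
  then have UT: "U ** T = mat 1"
    using SL2_H.inv_comm[of T U] assms(2) by simp
  have "act (U ** S) X = X" for X
    by (simp add: act_mult assms(3)) (simp add: UT flip: act_mult)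
  then have "U ** S = mat 1 \<or> U ** S = - mat 1" by (rule act_faithful)
  moreover have "S = T ** (U ** S)" by (simp add: U matrix_mul_assoc)
  ultimately show ?thesis
    by (auto simp: PSL_class_eq_iff qmat_mult_minus)
qed


section \<open>The root lattice of \<open>A\<^sub>4\<^sup>+\<^sup>+\<close>\<close>

lemma sigma_eq: "\<sigma> = 1 - \<tau>"
  by (simp add: \<sigma>_def \<tau>_def field_simps)

lemma tau_mult: "\<tau> * \<tau> = \<tau> + 1" "\<tau> * (\<tau> * x) = \<tau> * x + x"
proof -
  show "\<tau> * \<tau> = \<tau> + 1" by (simp add: \<tau>_def field_simps)
  then show "\<tau> * (\<tau> * x) = \<tau> * x + x"
    by (simp add: algebra_simps flip: mult.assoc)
qed

lemma simple_root_eqs: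
  "simple_root (Suc 0) = Quat 1 0 0 0" "simple_root 2 = Quat (-1/2) (1/2) (-1/2) (-1/2)"
  "simple_root 3 = Quat 0 (-1) 0 0" "simple_root 4 = Quat 0 (1/2) (\<sigma>/2) (\<tau>/2)"
  by (simp_all add: simple_root_def quat_comps qi_def qj_def qk_def)

lemma sum_1_4: "(\<Sum>i = 1..4. f i) = f (Suc 0) + f 2 + f 3 + f (4::nat)"
  by (simp add: numeral_eq_Suc add.assoc)

lemma highest_root_eq: "highest_root = Quat (1/2) 0 (-\<tau>/2) (-\<sigma>/2)"
  unfolding highest_root_def sum_1_4 simple_root_eqs by (simp add: quat_comps sigma_eq field_simps)

definition herm_root :: "int \<Rightarrow> herm" where
  "herm_root I = (if I = -1 then (-1, 0, 1) else if I = 0 then (1, - highest_root, 0)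
     else (0, simple_root (nat I), 0))"

lemma herm_root_eqs: "herm_root (-1) = (-1, Quat 0 0 0 0, 1)"
  "herm_root 0 = (1, Quat (-1/2) 0 (\<tau>/2) (\<sigma>/2), 0)" "herm_root 1 = (0, Quat 1 0 0 0, 0)"
  "herm_root 2 = (0, Quat (-1/2) (1/2) (-1/2) (-1/2), 0)" "herm_root 3 = (0, Quat 0 (-1) 0 0, 0)"
  "herm_root 4 = (0, Quat 0 (1/2) (\<sigma>/2) (\<tau>/2), 0)"
  by (simp_all add: herm_root_def simple_root_eqs highest_root_eq zero_quat_def uminus_quat_def)

text \<open>The vector with inner product 1 with every simple root.\<close>

definition weyl_vec :: herm where
  "weyl_vec = (-6, Quat (1/2) (-1/2) (-3/2 + \<sigma>) (-3/2 + \<tau>), -5)"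

abbreviation "nodes \<equiv> A4pp_nodes"

lemma hform_roots: "I \<in> nodes \<Longrightarrow> J \<in> nodes \<Longrightarrow>
    hform (herm_root I) (herm_root J) = of_int (A4pp_cartan I J)"
  unfolding A4pp_nodes_def
  by (elim insertE emptyE; hypsubst; simp add: herm_root_eqs A4pp_cartan_def doubleton_eq_iff
      inner_quat_def sigma_eq field_simps tau_mult)

lemma hform_weyl_vec: "I \<in> nodes \<Longrightarrow> hform weyl_vec (herm_root I) = 1"
  unfolding A4pp_nodes_def
  by (elim insertE emptyE; hypsubst; simp add: herm_root_eqs weyl_vec_def
      inner_quat_def sigma_eq field_simps tau_mult)

interpretation A4pp: simply_laced_roots nodes A4pp_cartan hform herm_root weyl_vec
proof
  show "hform X Y = hform Y X" for X Y by (rule hform_sym)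
qed (auto simp: hform_add hform_scale hform_roots hform_weyl_vec A4pp_cartan_def)

text \<open>The coefficients come from the inverse of the Cartan matrix.\<close>

definition root_coef :: "herm \<Rightarrow> int \<Rightarrow> real" where
  "root_coef X I = (let b = (\<lambda>I. hform X (herm_root I)) in
     if I = -1 then - (b 0 + b 1 + b 2 + b 3 + b 4)
     else if I = 0 then - (b (-1) + 2 * (b 0 + b 1 + b 2 + b 3 + b 4))
     else - (b (-1) + 2 * b 0 +
       (if I = 1 then 6 * b 1 + 7 * b 2 + 8 * b 3 + 9 * b 4
        else if I = 2 then 7 * b 1 + 4 * b 2 + 6 * b 3 + 8 * b 4
        else if I = 3 then 8 * b 1 + 6 * b 2 + 4 * b 3 + 7 * b 4
        else 9 * b 1 + 8 * b 2 + 7 * b 3 + 6 * b 4) / 5))"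

definition root_sum :: "(int \<Rightarrow> real) \<Rightarrow> herm" where
  "root_sum c = (\<Sum>I\<in>nodes. c I *\<^sub>R herm_root I)"

lemma sum_nodes: "(\<Sum>I\<in>nodes. f I) = f (-1) + f 0 + f 1 + f 2 + f 3 + f 4"
  by (simp add: A4pp_nodes_def add.assoc)

lemma ball_nodes: "(\<forall>I\<in>nodes. P I) \<longleftrightarrow> P (-1) \<and> P 0 \<and> P 1 \<and> P 2 \<and> P 3 \<and> P 4"
  by (simp add: A4pp_nodes_def)

lemma root_sum_coef: "root_sum (root_coef X) = X"
proof (cases X)
  fix p z r assume X: "X = (p, z, r)"
  show ?thesis
    unfolding root_sum_def sum_nodes root_coef_def X
    by (cases z) (simp add: herm_root_eqs inner_quat_def scaleR_quat_def plus_quat_def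
        sigma_eq field_simps tau_mult)
qed

lemma hform_root_sum: "hform (root_sum c) Y = (\<Sum>I\<in>nodes. c I * hform (herm_root I) Y)"
  unfolding root_sum_def sum_nodes by (simp add: hform_add hform_scale)

lemma root_coef_sum: "I \<in> nodes \<Longrightarrow> root_coef (root_sum c) I = c I"
proof -
  assume "I \<in> nodes"
  moreover have "hform (root_sum c) (herm_root J) = (\<Sum>I\<in>nodes. c I * of_int (A4pp_cartan I J))"
    if "J \<in> nodes" for J
    using that by (simp add: hform_root_sum hform_roots cong: sum.cong)
  note this[simplified ball_nodes]
  ultimately show ?thesis
    unfolding A4pp_nodes_def sum_nodes
    by (elim insertE emptyE; hypsubst) (simp_all add: root_coef_def A4pp_nodes_def
        A4pp_cartan_def doubleton_eq_iff field_simps)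
qed

lemma hform_self_coef: "hform X X = (\<Sum>I\<in>nodes. root_coef X I * hform X (herm_root I))"
proof -
  have "hform X X = hform (root_sum (root_coef X)) X"
    by (simp only: root_sum_coef)
  also have "\<dots> = (\<Sum>I\<in>nodes. root_coef X I * hform (herm_root I) X)"
    by (rule hform_root_sum)
  also have "\<dots> = (\<Sum>I\<in>nodes. root_coef X I * hform X (herm_root I))"
    by (rule sum.cong) (simp_all only: hform_sym[of _ X])
  finally show ?thesis .
qed

lemma root_sum_cong: "(\<And>I. I \<in> nodes \<Longrightarrow> c I = d I) \<Longrightarrow> root_sum c = root_sum d"
  unfolding root_sum_def by (rule sum.cong) simp_all

definition hlat :: "herm set" where
  "hlat = {(p, z, r) | p z r. p \<in> \<int> \<and> z \<in> A4_lattice \<and> r \<in> \<int>}"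

lemma hlat_iff_root_sum: "X \<in> hlat \<longleftrightarrow> (\<exists>n :: int \<Rightarrow> int. X = root_sum (\<lambda>I. of_int (n I)))"
proof
  assume "X \<in> hlat"
  then obtain p r :: int and n :: "nat \<Rightarrow> int" where
    X: "X = (of_int p, \<Sum>i=1..4. of_int (n i) * simple_root i, of_int r)"
    unfolding hlat_def A4_lattice_def by (auto elim!: Ints_cases)
  have "X = root_sum (\<lambda>I. of_int (if I = -1 then r else if I = 0 then p + r else n (nat I) + p + r))"
    unfolding X root_sum_def sum_nodes sum_1_4 herm_root_eqs simple_root_eqs
    by (simp add: quat_comps of_int_quat sigma_eq field_simps)
  then show "\<exists>n. X = root_sum (\<lambda>I. of_int (n I))"
    by (rule exI[where x = "\<lambda>I. if I = -1 then r else if I = 0 then p + r else n (nat I) + p + r"])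
next
  assume "\<exists>n :: int \<Rightarrow> int. X = root_sum (\<lambda>I. of_int (n I))"
  then obtain n :: "int \<Rightarrow> int" where X: "X = root_sum (\<lambda>I. of_int (n I))" ..
  have "X = (of_int (n 0 - n (-1)), \<Sum>i=1..4. of_int (n (int i) - n 0) * simple_root i, of_int (n (-1)))"
    unfolding X root_sum_def sum_nodes sum_1_4 herm_root_eqs simple_root_eqs
    by (simp add: quat_comps of_int_quat sigma_eq field_simps)
  moreover have "(\<Sum>i=1..4. of_int (n (int i) - n 0) * simple_root i) \<in> A4_lattice"
    unfolding A4_lattice_def mem_Collect_eq
    by (rule exI[where x = "\<lambda>i. n (int i) - n 0"]) simp
  ultimately show "X \<in> hlat"
    unfolding hlat_def using Ints_of_int by blast
qed

lemma hlat_iff_coef: "X \<in> hlat \<longleftrightarrow> (\<forall>I\<in>nodes. root_coef X I \<in> \<int>)"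
proof
  assume "X \<in> hlat" then show "\<forall>I\<in>nodes. root_coef X I \<in> \<int>"
    by (auto simp: hlat_iff_root_sum root_coef_sum)
next
  assume "\<forall>I\<in>nodes. root_coef X I \<in> \<int>"
  then have "root_sum (root_coef X) = root_sum (\<lambda>I. of_int \<lfloor>root_coef X I\<rfloor>)"
    by (intro root_sum_cong) simp
  then show "X \<in> hlat"
    unfolding hlat_iff_root_sum root_sum_coef by (rule exI[where x = "\<lambda>I. \<lfloor>root_coef X I\<rfloor>"])
qed

lemma hlat_combine:
  assumes "X \<in> hlat" "Y \<in> hlat" "c \<in> \<int>"
  shows "X - c *\<^sub>R Y \<in> hlat"
proof -
  from assms obtain m n :: "int \<Rightarrow> int" and k :: int where
    "X = root_sum (\<lambda>I. of_int (m I))" "Y = root_sum (\<lambda>I. of_int (n I))" "c = of_int k"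
    by (auto simp: hlat_iff_root_sum elim!: Ints_cases)
  then have "X - c *\<^sub>R Y = root_sum (\<lambda>I. of_int (m I - k * n I))"
    unfolding root_sum_def sum_nodes by (simp add: algebra_simps)
  then show ?thesis
    unfolding hlat_iff_root_sum by (rule exI[where x = "\<lambda>I. m I - k * n I"])
qed

lemma herm_root_in_hlat:
  assumes "I \<in> nodes"
  shows "herm_root I \<in> hlat"
proof -
  have "herm_root I = root_sum (\<lambda>J. of_int (if J = I then 1 else 0))"
    using assms unfolding root_sum_def A4pp_nodes_def by auto
  then show ?thesis
    unfolding hlat_iff_root_sum by (rule exI[where x = "\<lambda>J. if J = I then 1 else 0"])
qed

lemma hform_hlat_Ints:
  assumes "X \<in> hlat" "I \<in> nodes"
  shows "hform X (herm_root I) \<in> \<int>"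
  using assms by (auto simp: hlat_iff_root_sum hform_root_sum hform_roots intro!: Ints_sum)

lemma word_act_hlat: "w \<in> lists nodes \<Longrightarrow> X \<in> hlat \<Longrightarrow> A4pp.word_act w X \<in> hlat"
  by (induction w)
     (auto simp: A4pp.reflect_def intro!: hlat_combine herm_root_in_hlat hform_hlat_Ints)

lemma weyl_vec_in_hlat: "weyl_vec \<in> hlat"
proof -
  have "root_coef weyl_vec I \<in> \<int>" if "I \<in> nodes" for I
    using hform_weyl_vec unfolding root_coef_def Let_def by (simp add: A4pp_nodes_def)
  then show ?thesis by (simp add: hlat_iff_coef)
qed


section \<open>The fundamental chamber\<close>

text \<open>Half the norm of the lattice vector with coefficient \<open>m\<close> at the node \<open>-1\<close> and coefficients
\<open>a, b, c, d, e\<close> at the cycle of nodes \<open>0, 1, 2, 3, 4\<close>.\<close>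

definition root_form :: "int \<Rightarrow> int \<Rightarrow> int \<Rightarrow> int \<Rightarrow> int \<Rightarrow> int \<Rightarrow> int" where
  "root_form m a b c d e = m * m - m * a + (a * a + b * b + c * c + d * d + e * e)
     - (a * b + b * c + c * d + d * e + e * a)"

lemma hform_root_sum_self:
  "hform (root_sum (\<lambda>I. of_int (n I))) (root_sum (\<lambda>I. of_int (n I))) =
     of_int (2 * root_form (n (-1)) (n 0) (n 1) (n 2) (n 3) (n 4))"
proof -
  let ?X = "root_sum (\<lambda>I. of_int (n I))"
  have "hform (herm_root J) ?X = (\<Sum>I\<in>nodes. of_int (n I) * of_int (A4pp_cartan I J))"
    if "J \<in> nodes" for J
    using that unfolding hform_sym[of "herm_root J"]
    by (simp add: hform_root_sum hform_roots cong: sum.cong)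
  then have "hform ?X ?X = (\<Sum>J\<in>nodes. of_int (n J) *
      (\<Sum>I\<in>nodes. of_int (n I) * of_int (A4pp_cartan I J)))"
    by (simp add: hform_root_sum[of _ ?X] cong: sum.cong)
  also have "\<dots> = of_int (2 * root_form (n (-1)) (n 0) (n 1) (n 2) (n 3) (n 4))"
    unfolding sum_nodes root_form_def
    by (simp add: A4pp_cartan_def doubleton_eq_iff) (simp add: algebra_simps)
  finally show ?thesis .
qed

lemma sum_squares_nonpos:
  fixes a b c d e :: int
  assumes "a\<^sup>2 + b\<^sup>2 + c\<^sup>2 + d\<^sup>2 + e\<^sup>2 \<le> 0"
  shows "a = 0" "b = 0" "c = 0" "d = 0" "e = 0"
  using assms zero_le_power2[of a] zero_le_power2[of b] zero_le_power2[of c]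
    zero_le_power2[of d] zero_le_power2[of e]
  by (smt (verit) power2_less_eq_zero_iff)+

text \<open>Deleting a node of the 5-cycle leaves a diagram of finite type, on which the form is
  positive definite. In each case four times the form is a sum of squares in which one set of
  five squares already determines the vector.\<close>

lemma root_form_pos:
  assumes "a = 0 \<or> b = 0 \<or> c = 0 \<or> d = 0 \<or> e = 0"
    and "\<not> (m = 0 \<and> a = 0 \<and> b = 0 \<and> c = 0 \<and> d = 0 \<and> e = 0)"
  shows "root_form m a b c d e \<ge> 1"
proof (rule ccontr)
  assume "\<not> ?thesis"
  then have neg: "4 * root_form m a b c d e \<le> 0" by simp
  from assms(1) show False
  proof (elim disjE)
    assume z: "a = 0"
    have "4 * root_form m a b c d e = m\<^sup>2 + b\<^sup>2 + (b - c)\<^sup>2 + (c - d)\<^sup>2 + (d - e)\<^sup>2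
        + (3 * m\<^sup>2 + b\<^sup>2 + 2 * e\<^sup>2 + (b - c)\<^sup>2 + (c - d)\<^sup>2 + (d - e)\<^sup>2)"
      unfolding root_form_def z by (simp add: power2_eq_square algebra_simps)
    moreover have "3 * m\<^sup>2 + b\<^sup>2 + 2 * e\<^sup>2 + (b - c)\<^sup>2 + (c - d)\<^sup>2 + (d - e)\<^sup>2 \<ge> 0" by simp
    ultimately have "m\<^sup>2 + b\<^sup>2 + (b - c)\<^sup>2 + (c - d)\<^sup>2 + (d - e)\<^sup>2 \<le> 0" using neg by linarith
    from sum_squares_nonpos[OF this] assms(2) z show False by simp
  next
    assume z: "b = 0"
    have "4 * root_form m a b c d e = (2 * m - a)\<^sup>2 + c\<^sup>2 + (c - d)\<^sup>2 + (d - e)\<^sup>2 + (e - a)\<^sup>2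
        + (a\<^sup>2 + c\<^sup>2 + (c - d)\<^sup>2 + (d - e)\<^sup>2 + (e - a)\<^sup>2)"
      unfolding root_form_def z by (simp add: power2_eq_square algebra_simps)
    moreover have "a\<^sup>2 + c\<^sup>2 + (c - d)\<^sup>2 + (d - e)\<^sup>2 + (e - a)\<^sup>2 \<ge> 0" by simp
    ultimately have "(2 * m - a)\<^sup>2 + c\<^sup>2 + (c - d)\<^sup>2 + (d - e)\<^sup>2 + (e - a)\<^sup>2 \<le> 0" using neg by linarith
    from sum_squares_nonpos[OF this] assms(2) z show False by simp
  next
    assume z: "c = 0"
    have "4 * root_form m a b c d e = (2 * m - a)\<^sup>2 + (a - 2 * b)\<^sup>2 + d\<^sup>2 + (d - e)\<^sup>2 + (e - a)\<^sup>2
        + (d\<^sup>2 + (d - e)\<^sup>2 + (e - a)\<^sup>2)"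
      unfolding root_form_def z by (simp add: power2_eq_square algebra_simps)
    moreover have "d\<^sup>2 + (d - e)\<^sup>2 + (e - a)\<^sup>2 \<ge> 0" by simp
    ultimately have "(2 * m - a)\<^sup>2 + (a - 2 * b)\<^sup>2 + d\<^sup>2 + (d - e)\<^sup>2 + (e - a)\<^sup>2 \<le> 0" using neg by linarith
    from sum_squares_nonpos[OF this] assms(2) z show False by simp
  next
    assume z: "d = 0"
    have "4 * root_form m a b c d e = (2 * m - a)\<^sup>2 + (a - 2 * e)\<^sup>2 + c\<^sup>2 + (c - b)\<^sup>2 + (b - a)\<^sup>2
        + (c\<^sup>2 + (c - b)\<^sup>2 + (b - a)\<^sup>2)"
      unfolding root_form_def z by (simp add: power2_eq_square algebra_simps)
    moreover have "c\<^sup>2 + (c - b)\<^sup>2 + (b - a)\<^sup>2 \<ge> 0" by simp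
    ultimately have "(2 * m - a)\<^sup>2 + (a - 2 * e)\<^sup>2 + c\<^sup>2 + (c - b)\<^sup>2 + (b - a)\<^sup>2 \<le> 0" using neg by linarith
    from sum_squares_nonpos[OF this] assms(2) z show False by simp
  next
    assume z: "e = 0"
    have "4 * root_form m a b c d e = (2 * m - a)\<^sup>2 + d\<^sup>2 + (d - c)\<^sup>2 + (c - b)\<^sup>2 + (b - a)\<^sup>2
        + (a\<^sup>2 + d\<^sup>2 + (d - c)\<^sup>2 + (c - b)\<^sup>2 + (b - a)\<^sup>2)"
      unfolding root_form_def z by (simp add: power2_eq_square algebra_simps)
    moreover have "a\<^sup>2 + d\<^sup>2 + (d - c)\<^sup>2 + (c - b)\<^sup>2 + (b - a)\<^sup>2 \<ge> 0" by simp
    ultimately have "(2 * m - a)\<^sup>2 + d\<^sup>2 + (d - c)\<^sup>2 + (c - b)\<^sup>2 + (b - a)\<^sup>2 \<le> 0" using neg by linarith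
    from sum_squares_nonpos[OF this] assms(2) z show False by simp
  qed
qed

text \<open>A vector whose positive part is supported on the whole cycle, such as the null vector of the
affine diagram, can have a negative part only at the node \<open>-1\<close>. The edge from \<open>-1\<close> to \<open>0\<close> then
makes the form too large.\<close>

lemma root_form_affine_neg:
  assumes "m < 0" "a > 0"
  shows "root_form m a b c d e \<ge> 2"
proof -
  have "2 * root_form m a b c d e = 2 * m\<^sup>2 + 2 * (- m * a) +
      ((a - b)\<^sup>2 + (b - c)\<^sup>2 + (c - d)\<^sup>2 + (d - e)\<^sup>2 + (e - a)\<^sup>2)"
    unfolding root_form_def by (simp add: power2_eq_square algebra_simps)
  moreover have "m\<^sup>2 \<ge> 1" "- m * a \<ge> 1"
    using assms mult_mono[of 1 "-m" 1 a] by (simp_all add: int_one_le_iff_zero_less)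
  moreover have "(a - b)\<^sup>2 + (b - c)\<^sup>2 + (c - d)\<^sup>2 + (d - e)\<^sup>2 + (e - a)\<^sup>2 \<ge> 0" by simp
  ultimately show ?thesis by linarith
qed

lemma pos_neg_part_mult:
  fixes x y :: int
  shows "x * x = max x 0 * max x 0 + max (- x) 0 * max (- x) 0"
    and "x * y \<le> max x 0 * max y 0 + max (- x) 0 * max (- y) 0"
proof -
  show "x * x = max x 0 * max x 0 + max (- x) 0 * max (- x) 0"
    by (cases "x \<ge> 0") simp_all
  have "x * y = (max x 0 - max (- x) 0) * (max y 0 - max (- y) 0)"
    by (intro arg_cong2[where f = "(*)"]) auto
  also have "\<dots> = max x 0 * max y 0 + max (- x) 0 * max (- y) 0
      - (max x 0 * max (- y) 0 + max (- x) 0 * max y 0)"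
    by (simp only: algebra_simps)
  also have "\<dots> \<le> max x 0 * max y 0 + max (- x) 0 * max (- y) 0"
    using mult_nonneg_nonneg[of "max x 0" "max (- y) 0"] mult_nonneg_nonneg[of "max (- x) 0" "max y 0"]
    by linarith
  finally show "x * y \<le> max x 0 * max y 0 + max (- x) 0 * max (- y) 0" .
qed

text \<open>With \<open>n\<^sub>+\<close> and \<open>n\<^sub>-\<close> the positive and negative parts of the coefficient vector,
  the form takes at \<open>n\<close> at least the sum of its values at \<open>n\<^sub>+\<close> and \<open>n\<^sub>-\<close>, because the
  off-diagonal entries of the Cartan matrix are not positive. If both parts are nonzero, then both
  values are at least 1, unless one of the parts is supported on the whole cycle.\<close>

lemma root_form_one_sign:
  assumes "root_form m a b c d e = 1"
  shows "(m \<ge> 0 \<and> a \<ge> 0 \<and> b \<ge> 0 \<and> c \<ge> 0 \<and> d \<ge> 0 \<and> e \<ge> 0) \<or>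
         (m \<le> 0 \<and> a \<le> 0 \<and> b \<le> 0 \<and> c \<le> 0 \<and> d \<le> 0 \<and> e \<le> 0)"
proof (rule ccontr)
  assume mixed: "\<not> ?thesis"
  let ?p = "\<lambda>x::int. max x 0" and ?n = "\<lambda>x::int. max (- x) 0"
  have le: "root_form (?p m) (?p a) (?p b) (?p c) (?p d) (?p e)
      + root_form (?n m) (?n a) (?n b) (?n c) (?n d) (?n e) \<le> root_form m a b c d e"
    unfolding root_form_def
    using pos_neg_part_mult(1)[of m] pos_neg_part_mult(1)[of a] pos_neg_part_mult(1)[of b]
      pos_neg_part_mult(1)[of c] pos_neg_part_mult(1)[of d] pos_neg_part_mult(1)[of e]
      pos_neg_part_mult(2)[of m a] pos_neg_part_mult(2)[of a b] pos_neg_part_mult(2)[of b c]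
      pos_neg_part_mult(2)[of c d] pos_neg_part_mult(2)[of d e] pos_neg_part_mult(2)[of e a]
    by linarith
  have neg: "root_form (- m) (- a) (- b) (- c) (- d) (- e) = root_form m a b c d e"
    by (simp add: root_form_def)
  consider "m < 0" "a > 0" | "m > 0" "a < 0"
    | "a \<le> 0 \<or> b \<le> 0 \<or> c \<le> 0 \<or> d \<le> 0 \<or> e \<le> 0" "a \<ge> 0 \<or> b \<ge> 0 \<or> c \<ge> 0 \<or> d \<ge> 0 \<or> e \<ge> 0"
    using mixed by linarith
  then show False
  proof cases
    case 1
    then show ?thesis using root_form_affine_neg[of m a b c d e] assms by simp
  next
    case 2
    then show ?thesis using root_form_affine_neg[of "-m" "-a" "-b" "-c" "-d" "-e"] assms neg by simp
  next
    case 3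
    have zero: "max x 0 = 0 \<longleftrightarrow> x \<le> 0" "max (- x) 0 = 0 \<longleftrightarrow> x \<ge> 0" for x :: int
      by (auto simp: max_def)
    have "root_form (?p m) (?p a) (?p b) (?p c) (?p d) (?p e) \<ge> 1"
      by (rule root_form_pos; unfold zero) (use 3 mixed in linarith)+
    moreover have "root_form (?n m) (?n a) (?n b) (?n c) (?n d) (?n e) \<ge> 1"
      by (rule root_form_pos; unfold zero) (use 3 mixed in linarith)+
    ultimately show ?thesis using le assms by linarith
  qed
qed

lemma hform_weyl_vec_root_sum: "hform weyl_vec (root_sum c) = (\<Sum>I\<in>nodes. c I)"
  unfolding hform_sym[of weyl_vec] hform_root_sum
  by (rule sum.cong) (simp_all add: hform_sym[of "herm_root _" weyl_vec] hform_weyl_vec)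

lemma norm2_hlat_cases:
  assumes "X \<in> hlat" "hform X X = 2"
  obtains n :: "int \<Rightarrow> int" where "X = root_sum (\<lambda>I. of_int (n I))"
    "hform weyl_vec X = of_int (n (-1) + n 0 + n 1 + n 2 + n 3 + n 4)"
    "(\<forall>I\<in>nodes. n I \<ge> 0) \<or> (\<forall>I\<in>nodes. n I \<le> 0)"
proof -
  obtain n :: "int \<Rightarrow> int" where X: "X = root_sum (\<lambda>I. of_int (n I))"
    using assms(1) by (auto simp: hlat_iff_root_sum)
  have "real_of_int (2 * root_form (n (-1)) (n 0) (n 1) (n 2) (n 3) (n 4)) = real_of_int 2"
    using assms(2) hform_root_sum_self[of n] by (simp add: X)
  then have "root_form (n (-1)) (n 0) (n 1) (n 2) (n 3) (n 4) = 1"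
    unfolding of_int_eq_iff by simp
  from root_form_one_sign[OF this] that[OF X] show ?thesis
    by (simp add: X hform_weyl_vec_root_sum sum_nodes ball_nodes)
qed

text \<open>Coefficients of one sign that are not all zero have a nonzero sum, so the Weyl vector lies on no mirror.\<close>

lemma norm2_height_nonzero:
  assumes "X \<in> hlat" "hform X X = 2"
  shows "hform weyl_vec X \<noteq> 0"
proof
  assume 0: "hform weyl_vec X = 0"
  obtain n :: "int \<Rightarrow> int" where n: "X = root_sum (\<lambda>I. of_int (n I))"
    "hform weyl_vec X = of_int (n (-1) + n 0 + n 1 + n 2 + n 3 + n 4)"
    "(\<forall>I\<in>nodes. n I \<ge> 0) \<or> (\<forall>I\<in>nodes. n I \<le> 0)"
    using norm2_hlat_cases[OF assms] .
  have "n (-1) + n 0 + n 1 + n 2 + n 3 + n 4 = 0" using n(2) 0 of_int_eq_0_iff by metis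
  with n(3) have "\<forall>I\<in>nodes. n I = 0" unfolding ball_nodes by linarith
  then have "hform X X = 0" by (simp add: n(1) hform_root_sum)
  with assms show False by simp
qed

lemma norm2_height_one:
  assumes "X \<in> hlat" "hform X X = 2" "hform weyl_vec X = 1"
  obtains I where "I \<in> nodes" "X = herm_root I"
proof -
  obtain n :: "int \<Rightarrow> int" where n: "X = root_sum (\<lambda>I. of_int (n I))"
    "hform weyl_vec X = of_int (n (-1) + n 0 + n 1 + n 2 + n 3 + n 4)"
    "(\<forall>I\<in>nodes. n I \<ge> 0) \<or> (\<forall>I\<in>nodes. n I \<le> 0)"
    using norm2_hlat_cases[OF assms(1,2)] .
  have "n (-1) + n 0 + n 1 + n 2 + n 3 + n 4 = 1" using n(2) assms(3) of_int_eq_1_iff by metis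
  then have sum: "(\<Sum>J\<in>nodes. n J) = 1" by (simp add: sum_nodes)
  have "\<not> (\<forall>J\<in>nodes. n J \<le> 0)" using sum sum_nonpos[of nodes n] by auto
  then obtain I where I: "I \<in> nodes" "n I > 0" and nonneg: "\<forall>J\<in>nodes. n J \<ge> 0"
    using n(3) by (auto simp: not_le)
  have fin: "finite nodes" by (simp add: A4pp_nodes_def)
  have rest: "(\<Sum>J\<in>nodes - {I}. n J) \<ge> 0"
    using nonneg by (intro sum_nonneg) auto
  have split: "n I + (\<Sum>J\<in>nodes - {I}. n J) = 1"
    using sum.remove[OF fin I(1), of n] sum by simp
  with rest I(2) have "n I = 1" "(\<Sum>J\<in>nodes - {I}. n J) = 0" by linarith+
  moreover have "\<forall>J\<in>nodes - {I}. n J = 0"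
    using calculation(2) nonneg fin by (subst (asm) sum_nonneg_eq_0_iff) auto
  ultimately have "\<exists>I\<in>nodes. \<forall>J\<in>nodes. n J = (if J = I then 1 else 0)"
    using I by auto
  then obtain I where I: "I \<in> nodes" "\<And>J. J \<in> nodes \<Longrightarrow> n J = (if J = I then 1 else 0)" by blast
  have "X = herm_root I"
    using I unfolding n(1) root_sum_def A4pp_nodes_def by auto
  with I that show ?thesis by blast
qed

text \<open>The dual lattice modulo the root lattice has order 5, and up to a unit
  \<open>b\<^sub>1 + 2 b\<^sub>2 + 3 b\<^sub>3 + 4 b\<^sub>4\<close> modulo 5 is the class of \<open>X\<close>; five times the norm of \<open>X\<close>
  is minus its square modulo 5.\<close>

lemma norm2_dual_in_hlat:
  assumes int: "\<And>I. I \<in> nodes \<Longrightarrow> hform X (herm_root I) \<in> \<int>" and norm: "hform X X = 2"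
  shows "X \<in> hlat"
proof -
  have "\<forall>I\<in>nodes. \<exists>k. hform X (herm_root I) = of_int k"
    using int by (auto elim: Ints_cases)
  then obtain b :: "int \<Rightarrow> int" where b: "\<forall>I\<in>nodes. hform X (herm_root I) = of_int (b I)"
    by metis
  let ?u = "b 1 + 2 * b 2 + 3 * b 3 + 4 * b 4"
  \<comment> \<open>\<open>?u\<^sup>2 + 5 * hform X X\<close> is \<open>5 * ?K\<close>\<close>
  let ?K = "(b 3)\<^sup>2 + 2 * (b 4)\<^sup>2 - (b 1)\<^sup>2 - 2 * b 1 * (b 2 + b 3 + b 4) + 2 * b 3 * b 4
    - b (-1) * (b 0 + b 1 + b 2 + b 3 + b 4) - b 0 * (b (-1) + 2 * (b 0 + b 1 + b 2 + b 3 + b 4))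
    - (b 1 + b 2 + b 3 + b 4) * (b (-1) + 2 * b 0)"
  have coef: "root_coef X I = (if I = -1 then of_int (- (b 0 + b 1 + b 2 + b 3 + b 4))
     else if I = 0 then of_int (- (b (-1) + 2 * (b 0 + b 1 + b 2 + b 3 + b 4)))
     else of_int (- (b (-1) + 2 * b 0)) - of_int
       (if I = 1 then 6 * b 1 + 7 * b 2 + 8 * b 3 + 9 * b 4
        else if I = 2 then 7 * b 1 + 4 * b 2 + 6 * b 3 + 8 * b 4
        else if I = 3 then 8 * b 1 + 6 * b 2 + 4 * b 3 + 7 * b 4
        else 9 * b 1 + 8 * b 2 + 7 * b 3 + 6 * b 4) / 5)" for I
    using b unfolding root_coef_def Let_def ball_nodes by simp
  have "hform X X = (\<Sum>I\<in>nodes. root_coef X I * of_int (b I))"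
    using b by (subst hform_self_coef) (simp cong: sum.cong)
  then have "10 = 5 * (\<Sum>I\<in>nodes. root_coef X I * of_int (b I))"
    using norm by simp
  also have "\<dots> = of_int (5 * ?K - ?u\<^sup>2)"
    unfolding sum_nodes coef by (simp add: field_simps power2_eq_square)
  finally have "of_int (5 * ?K - ?u\<^sup>2) = real_of_int 10" by simp
  then have "5 * ?K - ?u\<^sup>2 = 10" unfolding of_int_eq_iff .
  then have "?u\<^sup>2 = 5 * (?K - 2)" by simp
  then have "5 dvd ?u\<^sup>2" by (metis dvd_triv_left)
  then have "5 dvd ?u"
    using prime_dvd_power[of "5::int" ?u 2] by simp
  then obtain k where k: "?u = 5 * k" by blast
  have quotients: "6 * b 1 + 7 * b 2 + 8 * b 3 + 9 * b 4 = 5 * (k + b 1 + b 2 + b 3 + b 4)"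
    "7 * b 1 + 4 * b 2 + 6 * b 3 + 8 * b 4 = 5 * (2 * k + b 1)"
    "8 * b 1 + 6 * b 2 + 4 * b 3 + 7 * b 4 = 5 * (3 * k + b 1 - b 3 - b 4)"
    "9 * b 1 + 8 * b 2 + 7 * b 3 + 6 * b 4 = 5 * (4 * k + b 1 - b 3 - 2 * b 4)"
    using k by (simp_all add: algebra_simps)
  have five: "real_of_int (5 * m) / 5 = of_int m" for m by simp
  have "root_coef X I \<in> \<int>" for I
    unfolding coef quotients by (auto simp only: five Ints_of_int Ints_diff split: if_split)
  then show ?thesis by (simp add: hlat_iff_coef)
qed

text \<open>The inverse of the Cartan matrix has no positive entry and its row sums are negative. Raising the
inner product of a strictly dominant vector with some simple root above 1 therefore lowers the
norm.\<close>

lemma dominant_weyl_norm: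
  assumes "hform y y = hform weyl_vec weyl_vec"
    and dom: "\<And>I. I \<in> nodes \<Longrightarrow> hform y (herm_root I) \<ge> 1"
  shows "y = weyl_vec"
proof -
  let ?b = "\<lambda>I. hform y (herm_root I)"
  have b: "\<forall>I\<in>nodes. ?b I \<ge> 1" using dom by blast
  have c: "root_coef y (-1) \<le> -5" "root_coef y 0 \<le> -11" "root_coef y 1 \<le> -9"
    "root_coef y 2 \<le> -8" "root_coef y 3 \<le> -8" "root_coef y 4 \<le> -9"
    using b unfolding root_coef_def Let_def ball_nodes by (simp_all add: field_simps)
  have "hform y y = (\<Sum>I\<in>nodes. root_coef y I * ?b I)"
    by (rule hform_self_coef)
  moreover have "hform y y = - 50"
    unfolding assms(1) by (simp add: weyl_vec_def inner_quat_def sigma_eq algebra_simps tau_mult)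
  moreover have "root_coef y I * ?b I \<le> k - (?b I - 1)"
    if "I \<in> nodes" "root_coef y I \<le> k" "k \<le> -1" for I k
  proof -
    have "(- root_coef y I - 1) * (?b I - 1) \<ge> 0"
      using that b by (intro mult_nonneg_nonneg) auto
    then show ?thesis using that by (simp add: algebra_simps)
  qed
  note this[OF _ c(1)] this[OF _ c(2)] this[OF _ c(3)] this[OF _ c(4)] this[OF _ c(5)] this[OF _ c(6)]
  ultimately have "\<forall>I\<in>nodes. ?b I = 1"
    using b unfolding sum_nodes ball_nodes by (simp add: A4pp_nodes_def)
  then have "root_coef y = root_coef weyl_vec"
    using hform_weyl_vec by (auto simp: root_coef_def A4pp_nodes_def fun_eq_iff)
  then show ?thesis using root_sum_coef by metis
qed


section \<open>Products of an even number of reflections\<close>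

lemma hdet_root: "I \<in> nodes \<Longrightarrow> hdet (herm_root I) = -1"
  using A4pp.root_norm[of I] hform_self[of "herm_root I"] by simp

lemma reflect_eq_act:
  "I \<in> nodes \<Longrightarrow> A4pp.reflect (herm_root I) X = act (hmat (herm_root I)) (hadj X)"
  by (simp add: A4pp.reflect_def act_hmat_hadj hdet_root)

lemma hmat_in_SL2:
  assumes "hdet R = -1"
  shows "hmat R \<in> carrier SL2_H"
proof -
  obtain p z r where R: "R = (p, z, r)" by (cases R)
  have zz: "inner z z = p * r + 1" using assms by (simp add: R)
  have "act (hmat R) (hadj (1, 0, 1)) = - hform (1, 0, 1) R *\<^sub>R R - hdet R *\<^sub>R (1, 0, 1)"
    by (rule act_hmat_hadj)
  then have "act (hmat R) (1, 0, 1) = ((p + r) * p + 1, (p + r) *\<^sub>R z, (p + r) * r + 1)"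
    using assms by (simp add: R algebra_simps)
  then show ?thesis by (simp add: SL2_H_iff zz) (simp add: algebra_simps)
qed

lemma hdet_hadj: "hdet (hadj X) = hdet X"
  by (cases X) simp

text \<open>The second factor is the adjugate of a root because two successive reflections are
\<open>X \<mapsto> R adj(R' adj(X) R') R = R adj(R') X adj(R') R\<close>. The value on words of odd length has no meaning.\<close>

fun rotor :: "int list \<Rightarrow> qmat" where
  "rotor (I # J # w) = hmat (herm_root I) ** hmat (hadj (herm_root J)) ** rotor w"
| "rotor _ = mat 1"

lemma rotor_in_SL2: "w \<in> lists nodes \<Longrightarrow> rotor w \<in> carrier SL2_H"
  by (induction w rule: rotor.induct)
     (simp_all add: SL2_H_mult SL2_H_one hmat_in_SL2 hdet_hadj hdet_root)

lemma act_rotor: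
  "w \<in> lists nodes \<Longrightarrow> even (length w) \<Longrightarrow> act (rotor w) X = A4pp.word_act w X"
  by (induction w rule: rotor.induct) (simp_all add: act_mult reflect_eq_act hadj_act)

lemma rotor_append:
  "even (length u) \<Longrightarrow> rotor (u @ v) = rotor u ** rotor v"
  by (induction u rule: rotor.induct) (simp_all add: matrix_mul_assoc)

text \<open>After multiplication by the inverse of the matrix of an even word, a matrix acting as an odd word
would act as one reflection, and after multiplication by the adjugate of its root as \<open>hadj\<close>.\<close>

lemma odd_word_not_act:
  assumes w: "w \<in> lists nodes" "odd (length w)"
  shows "\<exists>X. act T X \<noteq> A4pp.word_act w X"
proof (rule ccontr)
  assume "\<not> ?thesis"
  then have T: "act T X = A4pp.word_act w X" for X by blast
  obtain I v where w_eq: "w = I # v" using w(2) by (cases w) auto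
  then have I: "I \<in> nodes" and v: "v \<in> lists nodes" "even (length v)" using w by auto
  obtain V where V: "rotor v ** V = mat 1"
    using SL2_H_right_inverse[OF rotor_in_SL2[OF v(1)]] by blast
  have "hmat (hadj (herm_root I)) ** hmat (herm_root I) = - mat 1"
    using hmat_mult_hadj[of "hadj (herm_root I)"] I by (simp add: hdet_hadj hdet_root)
  then have "act (hmat (hadj (herm_root I)) ** hmat (herm_root I)) X = X" for X
    by simp
  moreover have "act (T ** V) X = act (hmat (herm_root I)) (hadj X)" for X
  proof -
    have "act (T ** V) X = act (hmat (herm_root I)) (hadj (act (rotor v) (act V X)))"
      by (simp add: act_mult T w_eq reflect_eq_act[OF I] act_rotor[OF v])
    then show ?thesis by (simp add: V flip: act_mult)
  qed
  ultimately have "act (hmat (hadj (herm_root I)) ** (T ** V)) X = hadj X" for X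
    by (simp add: act_mult)
  then show False using act_neq_hadj by blast
qed

definition diag_flip :: qmat where "diag_flip = mat2 1 0 0 (-1)"

lemma act_diag_flip: "act diag_flip (p, z, r) = (p, - z, r)"
  by (simp add: diag_flip_def) (simp add: uminus_quat_def)

lemma diag_flip_square: "diag_flip ** diag_flip = mat 1"
  by (simp add: diag_flip_def mat2_mult mat2_one)

lemma act_diag_flip_twice [simp]: "act diag_flip (act diag_flip X) = X"
  by (simp add: diag_flip_square flip: act_mult)

lemma diag_flip_in_SL2: "diag_flip \<in> carrier SL2_H"
  by (simp add: SL2_H_iff act_diag_flip)

lemma A4_lattice_uminus_iff: "- z \<in> A4_lattice \<longleftrightarrow> z \<in> A4_lattice"
proof -
  have "- z \<in> A4_lattice" if z: "z \<in> A4_lattice" for z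
  proof -
    obtain n :: "nat \<Rightarrow> int" where "z = (\<Sum>i=1..4. of_int (n i) * simple_root i)"
      using z unfolding A4_lattice_def by blast
    then have "- z = (\<Sum>i=1..4. of_int (- n i) * simple_root i)"
      by (simp add: sum_negf)
    then show ?thesis
      unfolding A4_lattice_def mem_Collect_eq by (intro exI[where x = "\<lambda>i. - n i"]) simp
  qed
  from this[of z] this[of "-z"] show ?thesis by auto
qed

definition diagram_aut :: "int \<Rightarrow> int" where
  "diagram_aut I = (if I \<in> {-1, 0} then I else 5 - I)"

text \<open>The longest word of the finite Weyl group of type \<open>A\<^sub>4\<close>.\<close>

definition longest_word :: "int list" where
  "longest_word = [1, 2, 1, 3, 2, 1, 4, 3, 2, 1]"

lemma longest_word_props: "longest_word \<in> lists nodes" "even (length longest_word)"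
  by (simp_all add: longest_word_def A4pp_nodes_def)

lemma reflect_root: "I \<in> nodes \<Longrightarrow> J \<in> nodes \<Longrightarrow>
   A4pp.reflect (herm_root I) (herm_root J) = herm_root J - of_int (A4pp_cartan J I) *\<^sub>R herm_root I"
  by (simp add: A4pp.reflect_def hform_roots)

text \<open>The longest element of \<open>W(A\<^sub>4)\<close> is the negative of the diagram symmetry on the span of
\<open>\<alpha>\<^sub>1, \<dots>, \<alpha>\<^sub>4\<close>, and \<open>diag_flip\<close> is the negative of the identity there. On the orthogonal complement
both are the identity.\<close>

lemma longest_word_diag_flip:
  assumes "I \<in> nodes"
  shows "A4pp.word_act longest_word (act diag_flip (herm_root I)) = herm_root (diagram_aut I)"
proof -
  have diff: "A4pp.reflect r (x - y) = A4pp.reflect r x - A4pp.reflect r y" for r x y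
    by (simp add: A4pp.reflect_def hform_add A4pp.form_diff algebra_simps)
  have neg: "A4pp.reflect r (- x) = - A4pp.reflect r x" for r x
    using A4pp.reflect_scale[of r "-1" x] by simp
  have root: "A4pp.reflect (herm_root I) (herm_root J) =
      (if I = J then - herm_root J else if A4pp_cartan J I = 0 then herm_root J
       else herm_root J + herm_root I)" if "I \<in> {1, 2, 3, 4}" "J \<in> nodes" for I J
    using that reflect_root[of I J] A4pp.cartan_off_diag[of J I]
    by (auto simp: A4pp_nodes_def A4pp_cartan_def scaleR_2)
  note roots = root[of 1] root[of 2] root[of 3] root[of 4]
  have flip: "act diag_flip (herm_root (-1)) = herm_root (-1)"
    "act diag_flip (herm_root 0) =
       herm_root 0 + 2 *\<^sub>R (herm_root 1 + herm_root 2 + herm_root 3 + herm_root 4)"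
    "act diag_flip (herm_root 1) = - herm_root 1" "act diag_flip (herm_root 2) = - herm_root 2"
    "act diag_flip (herm_root 3) = - herm_root 3" "act diag_flip (herm_root 4) = - herm_root 4"
    by (simp_all add: herm_root_eqs act_diag_flip quat_comps sigma_eq field_simps)
  from assms show ?thesis
    unfolding A4pp_nodes_def longest_word_def
    by (elim insertE emptyE; hypsubst)
       (simp_all add: flip roots A4pp.reflect_add diff neg A4pp.reflect_scale A4pp_nodes_def
        A4pp_cartan_def doubleton_eq_iff diagram_aut_def scaleR_2)
qed

lemma linear_eq_on_roots:
  assumes "linear f" "linear g" "\<And>I. I \<in> nodes \<Longrightarrow> f (herm_root I) = g (herm_root I)"
  shows "f X = g X"
proof -
  have "f (root_sum c) = g (root_sum c)" for c
    unfolding root_sum_def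
    by (simp add: linear_sum[OF assms(1)] linear_sum[OF assms(2)] linear_scale[OF assms(1)]
        linear_scale[OF assms(2)] assms(3) cong: sum.cong)
  then show ?thesis using root_sum_coef by metis
qed

text \<open>Otherwise the diagram symmetry would be the action of a word. This word permutes the simple
roots, so it is trivial in the Weyl group, whereas the symmetry moves \<open>\<alpha>\<^sub>1\<close>.\<close>

lemma word_act_neq_diag_flip:
  assumes "w \<in> lists nodes"
  shows "\<exists>X. A4pp.word_act w X \<noteq> act diag_flip X"
proof (rule ccontr)
  assume "\<not> ?thesis"
  then have w: "A4pp.word_act w X = act diag_flip X" for X by blast
  let ?v = "longest_word @ w"
  have v: "A4pp.word_act ?v (herm_root I) = herm_root (diagram_aut I)" if "I \<in> nodes" for I
    using longest_word_diag_flip[OF that] by (simp add: A4pp.word_act_append w)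
  have "diagram_aut I \<in> nodes" if "I \<in> nodes" for I
    using that by (auto simp: A4pp_nodes_def diagram_aut_def)
  then have "weyl_eq nodes A4pp_cartan ?v []"
    using assms longest_word_props
    by (intro A4pp.word_act_pos_imp_trivial) (auto simp: v A4pp.pos_cone.root)
  then have "A4pp.word_act ?v = id"
    using A4pp.word_act_cong by fastforce
  with v[of 1] show False
    by (simp add: A4pp_nodes_def diagram_aut_def herm_root_eqs)
qed

lemma cartan_neighbours:
  assumes "I \<in> nodes" "J \<in> nodes" "A4pp_cartan I J = -1"
  shows "I = -1 \<and> J = 0 \<or> I = 0 \<and> J \<in> {-1, 1, 4} \<or> I = 1 \<and> J \<in> {0, 2} \<or>
     I = 2 \<and> J \<in> {1, 3} \<or> I = 3 \<and> J \<in> {2, 4} \<or> I = 4 \<and> J \<in> {3, 0}"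
  using assms unfolding A4pp_nodes_def
  by (elim insertE emptyE; hypsubst; simp add: A4pp_cartan_def doubleton_eq_iff)

text \<open>Node 0 is the only one with three neighbours, and of its neighbours only \<open>-1\<close> is
  a leaf.\<close>

lemma diagram_automorphisms:
  assumes nodes: "\<And>I. I \<in> nodes \<Longrightarrow> \<pi> I \<in> nodes"
    and cartan: "\<And>I J. I \<in> nodes \<Longrightarrow> J \<in> nodes \<Longrightarrow> A4pp_cartan (\<pi> I) (\<pi> J) = A4pp_cartan I J"
  shows "(\<forall>I\<in>nodes. \<pi> I = I) \<or> (\<forall>I\<in>nodes. \<pi> I = diagram_aut I)"
proof -
  have inj: "\<pi> I \<noteq> \<pi> J" if "I \<in> nodes" "J \<in> nodes" "I \<noteq> J" for I J
    using cartan[OF that(1,2)] A4pp.cartan_diag[OF nodes[OF that(1)]]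
      A4pp.cartan_off_diag[OF that] by auto
  have n: "-1 \<in> nodes" "0 \<in> nodes" "1 \<in> nodes" "2 \<in> nodes" "3 \<in> nodes" "4 \<in> nodes"
    by (simp_all add: A4pp_nodes_def)
  have nb: "A4pp_cartan (\<pi> 0) (\<pi> (-1)) = -1" "A4pp_cartan (\<pi> 0) (\<pi> 1) = -1"
    "A4pp_cartan (\<pi> 0) (\<pi> 4) = -1" "A4pp_cartan (\<pi> 1) (\<pi> 2) = -1"
    "A4pp_cartan (\<pi> 4) (\<pi> 3) = -1"
    by (simp_all add: cartan n) (simp_all add: A4pp_cartan_def doubleton_eq_iff)
  note nb = cartan_neighbours[OF nodes[OF n(2)] nodes[OF n(1)] nb(1)]
    cartan_neighbours[OF nodes[OF n(2)] nodes[OF n(3)] nb(2)]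
    cartan_neighbours[OF nodes[OF n(2)] nodes[OF n(6)] nb(3)]
    cartan_neighbours[OF nodes[OF n(3)] nodes[OF n(4)] nb(4)]
    cartan_neighbours[OF nodes[OF n(6)] nodes[OF n(5)] nb(5)]
  have a: "\<pi> 0 \<noteq> \<pi> 1" "\<pi> (-1) \<noteq> \<pi> 1" "\<pi> (-1) \<noteq> \<pi> 4" "\<pi> 1 \<noteq> \<pi> 4" "\<pi> 0 \<noteq> \<pi> 2" "\<pi> 0 \<noteq> \<pi> 3"
    "\<pi> 1 \<noteq> \<pi> 3" "\<pi> 2 \<noteq> \<pi> 4"
    by (intro inj n; simp)+
  \<comment> \<open>splitting the many disequations into inequalities would be too costly\<close>
  note [[linarith_neq_limit = 0]]
  have "\<pi> 0 \<noteq> -1" "\<pi> 0 \<noteq> 1" "\<pi> 0 \<noteq> 2" "\<pi> 0 \<noteq> 3" "\<pi> 0 \<noteq> 4"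
    by (rule notI, use nb(1,2,3) a(2-4) in force)+
  then have 0: "\<pi> 0 = 0"
    using nodes[OF n(2)] by (simp add: A4pp_nodes_def)
  have "\<pi> 1 \<noteq> -1" "\<pi> 4 \<noteq> -1"
    using nb(4,5) a(5,6) unfolding 0 by auto
  then have leaf: "\<pi> (-1) = -1"
    and "\<pi> 1 = 1 \<and> \<pi> 4 = 4 \<or> \<pi> 1 = 4 \<and> \<pi> 4 = 1"
    using nb(1,2,3) a(2-4) unfolding 0 by (simp, metis)+
  then consider (id) "\<pi> 1 = 1" "\<pi> 4 = 4" | (swap) "\<pi> 1 = 4" "\<pi> 4 = 1" by blast
  then show ?thesis
  proof cases
    case id
    then have "\<pi> 2 = 2" "\<pi> 3 = 3" using nb(4,5) a(5,6) unfolding 0 id by simp_all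
    then show ?thesis by (simp add: ball_nodes 0 leaf id)
  next
    case swap
    then have "\<pi> 2 = 3" "\<pi> 3 = 2" using nb(4,5) a(5,6) unfolding 0 swap by simp_all
    then show ?thesis by (simp add: ball_nodes 0 leaf swap diagram_aut_def)
  qed
qed

lemma hform_hlat_Ints2:
  assumes "X \<in> hlat" "Y \<in> hlat"
  shows "hform X Y \<in> \<int>"
proof -
  obtain n :: "int \<Rightarrow> int" where X: "X = root_sum (\<lambda>I. of_int (n I))"
    using assms(1) by (auto simp: hlat_iff_root_sum)
  have "hform (herm_root I) Y \<in> \<int>" if "I \<in> nodes" for I
    using hform_hlat_Ints[OF assms(2) that] by (simp add: hform_sym)
  then show ?thesis
    unfolding X hform_root_sum by (intro Ints_sum Ints_mult) auto
qed

lemma word_act_hpos: "w \<in> lists nodes \<Longrightarrow> hpos X \<Longrightarrow> hpos (A4pp.word_act w X)"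
  by (induction w) (auto simp: reflect_eq_act intro!: hpos_act hpos_hadj hmat_in_SL2 hdet_root)

lemma hpos_neg_weyl_vec: "hpos (- weyl_vec)"
  by (simp add: hpos_def weyl_vec_def inner_quat_def uminus_quat_def sigma_eq algebra_simps tau_mult)


text \<open>Given a lattice automorphism \<open>g\<close>, a word \<open>w\<close> is chosen that brings \<open>w g h\<close> as close as
  possible to the Weyl vector \<open>h\<close>. Then \<open>w g h\<close> lies in the closed fundamental chamber. It lies
  on no wall because no norm 2 vector is orthogonal to \<open>h\<close>, and therefore it is \<open>h\<close>. Thus
  \<open>w g\<close> permutes the lattice vectors of norm 2 and height 1, which are the simple roots.\<close>

theorem lattice_matrix_permutes_roots:
  assumes S: "S \<in> carrier SL2_H" and stable: "\<And>X. X \<in> hlat \<Longrightarrow> act S X \<in> hlat"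
  obtains w where "w \<in> lists nodes"
    "\<And>I. I \<in> nodes \<Longrightarrow> A4pp.word_act w (act S (herm_root I)) \<in> herm_root ` nodes"
proof -
  define g where "g w X = A4pp.word_act w (act S X)" for w X
  let ?h = weyl_vec
  have g_hlat: "g w X \<in> hlat" if "w \<in> lists nodes" "X \<in> hlat" for w X
    using that by (simp add: g_def word_act_hlat stable)
  have g_form: "hform (g w X) (g w Y) = hform X Y" if "w \<in> lists nodes" for w X Y
    using that by (simp add: g_def A4pp.form_word_act hform_act S)
  have neg: "hform ?h (g w ?h) < 0" if "w \<in> lists nodes" for w
  proof -
    have "hpos (g w (- ?h))"
      using that by (simp add: g_def word_act_hpos hpos_act S hpos_neg_weyl_vec)
    then have "hform (- ?h) (g w (- ?h)) < 0"
      by (rule hform_hpos_neg[OF hpos_neg_weyl_vec])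
    moreover have "g w (- ?h) = - g w ?h"
      by (simp add: g_def linear_neg[OF linear_act] linear_neg[OF A4pp.linear_word_act])
    moreover have "hform (- X) (- Y) = hform X Y" for X Y
      by (cases X; cases Y) simp
    ultimately show ?thesis by simp
  qed
  \<comment> \<open>a positive integer, because \<open>-h\<close> and \<open>- g w h\<close> both lie in the cone of positive definite
    matrices\<close>
  define f where "f w = nat (- \<lfloor>hform ?h (g w ?h)\<rfloor>)" for w
  have f: "real (f w) = - hform ?h (g w ?h)" if w: "w \<in> lists nodes" for w
  proof -
    have "hform ?h (g w ?h) \<in> \<int>"
      by (intro hform_hlat_Ints2 weyl_vec_in_hlat g_hlat w)
    then obtain k where "hform ?h (g w ?h) = of_int k" by (auto elim: Ints_cases)
    with neg[OF w] show ?thesis by (simp add: f_def)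
  qed
  obtain w where w: "w \<in> lists nodes" and min: "\<And>v. v \<in> lists nodes \<Longrightarrow> f w \<le> f v"
    using ex_has_least_nat[of "\<lambda>w. w \<in> lists nodes" "[]" f] by auto
  let ?y = "g w ?h"
  have "hform ?y (herm_root I) \<ge> 1" if I: "I \<in> nodes" for I
  proof -
    have Iw: "I # w \<in> lists nodes" using I w by simp
    have "real (f w) \<le> real (f (I # w))" using min[OF Iw] by simp
    moreover have "g (I # w) ?h = ?y - hform ?y (herm_root I) *\<^sub>R herm_root I"
      by (simp add: g_def A4pp.reflect_def)
    ultimately have "hform ?y (herm_root I) \<ge> 0"
      using f[OF w] f[OF Iw] hform_weyl_vec[OF I]
      by (simp add: A4pp.form_diff_right A4pp.form_scale_right)
    moreover have "hform ?y (herm_root I) \<noteq> 0"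
    proof -
      \<comment> \<open>the preimage \<open>v\<close> of the root under \<open>g w\<close> is at first only known to be in the dual lattice\<close>
      obtain T where T: "S ** T = mat 1" using SL2_H_right_inverse[OF S] by blast
      define v where "v = act T (A4pp.word_act (rev w) (herm_root I))"
      have "act S (act T X) = X" for X by (simp add: T flip: act_mult)
      then have gv: "g w v = herm_root I"
        by (simp add: g_def v_def A4pp.word_act_rev[OF w])
      have "hform v (herm_root J) \<in> \<int>" if "J \<in> nodes" for J
        using g_form[OF w, of v "herm_root J"] gv hform_hlat_Ints2 herm_root_in_hlat g_hlat w I that
        by metis
      moreover have norm: "hform v v = 2"
        using g_form[OF w, of v v] gv A4pp.root_norm[OF I] by simp
      ultimately have "hform ?h v \<noteq> 0"
        by (intro norm2_height_nonzero norm2_dual_in_hlat)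
      then show ?thesis using g_form[OF w, of ?h v] gv by simp
    qed
    moreover have "hform ?y (herm_root I) \<in> \<int>"
      using w I by (intro hform_hlat_Ints g_hlat weyl_vec_in_hlat)
    ultimately show ?thesis by (auto elim!: Ints_cases)
  qed
  then have y: "?y = ?h"
    using g_form[OF w] by (intro dominant_weyl_norm)
  have "g w (herm_root I) \<in> herm_root ` nodes" if I: "I \<in> nodes" for I
  proof -
    have "hform ?h (g w (herm_root I)) = 1"
      using g_form[OF w, of ?h "herm_root I"] y hform_weyl_vec[OF I] by simp
    moreover have "hform (g w (herm_root I)) (g w (herm_root I)) = 2"
      using g_form[OF w] A4pp.root_norm[OF I] by simp
    ultimately show ?thesis
      using norm2_height_one[OF g_hlat[OF w herm_root_in_hlat[OF I]]] by blast
  qed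
  with w that show ?thesis by (simp add: g_def)
qed

text \<open>The permutation of the simple roots is a symmetry of the diagram, and the parity of the word is
even because an odd word is not the action of a matrix.\<close>

theorem lattice_matrix_cases:
  assumes S: "S \<in> carrier SL2_H" and stable: "\<And>X. X \<in> hlat \<Longrightarrow> act S X \<in> hlat"
  obtains w where "w \<in> lists nodes" "even (length w)" "\<And>X. act S X = act (rotor w) X"
  | w where "w \<in> lists nodes" "even (length w)" "\<And>X. act S X = act (rotor w ** diag_flip) X"
proof -
  obtain w where w: "w \<in> lists nodes"
    and perm: "\<And>I. I \<in> nodes \<Longrightarrow> A4pp.word_act w (act S (herm_root I)) \<in> herm_root ` nodes"
    using lattice_matrix_permutes_roots[OF S stable] by blast
  define g where "g X = A4pp.word_act w (act S X)" for X
  have g_linear: "linear g"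
    using linear_compose[OF linear_act[of S] A4pp.linear_word_act[of w]]
    by (simp add: g_def[abs_def] o_def)
  have S_back: "act S X = A4pp.word_act (rev w) (g X)" for X
    by (simp add: g_def A4pp.word_act_rev[OF w])
  have "\<forall>I\<in>nodes. \<exists>J\<in>nodes. g (herm_root I) = herm_root J"
    using perm by (auto simp: g_def)
  then obtain \<pi> where \<pi>: "\<forall>I\<in>nodes. \<pi> I \<in> nodes \<and> g (herm_root I) = herm_root (\<pi> I)"
    by metis
  have "real_of_int (A4pp_cartan (\<pi> I) (\<pi> J)) = of_int (A4pp_cartan I J)"
    if "I \<in> nodes" "J \<in> nodes" for I J
  proof -
    have "of_int (A4pp_cartan (\<pi> I) (\<pi> J)) = hform (g (herm_root I)) (g (herm_root J))"
      using \<pi> that by (simp add: hform_roots)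
    also have "\<dots> = hform (herm_root I) (herm_root J)"
      by (simp add: g_def A4pp.form_word_act[OF w] hform_act[OF S])
    finally show ?thesis using that by (simp add: hform_roots)
  qed
  then have "(\<forall>I\<in>nodes. \<pi> I = I) \<or> (\<forall>I\<in>nodes. \<pi> I = diagram_aut I)"
    using \<pi> by (intro diagram_automorphisms) auto
  then show ?thesis
  proof
    assume "\<forall>I\<in>nodes. \<pi> I = I"
    with \<pi> have "g (herm_root I) = id (herm_root I)" if "I \<in> nodes" for I
      using that by (metis id_apply)
    then have "g X = id X" for X
      by (rule linear_eq_on_roots[OF g_linear linear_id])
    then have S_eq: "act S X = A4pp.word_act (rev w) X" for X by (simp add: S_back)
    have rev: "rev w \<in> lists nodes" using w by (auto simp: in_lists_conv_set)
    moreover have "even (length (rev w))"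
      using odd_word_not_act[OF rev, of S] S_eq by blast
    ultimately show ?thesis using that(1)[of "rev w"] by (simp add: S_eq act_rotor)
  next
    assume aut: "\<forall>I\<in>nodes. \<pi> I = diagram_aut I"
    have flip_linear: "linear (\<lambda>X. A4pp.word_act longest_word (act diag_flip X))"
      using linear_compose[OF linear_act[of diag_flip] A4pp.linear_word_act[of longest_word]]
      by (simp add: o_def)
    have "g (herm_root I) = A4pp.word_act longest_word (act diag_flip (herm_root I))"
      if "I \<in> nodes" for I
      using \<pi> aut that by (metis longest_word_diag_flip)
    then have "g X = A4pp.word_act longest_word (act diag_flip X)" for X
      by (rule linear_eq_on_roots[OF g_linear flip_linear])
    then have S_eq: "act S X = A4pp.word_act (rev w @ longest_word) (act diag_flip X)" for X
      by (simp add: S_back A4pp.word_act_append)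
    have v: "rev w @ longest_word \<in> lists nodes"
      using w longest_word_props by (auto simp: in_lists_conv_set)
    have "act (S ** diag_flip) X = A4pp.word_act (rev w @ longest_word) X" for X
      by (simp add: act_mult S_eq)
    then have "even (length (rev w @ longest_word))"
      using odd_word_not_act[OF v] by blast
    then show ?thesis
      using that(2)[OF v] by (simp only: S_eq act_rotor[OF v] act_mult)
  qed
qed


section \<open>The lattice conditions\<close>

lemma mem_hlat_iff: "(p, z, r) \<in> hlat \<longleftrightarrow> p \<in> \<int> \<and> z \<in> A4_lattice \<and> r \<in> \<int>"
  by (auto simp: hlat_def)

lemma hlat_scale: "X \<in> hlat \<Longrightarrow> c \<in> \<int> \<Longrightarrow> c *\<^sub>R X \<in> hlat"
  using hlat_combine[of X X "1 - c"] by (simp add: algebra_simps)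

lemma hlat_add: "X \<in> hlat \<Longrightarrow> Y \<in> hlat \<Longrightarrow> X + Y \<in> hlat"
  using hlat_combine[of X Y "-1"] by simp

lemma A4_latticeE:
  assumes "z \<in> A4_lattice"
  obtains n :: "nat \<Rightarrow> int" where "z = of_int (n 1) * simple_root (Suc 0) +
    of_int (n 2) * simple_root 2 + of_int (n 3) * simple_root 3 + of_int (n 4) * simple_root 4"
  using assms unfolding A4_lattice_def sum_1_4 by auto

lemma A4_latticeI:
  "of_int a * simple_root (Suc 0) + of_int b * simple_root 2 + of_int c * simple_root 3 +
    of_int d * simple_root 4 \<in> A4_lattice"
  unfolding A4_lattice_def sum_1_4 mem_Collect_eq
  by (rule exI[where x = "\<lambda>i. if i = Suc 0 then a else if i = 2 then b else if i = 3 then c else d"])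
     simp

lemma qcnj_in_A4_lattice_iff: "qcnj z \<in> A4_lattice \<longleftrightarrow> z \<in> A4_lattice"
proof -
  have "qcnj z \<in> A4_lattice" if z: "z \<in> A4_lattice" for z
  proof -
    obtain n :: "nat \<Rightarrow> int" where n: "z = of_int (n 1) * simple_root (Suc 0) +
        of_int (n 2) * simple_root 2 + of_int (n 3) * simple_root 3 + of_int (n 4) * simple_root 4"
      using A4_latticeE[OF z] .
    have "qcnj z = of_int (n 1 - n 2) * simple_root (Suc 0) + of_int (- n 2) * simple_root 2
        + of_int (- n 3) * simple_root 3 + of_int (- n 4) * simple_root 4"
      unfolding n simple_root_eqs by (simp add: quat_comps of_int_quat)
    then show ?thesis by (simp only: A4_latticeI)
  qed
  from this[of z] this[of "qcnj z"] show ?thesis by auto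
qed

lemma simple_root_in_hlat: "i \<in> {1..4} \<Longrightarrow> (0, simple_root i, 0) \<in> hlat"
  using herm_root_in_hlat[of "int i"]
  by (auto simp: herm_root_def A4pp_nodes_def numeral_eq_Suc le_Suc_eq)

text \<open>The conditions are those for the images of the two diagonal matrix units and of the four
off-diagonal matrices with entry \<open>a\<^sub>i\<close>, which together generate the lattice. The conditions use
the lower left entries \<open>c \<cdot> qcnj a\<close> and \<open>d \<cdot> qcnj b\<close>, the action the upper right ones; \<open>A4_lattice\<close> is
closed under conjugation.\<close>

lemma lattice_conditions_iff:
  "lattice_conditions a b c d \<longleftrightarrow> (\<forall>X\<in>hlat. act (mat2 a b c d) X \<in> hlat)"
proof -
  let ?S = "mat2 a b c d"
  have off: "act ?S (1, 0, 0) \<in> hlat \<longleftrightarrow>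
      a * qcnj a \<in> \<int> \<and> c * qcnj a \<in> A4_lattice \<and> c * qcnj c \<in> \<int>"
    "act ?S (0, 0, 1) \<in> hlat \<longleftrightarrow>
      b * qcnj b \<in> \<int> \<and> d * qcnj b \<in> A4_lattice \<and> d * qcnj d \<in> \<int>"
    using qcnj_in_A4_lattice_iff[of "a * qcnj c"] qcnj_in_A4_lattice_iff[of "b * qcnj d"]
    by (simp_all add: mem_hlat_iff quat_mult_qcnj qcnj_mult)
  have root: "act ?S (0, s, 0) \<in> hlat \<longleftrightarrow>
      a * s * qcnj b + b * qcnj s * qcnj a \<in> \<int> \<and> c * s * qcnj d + d * qcnj s * qcnj c \<in> \<int> \<and>
      a * s * qcnj d + b * qcnj s * qcnj c \<in> A4_lattice" for s
  proof -
    have "x * s * qcnj y + y * qcnj s * qcnj x = of_real (2 * inner (x * s) y)" for x y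
      using quat_mult_qcnj_sum[of "x * s" y] by (simp add: qcnj_mult mult.assoc)
    then show ?thesis by (simp only: herm_simps mem_hlat_iff of_real_in_Ints_iff) auto
  qed
  have "lattice_conditions a b c d \<longleftrightarrow> act ?S (1, 0, 0) \<in> hlat \<and> act ?S (0, 0, 1) \<in> hlat \<and>
      (\<forall>i\<in>{1..4}. act ?S (0, simple_root i, 0) \<in> hlat)"
    unfolding lattice_conditions_def off root by blast
  also have "\<dots> \<longleftrightarrow> (\<forall>X\<in>hlat. act ?S X \<in> hlat)"
  proof (intro iffI ballI)
    fix X assume basis: "act ?S (1, 0, 0) \<in> hlat \<and> act ?S (0, 0, 1) \<in> hlat \<and>
      (\<forall>i\<in>{1..4}. act ?S (0, simple_root i, 0) \<in> hlat)" and X: "X \<in> hlat"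
    obtain p z r where Xeq: "X = (p, z, r)" by (cases X)
    with X have pzr: "p \<in> \<int>" "z \<in> A4_lattice" "r \<in> \<int>" by (simp_all add: mem_hlat_iff)
    obtain n :: "nat \<Rightarrow> int" where n: "z = of_int (n 1) * simple_root (Suc 0) +
        of_int (n 2) * simple_root 2 + of_int (n 3) * simple_root 3 + of_int (n 4) * simple_root 4"
      using A4_latticeE[OF pzr(2)] .
    have scale: "of_int k * s = real_of_int k *\<^sub>R (s :: quat)" for k s
      by (simp add: scaleR_conv_of_real)
    have "X = p *\<^sub>R (1, 0, 0) + r *\<^sub>R (0, 0, 1) +
       (real_of_int (n 1) *\<^sub>R (0, simple_root (Suc 0), 0) + real_of_int (n 2) *\<^sub>R (0, simple_root 2, 0) +
        real_of_int (n 3) *\<^sub>R (0, simple_root 3, 0) + real_of_int (n 4) *\<^sub>R (0, simple_root 4, 0))"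
      by (simp add: Xeq n scale)
    then have eq: "act ?S X = p *\<^sub>R act ?S (1, 0, 0) + r *\<^sub>R act ?S (0, 0, 1) +
       (real_of_int (n 1) *\<^sub>R act ?S (0, simple_root (Suc 0), 0) +
        real_of_int (n 2) *\<^sub>R act ?S (0, simple_root 2, 0) +
        real_of_int (n 3) *\<^sub>R act ?S (0, simple_root 3, 0) +
        real_of_int (n 4) *\<^sub>R act ?S (0, simple_root 4, 0))"
      by (simp only: linear_add[OF linear_act] linear_scale[OF linear_act])
    have "act ?S (0, simple_root i, 0) \<in> hlat" if "i \<in> {1..4}" for i
      using basis that by blast
    from this[of "Suc 0"] this[of 2] this[of 3] this[of 4] show "act ?S X \<in> hlat"
      unfolding eq using basis pzr by (intro hlat_add hlat_scale; (simp del: herm_simps)?)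
  next
    assume "\<forall>X\<in>hlat. act ?S X \<in> hlat"
    moreover have "(1, 0, 0) \<in> hlat" "(0, 0, 1) \<in> hlat"
      using A4_latticeI[of 0 0 0 0] by (simp_all add: mem_hlat_iff)
    ultimately show "act ?S (1, 0, 0) \<in> hlat \<and> act ?S (0, 0, 1) \<in> hlat \<and>
      (\<forall>i\<in>{1..4}. act ?S (0, simple_root i, 0) \<in> hlat)"
      using simple_root_in_hlat by blast
  qed
  finally show ?thesis .
qed

definition lattice_stable :: "qmat \<Rightarrow> bool" where
  "lattice_stable S \<longleftrightarrow> (\<forall>X\<in>hlat. act S X \<in> hlat)"

lemma lattice_conditions_iff_stable:
  "lattice_conditions (S $ 1 $ 1) (S $ 1 $ 2) (S $ 2 $ 1) (S $ 2 $ 2) \<longleftrightarrow> lattice_stable S"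
  by (cases S rule: qmat_cases) (simp add: lattice_conditions_iff lattice_stable_def)


section \<open>Icosian entries\<close>

lemma quat_units_Quat: "qi = Quat 0 1 0 0" "qj = Quat 0 0 1 0" "qk = Quat 0 0 0 1"
  by (simp_all add: qi_def qj_def qk_def)

lemma even_perm_01_23: "Transposition.transpose 0 1 \<circ> Transposition.transpose 2 3 permutes {0..3::nat}"
    "evenperm (Transposition.transpose 0 1 \<circ> Transposition.transpose 2 (3::nat))"
  by (intro permutes_compose permutes_swap_id; simp)
     (simp add: evenperm_comp permutation_swap_id evenperm_swap)

lemma even_perm_02_13: "Transposition.transpose 0 2 \<circ> Transposition.transpose 1 3 permutes {0..3::nat}"
    "evenperm (Transposition.transpose 0 2 \<circ> Transposition.transpose 1 (3::nat))"
  by (intro permutes_compose permutes_swap_id; simp)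
     (simp add: evenperm_comp permutation_swap_id evenperm_swap)

lemma even_perm_132: "Transposition.transpose 1 3 \<circ> Transposition.transpose 2 3 permutes {0..3::nat}"
    "evenperm (Transposition.transpose 1 3 \<circ> Transposition.transpose 2 (3::nat))"
  by (intro permutes_compose permutes_swap_id; simp)
     (simp add: evenperm_comp permutation_swap_id evenperm_swap)

lemma icosian_unitI:
  assumes "p permutes {0..3}" "evenperm p" "{s1, s2, s3} \<subseteq> {1, -1 :: real}"
    "v = (\<lambda>_ :: nat. 0 :: real)(1 := s1, 2 := s2 * \<sigma>, 3 := s3 * \<tau>)"
    "x = (1/2) *\<^sub>R Quat (v (p 0)) (v (p 1)) (v (p 2)) (v (p 3))"
  shows "x \<in> icosian_units"
  using assms unfolding icosian_units_def by blast

lemma hurwitz_unitI: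
  "s \<in> {1, -1} \<Longrightarrow> u \<in> {1, qi, qj, qk} \<Longrightarrow> s *\<^sub>R u \<in> hurwitz_units"
  "{s0, s1, s2, s3} \<subseteq> {1, -1} \<Longrightarrow> (1/2) *\<^sub>R Quat s0 s1 s2 s3 \<in> hurwitz_units"
  unfolding hurwitz_units_def by blast+

lemma icosian_units_examples:
  "1 \<in> icosian_units" "qi \<in> icosian_units" "qj \<in> icosian_units"
  "simple_root 2 \<in> icosian_units" "simple_root 4 \<in> icosian_units"
  "qi * simple_root 4 \<in> icosian_units" "qj * simple_root 4 \<in> icosian_units"
  "simple_root 2 * simple_root 4 \<in> icosian_units" "highest_root \<in> icosian_units"
proof -
  have hurwitz: "x \<in> icosian_units" if "x \<in> hurwitz_units" for x
    using that by (simp add: icosian_units_def)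
  have "1 *\<^sub>R x \<in> icosian_units" if "x \<in> {1, qi, qj, qk}" for x
    using that by (intro hurwitz hurwitz_unitI) simp_all
  from this[of 1] this[of qi] this[of qj]
  show "1 \<in> icosian_units" "qi \<in> icosian_units" "qj \<in> icosian_units" by simp_all
  have "(1/2) *\<^sub>R Quat (-1) 1 (-1) (-1) \<in> icosian_units"
    by (intro hurwitz hurwitz_unitI) simp
  then show "simple_root 2 \<in> icosian_units"
    by (simp add: simple_root_eqs scaleR_quat_def)
  show "simple_root 4 \<in> icosian_units"
    by (rule icosian_unitI[OF permutes_id evenperm_id[THEN eqTrueE] _ HOL.refl, of 1 1 1])
       (simp_all add: simple_root_eqs scaleR_quat_def)
  show "qi * simple_root 4 \<in> icosian_units"
    by (rule icosian_unitI[OF even_perm_01_23 _ HOL.refl, of "-1" 1 "-1"])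
       (simp_all add: simple_root_eqs quat_units_Quat scaleR_quat_def times_quat_def Transposition.transpose_def)
  show "qj * simple_root 4 \<in> icosian_units"
    by (rule icosian_unitI[OF even_perm_02_13 _ HOL.refl, of "-1" "-1" 1])
       (simp_all add: simple_root_eqs quat_units_Quat scaleR_quat_def times_quat_def Transposition.transpose_def)
  show "simple_root 2 * simple_root 4 \<in> icosian_units"
    by (rule icosian_unitI[OF even_perm_132 _ HOL.refl, of "-1" 1 "-1"])
       (simp_all add: simple_root_eqs scaleR_quat_def times_quat_def Transposition.transpose_def sigma_eq
         field_simps tau_mult)
  have "highest_root = (1/2) *\<^sub>R Quat 1 0 (-\<tau>) (-\<sigma>)"
    by (simp add: highest_root_eq scaleR_quat_def)
  then show "highest_root \<in> icosian_units"
    by (intro icosian_unitI[OF even_perm_01_23 _ HOL.refl, of 1 "-1" "-1"])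
       (simp_all add: Transposition.transpose_def)
qed

text \<open>The icosians are defined by sums over all units, and a sum over an infinite set would be zero.\<close>

lemma finite_icosian_units: "finite icosian_units"
proof -
  define s :: "real set" where "s = {1, -1}"
  have h1: "hurwitz_units \<subseteq> (\<lambda>(x, u). x *\<^sub>R u) ` (s \<times> {1, qi, qj, qk}) \<union>
      (\<lambda>(a, b, c, d). (1/2) *\<^sub>R Quat a b c d) ` (s \<times> s \<times> s \<times> s)"
    unfolding hurwitz_units_def s_def by force
  have h2: "{(1/2) *\<^sub>R Quat (v (p 0)) (v (p 1)) (v (p 2)) (v (p 3)) | v p s1 s2 s3.
        {s1, s2, s3} \<subseteq> {1, -1 :: real} \<and>
        v = (\<lambda>_ :: nat. 0 :: real)(1 := s1, 2 := s2 * \<sigma>, 3 := s3 * \<tau>) \<and>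
        p permutes {0..3} \<and> evenperm p} \<subseteq>
      (\<lambda>(v, p). (1/2) *\<^sub>R Quat (v (p 0)) (v (p 1)) (v (p 2)) (v (p 3))) `
      ((\<lambda>(a, b, c). (\<lambda>_ :: nat. 0 :: real)(1 := a, 2 := b * \<sigma>, 3 := c * \<tau>)) ` (s \<times> s \<times> s)
        \<times> {p. p permutes {0..3::nat}})"
  proof (intro subsetI, elim CollectE exE conjE)
    fix x p s1 s2 s3 and v :: "nat \<Rightarrow> real"
    assume x: "x = (1/2) *\<^sub>R Quat (v (p 0)) (v (p 1)) (v (p 2)) (v (p 3))"
      and s123: "{s1, s2, s3} \<subseteq> {1, -1 :: real}"
      and v: "v = (\<lambda>_ :: nat. 0 :: real)(1 := s1, 2 := s2 * \<sigma>, 3 := s3 * \<tau>)"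
      and p: "p permutes {0..3}"
    have "v \<in> (\<lambda>(a, b, c). (\<lambda>_ :: nat. 0 :: real)(1 := a, 2 := b * \<sigma>, 3 := c * \<tau>)) ` (s \<times> s \<times> s)"
    proof (rule image_eqI[where x = "(s1, s2, s3)"])
      have "s1 \<in> s" "s2 \<in> s" "s3 \<in> s" using s123 by (simp_all add: s_def)
      then show "(s1, s2, s3) \<in> s \<times> s \<times> s" by blast
    qed (simp add: v)
    with p show "x \<in> (\<lambda>(v, p). (1/2) *\<^sub>R Quat (v (p 0)) (v (p 1)) (v (p 2)) (v (p 3))) `
      ((\<lambda>(a, b, c). (\<lambda>_ :: nat. 0 :: real)(1 := a, 2 := b * \<sigma>, 3 := c * \<tau>)) ` (s \<times> s \<times> s)
        \<times> {p. p permutes {0..3::nat}})"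
      by (intro image_eqI[where x = "(v, p)"]) (simp_all add: x)
  qed
  have "finite s" "finite {p. p permutes {0..3::nat}}"
    by (simp add: s_def) (rule finite_permutations, simp)
  note fin = finite_UnI finite_imageI finite_cartesian_product this
  have "finite hurwitz_units" by (rule finite_subset[OF h1]) (intro fin; simp)
  moreover note finite_subset[OF h2]
  ultimately show ?thesis unfolding icosian_units_def by (simp add: fin)
qed

lemma icosian_unit_in_icosians:
  assumes "u \<in> icosian_units"
  shows "u \<in> icosians"
proof -
  have "(\<Sum>x\<in>icosian_units. of_int (if x = u then 1 else 0) * x) =
      (\<Sum>x\<in>icosian_units. if x = u then x else 0)"
    by (rule sum.cong) auto
  also have "\<dots> = u"
    using assms finite_icosian_units by simp
  finally show ?thesis
    unfolding icosians_def mem_Collect_eq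
    by (intro exI[where x = "\<lambda>x. if x = u then 1 else 0"]) simp
qed

lemma icosians_add:
  assumes "x \<in> icosians" "y \<in> icosians"
  shows "x + y \<in> icosians"
proof -
  from assms obtain m n :: "quat \<Rightarrow> int" where
    "x = (\<Sum>u\<in>icosian_units. of_int (m u) * u)" "y = (\<Sum>u\<in>icosian_units. of_int (n u) * u)"
    unfolding icosians_def by blast
  then have "x + y = (\<Sum>u\<in>icosian_units. of_int (m u + n u) * u)"
    by (simp add: sum.distrib algebra_simps)
  then show ?thesis
    unfolding icosians_def mem_Collect_eq by (intro exI[where x = "\<lambda>u. m u + n u"]) simp
qed

lemma icosians_scale:
  assumes "x \<in> icosians"
  shows "of_int k * x \<in> icosians"
proof -
  from assms obtain n :: "quat \<Rightarrow> int" where "x = (\<Sum>u\<in>icosian_units. of_int (n u) * u)"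
    unfolding icosians_def by blast
  then have "of_int k * x = (\<Sum>u\<in>icosian_units. of_int (k * n u) * u)"
    by (simp add: sum_distrib_left mult.assoc)
  then show ?thesis
    unfolding icosians_def mem_Collect_eq by (intro exI[where x = "\<lambda>u. k * n u"]) simp
qed

text \<open>The entries of the matrices of words arise from 1 by addition and by left multiplication with
  elements of \<open>A4_lattice\<close>. To see that they are icosians, a basis is used that consists of
  units and whose span is closed under these operations: the Hurwitz basis \<open>1, i, j, a\<^sub>2\<close> and its right multiples
  by \<open>a\<^sub>4\<close>.\<close>

definition icosian_comb :: "int \<Rightarrow> int \<Rightarrow> int \<Rightarrow> int \<Rightarrow> int \<Rightarrow> int \<Rightarrow> int \<Rightarrow> int \<Rightarrow> quat" where
  "icosian_comb a b c d e f g h =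
     of_int a * 1 + of_int b * qi + of_int c * qj + of_int d * simple_root 2 +
     of_int e * simple_root 4 + of_int f * (qi * simple_root 4) + of_int g * (qj * simple_root 4) +
     of_int h * (simple_root 2 * simple_root 4)"

definition icosian_span :: "quat set" where
  "icosian_span = {icosian_comb a b c d e f g h | a b c d e f g h. True}"

lemma icosian_span_subset: "icosian_span \<subseteq> icosians"
  unfolding icosian_span_def icosian_comb_def
  by (clarify, intro icosians_add icosians_scale icosian_units_examples[THEN icosian_unit_in_icosians])

lemma icosian_comb_in_span: "icosian_comb a b c d e f g h \<in> icosian_span"
  unfolding icosian_span_def by blast

lemma icosian_spanE:
  assumes "x \<in> icosian_span"
  obtains a b c d e f g h where "x = icosian_comb a b c d e f g h"
  using assms unfolding icosian_span_def by blast

lemma icosian_span_add: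
  assumes "x \<in> icosian_span" "y \<in> icosian_span"
  shows "x + y \<in> icosian_span"
proof -
  have "icosian_comb a b c d e f g h + icosian_comb a' b' c' d' e' f' g' h' =
    icosian_comb (a + a') (b + b') (c + c') (d + d') (e + e') (f + f') (g + g') (h + h')"
    for a b c d e f g h a' b' c' d' e' f' g' h'
    by (simp add: icosian_comb_def algebra_simps)
  with assms show ?thesis
    by (metis icosian_spanE icosian_comb_in_span)
qed

lemma icosian_span_scale:
  assumes "x \<in> icosian_span"
  shows "of_int k * x \<in> icosian_span"
proof -
  have "of_int k * icosian_comb a b c d e f g h =
    icosian_comb (k * a) (k * b) (k * c) (k * d) (k * e) (k * f) (k * g) (k * h)"
    for a b c d e f g h
    by (simp only: icosian_comb_def distrib_left of_int_mult mult.assoc)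
  with assms show ?thesis
    by (metis icosian_spanE icosian_comb_in_span)
qed

lemma icosian_comb_Quat: "icosian_comb a b c d e f g h =
   Quat (of_int a - of_int d / 2 - of_int f / 2 - \<sigma> * of_int g / 2)
        (of_int b + of_int d / 2 + of_int e / 2 + \<tau> * of_int g / 2 - \<tau> * of_int h / 2)
        (of_int c - of_int d / 2 + \<sigma> * of_int e / 2 - \<tau> * of_int f / 2 - of_int h / 2)
        (- of_int d / 2 + \<tau> * of_int e / 2 + \<sigma> * of_int f / 2 - of_int g / 2 + \<sigma> * of_int h / 2)"
  unfolding icosian_comb_def simple_root_eqs quat_units_Quat
  by (simp add: quat_comps of_int_quat sigma_eq field_simps tau_mult)

lemma simple_roots_mult_span:
  assumes "x \<in> icosian_span"
  shows "simple_root (Suc 0) * x \<in> icosian_span" "simple_root 2 * x \<in> icosian_span"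
    "simple_root 3 * x \<in> icosian_span" "simple_root 4 * x \<in> icosian_span"
proof -
  obtain a b c d e f g h where x: "x = icosian_comb a b c d e f g h"
    using icosian_spanE[OF assms] .
  have "simple_root (Suc 0) = 1" by (simp add: simple_root_def)
  then show "simple_root (Suc 0) * x \<in> icosian_span" using assms by simp
  have "simple_root 2 * x = icosian_comb (- b - d) c (- b - c) (a - b - c - d)
      (- f - h) g (- f - g) (e - f - g - h)"
    unfolding x icosian_comb_Quat simple_root_eqs
    by (simp add: times_quat_def sigma_eq field_simps tau_mult)
  then show "simple_root 2 * x \<in> icosian_span" by (simp only: icosian_comb_in_span)
  have "simple_root 3 * x = icosian_comb (b + c) (- a - c + d) (c - d) (2 * c - d)
      (f + g) (- e - g + h) (g - h) (2 * g - h)"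
    unfolding x icosian_comb_Quat simple_root_eqs
    by (simp add: times_quat_def sigma_eq field_simps tau_mult)
  then show "simple_root 3 * x \<in> icosian_span" by (simp only: icosian_comb_in_span)
  have "simple_root 4 * x = icosian_comb (- b - c - e - g + h) (f + g) (- g) (- c - 2 * g + h)
      (a + c - d - f - g) (- b - c) c (2 * c - d - g)"
    unfolding x icosian_comb_Quat simple_root_eqs
    by (simp add: times_quat_def sigma_eq field_simps tau_mult)
  then show "simple_root 4 * x \<in> icosian_span" by (simp only: icosian_comb_in_span)
qed

lemma A4_lattice_mult_span:
  assumes "z \<in> A4_lattice" "x \<in> icosian_span"
  shows "z * x \<in> icosian_span"
proof -
  obtain n :: "nat \<Rightarrow> int" where n: "z = of_int (n 1) * simple_root (Suc 0) +
      of_int (n 2) * simple_root 2 + of_int (n 3) * simple_root 3 + of_int (n 4) * simple_root 4"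
    using A4_latticeE[OF assms(1)] .
  show ?thesis
    unfolding n distrib_right mult.assoc
    by (intro icosian_span_add icosian_span_scale simple_roots_mult_span assms)
qed

definition icosian_entries :: "qmat \<Rightarrow> bool" where
  "icosian_entries S \<longleftrightarrow> (\<forall>i j. S $ i $ j \<in> icosian_span)"

lemma icosian_entries_mat2: "icosian_entries (mat2 a b c d) \<longleftrightarrow>
    a \<in> icosian_span \<and> b \<in> icosian_span \<and> c \<in> icosian_span \<and> d \<in> icosian_span"
  by (auto simp: icosian_entries_def forall_2)

lemma icosian_entries_hmat_mult:
  assumes "X \<in> hlat" "icosian_entries S"
  shows "icosian_entries (hmat X ** S)"
proof (cases S rule: qmat_cases)
  case (1 a b c d)
  obtain p r :: int and z where X: "X = (of_int p, z, of_int r)" and z: "z \<in> A4_lattice"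
    using assms(1) by (auto simp: hlat_def elim!: Ints_cases)
  have "qcnj z \<in> A4_lattice" using z by (simp add: qcnj_in_A4_lattice_iff)
  then show ?thesis
    using assms(2) z unfolding 1 X
    by (auto simp: mat2_mult icosian_entries_mat2
        intro!: icosian_span_add A4_lattice_mult_span icosian_span_scale)
qed

lemma hadj_in_hlat: "X \<in> hlat \<Longrightarrow> hadj X \<in> hlat"
  by (auto simp: hlat_def A4_lattice_uminus_iff)

lemma icosian_span_0_1: "0 \<in> icosian_span" "1 \<in> icosian_span"
proof -
  show "0 \<in> icosian_span"
    using icosian_comb_in_span[of 0 0 0 0 0 0 0 0] by (simp add: icosian_comb_def)
  show "1 \<in> icosian_span"
    using icosian_comb_in_span[of 1 0 0 0 0 0 0 0] by (simp add: icosian_comb_def)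
qed

lemma icosian_entries_rotor: "w \<in> lists nodes \<Longrightarrow> icosian_entries (rotor w)"
  by (induction w rule: rotor.induct)
     (auto simp: mat2_one icosian_entries_mat2 icosian_span_0_1 simp flip: matrix_mul_assoc
       intro!: icosian_entries_hmat_mult hadj_in_hlat herm_root_in_hlat)


section \<open>Galois conjugation of icosians\<close>

lemma sqrt_5_irrational: "sqrt 5 \<notin> \<rat>"
proof
  assume "sqrt 5 \<in> \<rat>"
  then obtain m n :: nat where mn: "n \<noteq> 0" "\<bar>sqrt 5\<bar> = real m / real n" "coprime m n"
    by (rule Rats_abs_nat_div_natE)
  then have "real m = sqrt 5 * real n" by (simp add: field_simps)
  then have "real (m\<^sup>2) = real (5 * n\<^sup>2)" by (simp add: power_mult_distrib)
  then have eq: "m\<^sup>2 = 5 * n\<^sup>2" by (simp only: of_nat_eq_iff)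
  have prime: "prime (5::nat)" by simp
  have "5 dvd m" using eq prime_dvd_power[OF prime, of m 2] by simp
  then obtain k where "m = 5 * k" by blast
  with eq have "n\<^sup>2 = 5 * k\<^sup>2" by (simp add: power2_eq_square)
  then have "5 dvd n" using prime_dvd_power[OF prime, of n 2] by simp
  with \<open>5 dvd m\<close> mn(3) show False by (auto simp: coprime_def)
qed

text \<open>Irrationality of \<open>sqrt 5\<close> makes the description in the definition unique.\<close>

lemma galois_conj_eq:
  assumes "p \<in> \<rat>" "q \<in> \<rat>"
  shows "galois_conj (p + q * \<tau>) = p + q * \<sigma>"
proof -
  have unique: "y = p + q * \<sigma>" if "r \<in> \<rat>" "s \<in> \<rat>" "p + q * \<tau> = r + sqrt 5 * s" "y = r - sqrt 5 * s"
    for r s y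
  proof -
    have eq: "sqrt 5 * (q / 2 - s) = r - p - q / 2"
      using that(3) by (simp add: \<tau>_def field_simps)
    have "q / 2 - s = 0"
    proof (rule ccontr)
      assume "q / 2 - s \<noteq> 0"
      then have "sqrt 5 = (r - p - q / 2) / (q / 2 - s)" using eq by (simp add: field_simps)
      then show False using assms that sqrt_5_irrational by simp
    qed
    with eq that(4) show ?thesis by (simp add: \<sigma>_def field_simps)
  qed
  have "p + q * \<tau> = (p + q / 2) + sqrt 5 * (q / 2)" "p + q * \<sigma> = (p + q / 2) - sqrt 5 * (q / 2)"
    by (simp_all add: \<tau>_def \<sigma>_def field_simps)
  moreover have "p + q / 2 \<in> \<rat>" "q / 2 \<in> \<rat>" using assms by simp_all
  ultimately show ?thesis
    unfolding galois_conj_def by (intro the_equality) (use unique in blast)+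
qed

definition rat_tau :: "real set" where
  "rat_tau = {p + q * \<tau> | p q. p \<in> \<rat> \<and> q \<in> \<rat>}"

lemma rat_tauI: "p \<in> \<rat> \<Longrightarrow> q \<in> \<rat> \<Longrightarrow> p + q * \<tau> \<in> rat_tau"
  by (auto simp: rat_tau_def)

lemma rat_tau_add:
  assumes "x \<in> rat_tau" "y \<in> rat_tau"
  shows "x + y \<in> rat_tau" "galois_conj (x + y) = galois_conj x + galois_conj y"
proof -
  from assms obtain p q r s where pq: "p \<in> \<rat>" "q \<in> \<rat>" "r \<in> \<rat>" "s \<in> \<rat>"
    and x: "x = p + q * \<tau>" and y: "y = r + s * \<tau>"
    by (auto simp: rat_tau_def)
  have eq: "x + y = (p + r) + (q + s) * \<tau>" by (simp add: x y algebra_simps)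
  show "x + y \<in> rat_tau" unfolding eq using pq by (intro rat_tauI) simp_all
  show "galois_conj (x + y) = galois_conj x + galois_conj y"
    unfolding eq unfolding x y using pq by (simp add: galois_conj_eq) (simp add: algebra_simps)
qed

lemma rat_tau_mult:
  assumes "x \<in> rat_tau" "y \<in> rat_tau"
  shows "x * y \<in> rat_tau" "galois_conj (x * y) = galois_conj x * galois_conj y"
proof -
  from assms obtain p q r s where pq: "p \<in> \<rat>" "q \<in> \<rat>" "r \<in> \<rat>" "s \<in> \<rat>"
    and x: "x = p + q * \<tau>" and y: "y = r + s * \<tau>"
    by (auto simp: rat_tau_def)
  have eq: "x * y = (p * r + q * s) + (p * s + q * r + q * s) * \<tau>"
    by (simp add: x y algebra_simps tau_mult)
  show "x * y \<in> rat_tau" unfolding eq using pq by (intro rat_tauI) simp_all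
  have "galois_conj (x * y) = (p * r + q * s) + (p * s + q * r + q * s) * \<sigma>"
    unfolding eq using pq by (intro galois_conj_eq) simp_all
  also have "\<dots> = (p + q * \<sigma>) * (r + s * \<sigma>)"
    by (simp add: sigma_eq algebra_simps tau_mult)
  finally show "galois_conj (x * y) = galois_conj x * galois_conj y"
    using pq by (simp add: x y galois_conj_eq)
qed

lemma rat_tau_Rats:
  assumes "x \<in> \<rat>"
  shows "x \<in> rat_tau" "galois_conj x = x"
  using rat_tauI[OF assms Rats_0] galois_conj_eq[OF assms Rats_0] by simp_all

lemma rat_tau_uminus:
  assumes "x \<in> rat_tau"
  shows "- x \<in> rat_tau" "galois_conj (- x) = - galois_conj x"
  using rat_tau_mult[OF rat_tau_Rats(1)[of "-1"] assms] rat_tau_Rats(2)[of "-1"] by simp_all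

lemma rat_tau_diff:
  assumes "x \<in> rat_tau" "y \<in> rat_tau"
  shows "x - y \<in> rat_tau" "galois_conj (x - y) = galois_conj x - galois_conj y"
  using rat_tau_add[OF assms(1) rat_tau_uminus(1)[OF assms(2)]] rat_tau_uminus(2)[OF assms(2)]
  by simp_all

lemma rat_tau_tau: "\<tau> / 2 \<in> rat_tau" "\<sigma> / 2 \<in> rat_tau"
    "galois_conj (\<tau> / 2) = \<sigma> / 2" "galois_conj (\<sigma> / 2) = \<tau> / 2"
proof -
  show "\<tau> / 2 \<in> rat_tau" "galois_conj (\<tau> / 2) = \<sigma> / 2"
    using rat_tauI[of 0 "1/2"] galois_conj_eq[of 0 "1/2"] by simp_all
  have "\<sigma> / 2 = 1/2 + (-1/2) * \<tau>" "1/2 + (-1/2) * \<sigma> = \<tau> / 2"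
    by (simp_all add: sigma_eq field_simps)
  moreover have "1/2 \<in> \<rat>" "-1/2 \<in> \<rat>" by simp_all
  ultimately show "\<sigma> / 2 \<in> rat_tau" "galois_conj (\<sigma> / 2) = \<tau> / 2"
    using rat_tauI[of "1/2" "-1/2"] galois_conj_eq[of "1/2" "-1/2"] by metis+
qed

definition rat_tau_quat :: "quat \<Rightarrow> bool" where
  "rat_tau_quat x \<longleftrightarrow> qRe x \<in> rat_tau \<and> qIm1 x \<in> rat_tau \<and> qIm2 x \<in> rat_tau \<and> qIm3 x \<in> rat_tau"

lemmas rat_tau_simps = rat_tau_add rat_tau_mult rat_tau_diff rat_tau_uminus

text \<open>Exchanging \<open>j\<close> and \<open>k\<close> and changing the signs of all three imaginary units is an
  automorphism of the quaternions, and so is Galois conjugation of the components.\<close>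

lemma icosian_star_mult:
  assumes "rat_tau_quat x" "rat_tau_quat y"
  shows "rat_tau_quat (x * y)" "icosian_star (x * y) = icosian_star x * icosian_star y"
  using assms unfolding rat_tau_quat_def icosian_star_def times_quat_def
  by (simp_all add: rat_tau_simps)

lemma icosian_star_uminus:
  assumes "rat_tau_quat x"
  shows "rat_tau_quat (- x)" "icosian_star (- x) = - icosian_star x"
  using assms unfolding rat_tau_quat_def icosian_star_def uminus_quat_def
  by (simp_all add: rat_tau_simps)

lemma icosian_star_roots:
  assumes "i \<in> {Suc 0, 2, 3, 4}"
  shows "rat_tau_quat (simple_root i)" "icosian_star (simple_root i) = qcnj (simple_root i)"
proof -
  have "(0::real) \<in> rat_tau" "galois_conj 0 = 0" "(1::real) \<in> rat_tau" "galois_conj 1 = 1"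
    "1/2 \<in> rat_tau" "galois_conj (1/2) = 1/2"
    by (simp_all add: rat_tau_Rats)
  with assms show "rat_tau_quat (simple_root i)" "icosian_star (simple_root i) = qcnj (simple_root i)"
    by (auto simp: simple_root_eqs rat_tau_quat_def icosian_star_def qcnj_def rat_tau_tau rat_tau_simps)
qed

lemma icosian_star_highest_root: "icosian_star highest_root = qcnj highest_root"
  by (simp add: highest_root_eq icosian_star_def qcnj_def rat_tau_tau rat_tau_simps rat_tau_Rats)


section \<open>The matrices of even words\<close>

definition even_matrices :: "qmat set" where
  "even_matrices = {S. \<exists>w\<in>lists nodes. even (length w) \<and> (S = rotor w \<or> S = - rotor w)}"

lemma even_matricesI:
  "w \<in> lists nodes \<Longrightarrow> even (length w) \<Longrightarrow> rotor w \<in> even_matrices"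
  "w \<in> lists nodes \<Longrightarrow> even (length w) \<Longrightarrow> - rotor w \<in> even_matrices"
  by (auto simp: even_matrices_def)

lemma even_matrices_uminus: "S \<in> even_matrices \<Longrightarrow> - S \<in> even_matrices"
  by (auto simp: even_matrices_def)

lemma even_matrices_mult:
  assumes "S \<in> even_matrices" "T \<in> even_matrices"
  shows "S ** T \<in> even_matrices"
proof -
  obtain u v where u: "u \<in> lists nodes" "even (length u)" "S = rotor u \<or> S = - rotor u"
    and v: "v \<in> lists nodes" "even (length v)" "T = rotor v \<or> T = - rotor v"
    using assms by (auto simp: even_matrices_def)
  then have "S ** T = rotor (u @ v) \<or> S ** T = - rotor (u @ v)"
    by (auto simp: rotor_append qmat_mult_minus)
  then show ?thesis
    using u v unfolding even_matrices_def by (auto intro!: bexI[of _ "u @ v"])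
qed

lemma herm_root_simple: "i \<in> {Suc 0, 2, 3, 4} \<Longrightarrow> herm_root (int i) = (0, simple_root i, 0)"
  by (auto simp: herm_root_def)

text \<open>Here \<open>diag(a, a\<^sup>*)\<close> acts as an even word. As \<open>a \<mapsto> a\<^sup>*\<close> is multiplicative, such \<open>a\<close> are
closed under products, and to obtain all 120 icosian units it suffices to find generators.\<close>

definition weyl_unit :: "quat \<Rightarrow> bool" where
  "weyl_unit a \<longleftrightarrow> rat_tau_quat a \<and> mat2 a 0 0 (icosian_star a) \<in> even_matrices"

lemma weyl_unit_mult: "weyl_unit a \<Longrightarrow> weyl_unit b \<Longrightarrow> weyl_unit (a * b)"
  using even_matrices_mult[of "mat2 a 0 0 (icosian_star a)" "mat2 b 0 0 (icosian_star b)"]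
  by (simp add: weyl_unit_def icosian_star_mult mat2_mult)

lemma weyl_unit_uminus: "weyl_unit a \<Longrightarrow> weyl_unit (- a)"
  using even_matrices_uminus[of "mat2 a 0 0 (icosian_star a)"]
  by (simp add: weyl_unit_def icosian_star_uminus mat2_uminus)

text \<open>The word \<open>[i, 1]\<close> gives the matrix \<open>- diag(a\<^sub>i, qcnj a\<^sub>i)\<close>, because \<open>a\<^sub>1 = 1\<close>, and on the simple
roots \<open>a\<^sup>*\<close> is the conjugate.\<close>

lemma weyl_unit_simple_root:
  assumes "i \<in> {Suc 0, 2, 3, 4}"
  shows "weyl_unit (simple_root i)"
proof -
  have i: "int i \<in> nodes" using assms by (auto simp: A4pp_nodes_def)
  have "- rotor [int i, 1] \<in> even_matrices"
    using i by (intro even_matricesI) (auto simp: A4pp_nodes_def)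
  moreover have "simple_root (Suc 0) = 1" by (simp add: simple_root_def)
  then have "rotor [int i, 1] = - mat2 (simple_root i) 0 0 (qcnj (simple_root i))"
    using herm_root_simple[OF assms] herm_root_simple[of "Suc 0"]
    by (simp add: mat2_mult mat2_uminus)
  ultimately show ?thesis
    using assms by (simp add: weyl_unit_def icosian_star_roots)
qed

lemma weyl_unit_ijk: "weyl_unit qi" "weyl_unit qj" "weyl_unit qk"
proof -
  have "qi = - simple_root 3" by (simp add: simple_root_def)
  then show i: "weyl_unit qi"
    using weyl_unit_uminus[OF weyl_unit_simple_root[of 3]] by simp
  have k_eq: "qk = - (simple_root 2 * qi * (simple_root 2 * simple_root 2))"
    by (simp add: simple_root_eqs quat_units_Quat times_quat_def uminus_quat_def)
  then show k: "weyl_unit qk"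
    unfolding k_eq by (intro weyl_unit_uminus weyl_unit_mult weyl_unit_simple_root i) simp_all
  have "qj = qk * qi"
    by (simp add: quat_units_Quat times_quat_def)
  then show "weyl_unit qj" using weyl_unit_mult[OF k i] by simp
qed

text \<open>Conjugation by \<open>i\<close>, \<open>j\<close>, \<open>k\<close> changes the signs of two imaginary components.\<close>

lemma weyl_unit_even_signs:
  assumes "weyl_unit (Quat a b c d)"
  shows "weyl_unit (Quat a b (-c) (-d))" "weyl_unit (Quat a (-b) c (-d))"
    "weyl_unit (Quat a (-b) (-c) d)" "weyl_unit (Quat (-a) (-b) (-c) (-d))"
    "weyl_unit (Quat (-a) (-b) c d)" "weyl_unit (Quat (-a) b (-c) d)"
    "weyl_unit (Quat (-a) b c (-d))"
proof -
  have "- (qi * Quat a b c d * qi) = Quat a b (-c) (-d)" "- (qj * Quat a b c d * qj) = Quat a (-b) c (-d)"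
    "- (qk * Quat a b c d * qk) = Quat a (-b) (-c) d"
    by (simp_all add: quat_units_Quat times_quat_def uminus_quat_def)
  then show 1: "weyl_unit (Quat a b (-c) (-d))" "weyl_unit (Quat a (-b) c (-d))"
    "weyl_unit (Quat a (-b) (-c) d)"
    using weyl_unit_uminus[OF weyl_unit_mult[OF weyl_unit_mult]] weyl_unit_ijk assms by metis+
  show "weyl_unit (Quat (-a) (-b) (-c) (-d))" "weyl_unit (Quat (-a) (-b) c d)"
    "weyl_unit (Quat (-a) b (-c) d)" "weyl_unit (Quat (-a) b c (-d))"
    using weyl_unit_uminus[OF assms] 1[THEN weyl_unit_uminus] by (simp_all add: uminus_quat_def)
qed

text \<open>If one component is zero, then the even sign changes already produce all of them.\<close>

definition all_signs_weyl_unit :: "real \<Rightarrow> real \<Rightarrow> real \<Rightarrow> real \<Rightarrow> bool" where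
  "all_signs_weyl_unit a b c d \<longleftrightarrow> (\<forall>x\<in>{a, -a}. \<forall>y\<in>{b, -b}. \<forall>z\<in>{c, -c}. \<forall>w\<in>{d, -d}.
     weyl_unit (Quat x y z w))"

lemma all_signs_weyl_unit_zero:
  "weyl_unit (Quat 0 b c d) \<Longrightarrow> all_signs_weyl_unit 0 b c d"
  unfolding all_signs_weyl_unit_def
  using weyl_unit_even_signs[of 0 b c d] by auto

text \<open>Left multiplication by \<open>i\<close>, \<open>j\<close> and conjugation by \<open>a\<^sub>2\<close> permute the components up to
  signs, and they generate the even permutations.\<close>

lemma all_signs_weyl_unit_permute:
  assumes "all_signs_weyl_unit a b c d"
  shows "all_signs_weyl_unit b a d c" "all_signs_weyl_unit c d a b" "all_signs_weyl_unit a c d b"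
proof -
  have *: "weyl_unit (Quat x y z w)" if "x \<in> {a, -a}" "y \<in> {b, -b}" "z \<in> {c, -c}" "w \<in> {d, -d}" for x y z w
    using assms that unfolding all_signs_weyl_unit_def by blast
  have "weyl_unit (Quat x y z w)" if "x \<in> {b, -b}" "y \<in> {a, -a}" "z \<in> {d, -d}" "w \<in> {c, -c}"
    for x y z w
  proof -
    have "weyl_unit (qi * Quat y (-x) w (-z))"
      by (intro weyl_unit_mult weyl_unit_ijk *) (use that in auto)
    then show ?thesis by (simp add: quat_units_Quat times_quat_def)
  qed
  then show "all_signs_weyl_unit b a d c"
    unfolding all_signs_weyl_unit_def by blast
  have "weyl_unit (Quat x y z w)" if "x \<in> {c, -c}" "y \<in> {d, -d}" "z \<in> {a, -a}" "w \<in> {b, -b}"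
    for x y z w
  proof -
    have "weyl_unit (qj * Quat z (-w) (-x) y)"
      by (intro weyl_unit_mult weyl_unit_ijk *) (use that in auto)
    then show ?thesis by (simp add: quat_units_Quat times_quat_def)
  qed
  then show "all_signs_weyl_unit c d a b"
    unfolding all_signs_weyl_unit_def by blast
  have "weyl_unit (Quat x y z w)" if "x \<in> {a, -a}" "y \<in> {c, -c}" "z \<in> {d, -d}" "w \<in> {b, -b}"
    for x y z w
  proof -
    have "weyl_unit (simple_root 2 * Quat x (-w) (-y) z * (simple_root 2 * simple_root 2))"
      by (intro weyl_unit_mult weyl_unit_simple_root *) (use that in auto)
    then show ?thesis by (simp add: simple_root_eqs times_quat_def field_simps)
  qed
  then show "all_signs_weyl_unit a c d b"
    unfolding all_signs_weyl_unit_def by blast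
qed

lemma permutes_insertE:
  assumes "p permutes insert a S"
  obtains b q where "p = Transposition.transpose a b \<circ> q" "b \<in> insert a S" "q permutes S"
proof -
  have "p \<in> (\<lambda>(b, p). Transposition.transpose a b \<circ> p) ` {(b, p). b \<in> insert a S \<and> p \<in> {p. p permutes S}}"
    using assms unfolding permutes_insert[symmetric] by simp
  then show ?thesis using that by auto
qed

text \<open>A permutation of \<open>{0..3}\<close> is a product of three transpositions that move 3, 2 and 1 to their
places, where each may be trivial; it is even iff the number of nontrivial ones is even.\<close>

lemma evenperm_values:
  fixes p :: "nat \<Rightarrow> nat"
  assumes "p permutes {0..3}" "evenperm p"
  shows "(p 0, p 1, p 2, p 3) \<in> {(0,1,2,3), (1,0,3,2), (2,3,0,1), (3,2,1,0),
     (0,2,3,1), (2,0,1,3), (3,1,0,2), (1,3,2,0), (0,3,1,2), (3,0,2,1), (1,2,0,3), (2,1,3,0)}"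
proof -
  have "{0..3::nat} = insert 3 (insert 2 (insert 1 {0}))" by auto
  with assms obtain b3 q where p: "p = Transposition.transpose 3 b3 \<circ> q"
      "b3 \<in> {3, 2, 1, 0}" "q permutes insert 2 (insert 1 {0})"
    by (metis permutes_insertE)
  obtain b2 r where q: "q = Transposition.transpose 2 b2 \<circ> r" "b2 \<in> {2, 1, 0}" "r permutes insert 1 {0}"
    using permutes_insertE[OF p(3)] by blast
  obtain b1 s where r: "r = Transposition.transpose 1 b1 \<circ> s" "b1 \<in> {1, 0}" "s permutes {0}"
    using permutes_insertE[OF q(3)] by blast
  have "s = id" using r(3) by simp
  then have p_eq: "p = Transposition.transpose 3 b3 \<circ> (Transposition.transpose 2 b2 \<circ> Transposition.transpose 1 b1)"
    by (simp add: p(1) q(1) r(1))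
  have "(b3 = 3) = ((b2 = 2) = (b1 = 1))"
    using assms(2) unfolding p_eq
    by (auto simp: evenperm_comp permutation_compose permutation_swap_id evenperm_swap)
  then show ?thesis
    using p(2) q(2) r(2) unfolding p_eq
    by (elim insertE emptyE; hypsubst) (simp_all add: Transposition.transpose_def)
qed

lemma weyl_unit_icosian_unit:
  assumes "x \<in> icosian_units"
  shows "weyl_unit x"
proof -
  have one: "weyl_unit 1"
    using weyl_unit_simple_root[of "Suc 0"] by (simp add: simple_root_def)
  have a2: "weyl_unit (simple_root 2)" by (rule weyl_unit_simple_root) simp
  have "simple_root 2 = Quat (-(1/2)) (1/2) (-(1/2)) (-(1/2))"
    "simple_root 2 * simple_root 2 = Quat (-(1/2)) (-(1/2)) (1/2) (1/2)"
    by (simp_all add: simple_root_eqs times_quat_def)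
  with a2 weyl_unit_mult[OF a2 a2]
  have seeds: "weyl_unit (Quat (-(1/2)) (1/2) (-(1/2)) (-(1/2)))"
    "weyl_unit (Quat (-(1/2)) (-(1/2)) (1/2) (1/2))" by simp_all
  note hurwitz = seeds seeds[THEN weyl_unit_even_signs(1)] seeds[THEN weyl_unit_even_signs(2)]
    seeds[THEN weyl_unit_even_signs(3)] seeds[THEN weyl_unit_even_signs(4)]
    seeds[THEN weyl_unit_even_signs(5)] seeds[THEN weyl_unit_even_signs(6)]
    seeds[THEN weyl_unit_even_signs(7)]
  have "weyl_unit (simple_root 4)" by (rule weyl_unit_simple_root) simp
  then have base: "all_signs_weyl_unit 0 (1/2) (\<sigma>/2) (\<tau>/2)"
    by (intro all_signs_weyl_unit_zero) (simp add: simple_root_eqs)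
  note cyc = base all_signs_weyl_unit_permute(3)[OF base]
    all_signs_weyl_unit_permute(3)[OF all_signs_weyl_unit_permute(3)[OF base]]
  note perm = cyc cyc[THEN all_signs_weyl_unit_permute(1)] cyc[THEN all_signs_weyl_unit_permute(2)]
    cyc[THEN all_signs_weyl_unit_permute(1), THEN all_signs_weyl_unit_permute(2)]
  from assms show ?thesis
    unfolding icosian_units_def hurwitz_units_def
  proof (elim UnE CollectE exE conjE)
    fix s u assume "x = s *\<^sub>R u" "s \<in> {1, -1}" "u \<in> {1, qi, qj, qk}"
    then show ?thesis
      using one weyl_unit_ijk one[THEN weyl_unit_uminus] weyl_unit_ijk[THEN weyl_unit_uminus]
      by (elim insertE emptyE; hypsubst) simp_all
  next
    fix s0 s1 s2 s3 :: real
    assume x: "x = (1/2) *\<^sub>R Quat s0 s1 s2 s3" and s: "{s0, s1, s2, s3} \<subseteq> {1, -1}"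
    have "s0 \<in> {1, -1}" "s1 \<in> {1, -1}" "s2 \<in> {1, -1}" "s3 \<in> {1, -1}" using s by auto
    then show ?thesis
      unfolding x using hurwitz
      by (elim insertE emptyE; hypsubst) (simp_all add: scaleR_quat_def)
  next
    fix v p and s1 s2 s3 :: real
    assume x: "x = (1/2) *\<^sub>R Quat (v (p 0)) (v (p 1)) (v (p 2)) (v (p 3))"
      and s: "{s1, s2, s3} \<subseteq> {1, -1}"
      and v: "v = (\<lambda>_ :: nat. 0 :: real)(1 := s1, 2 := s2 * \<sigma>, 3 := s3 * \<tau>)"
      and p: "p permutes {0..3}" "evenperm p"
    \<comment> \<open>the components of \<open>a\<^sub>4\<close>\<close>
    define c where "c n = (if n = 1 then 1/2 else if n = 2 then \<sigma>/2 else if n = 3 then \<tau>/2 else 0)"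
      for n :: nat
    have "s1 = 1 \<or> s1 = -1" "s2 = 1 \<or> s2 = -1" "s3 = 1 \<or> s3 = -1" using s by auto
    then have v_c: "v n / 2 \<in> {c n, - c n}" for n
      unfolding v c_def by (cases "n = 1"; cases "n = 2"; cases "n = 3") auto
    have "all_signs_weyl_unit (c (p 0)) (c (p 1)) (c (p 2)) (c (p 3))"
      using evenperm_values[OF p] perm unfolding insert_iff empty_iff prod.inject
      by (elim disjE conjE FalseE) (simp_all add: c_def)
    then have "weyl_unit (Quat (v (p 0) / 2) (v (p 1) / 2) (v (p 2) / 2) (v (p 3) / 2))"
      unfolding all_signs_weyl_unit_def using v_c by blast
    then show ?thesis by (simp add: x scaleR_quat_def)
  qed
qed


section \<open>The subgroup of even words in \<open>PSL\<^sub>2\<close>\<close>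

lemma even_matricesE:
  assumes "S \<in> even_matrices"
  obtains w where "w \<in> lists nodes" "even (length w)" "S = rotor w \<or> S = - rotor w"
  using assms unfolding even_matrices_def by blast

lemma PSL_class_uminus [simp]: "PSL_class (- S) = PSL_class S"
  by (auto simp: PSL_class_eq)

lemma even_matrices_subset_SL2: "S \<in> even_matrices \<Longrightarrow> S \<in> carrier SL2_H"
  by (metis even_matricesE rotor_in_SL2 SL2_H_uminus)

lemma even_matrices_act:
  assumes "S \<in> even_matrices"
  obtains w where "w \<in> lists nodes" "even (length w)" "\<And>X. act S X = A4pp.word_act w X"
    "PSL_class S = PSL_class (rotor w)"
proof -
  obtain w where w: "w \<in> lists nodes" "even (length w)" "S = rotor w \<or> S = - rotor w"
    using even_matricesE[OF assms] .
  have "act S X = A4pp.word_act w X" for X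
    using w(3) act_rotor[OF w(1,2), of X] by auto
  with that[OF w(1,2)] w(3) show ?thesis by auto
qed

lemma even_matrices_lattice_stable: "S \<in> even_matrices \<Longrightarrow> lattice_stable S"
  by (erule even_matrices_act) (simp add: lattice_stable_def word_act_hlat)

lemma icosian_entries_uminus: "icosian_entries S \<Longrightarrow> icosian_entries (- S)"
  using icosian_span_scale[of _ "-1"] by (simp add: icosian_entries_def)

lemma even_matrices_icosian: "S \<in> even_matrices \<Longrightarrow> icosian_entries S"
  by (metis even_matricesE icosian_entries_rotor icosian_entries_uminus)

definition even_classes :: "qmat set set" where
  "even_classes = PSL_class ` even_matrices"

lemma PSL_class_in_even_classes: "PSL_class S \<in> even_classes \<longleftrightarrow> S \<in> even_matrices"
  unfolding even_classes_def using even_matrices_uminus by (force simp: PSL_class_eq_iff)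

lemma even_classes_rotor: "even_classes = (\<lambda>w. PSL_class (rotor w)) ` {w \<in> lists nodes. even (length w)}"
  unfolding even_classes_def
  by (auto elim!: even_matrices_act intro!: imageI even_matricesI)

lemma Union_even_classes: "\<Union> even_classes = even_matrices"
  unfolding even_classes_def using even_matrices_uminus by (auto simp: PSL_class_eq)

lemma rotor_rev:
  assumes "w \<in> lists nodes" "even (length w)"
  shows "PSL_class (rotor w ** rotor (rev w)) = PSL_class (mat 1)"
proof (rule PSL_class_eqI)
  have w: "rev w \<in> lists nodes" "even (length (rev w))"
    using assms by (auto simp: in_lists_conv_set)
  show "rotor w ** rotor (rev w) \<in> carrier SL2_H" "mat 1 \<in> carrier SL2_H"
    using assms w by (simp_all add: SL2_H_mult SL2_H_one rotor_in_SL2)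
  show "act (rotor w ** rotor (rev w)) X = act (mat 1) X" for X
    by (simp add: act_mult act_rotor[OF assms] act_rotor[OF w] A4pp.word_act_rev[OF assms(1)])
qed

lemma one_in_even_matrices: "mat 1 \<in> even_matrices"
  using even_matricesI(1)[of "[]"] by simp

lemma subgroup_even_classes: "subgroup even_classes PSL2_H"
proof (rule group.subgroupI[OF group_PSL2_H])
  show "even_classes \<subseteq> carrier PSL2_H"
    by (auto simp: even_classes_def carrier_PSL2_H even_matrices_subset_SL2)
  show "even_classes \<noteq> {}"
    using one_in_even_matrices by (auto simp: even_classes_def)
next
  fix C assume "C \<in> even_classes"
  then obtain w where C: "C = PSL_class (rotor w)" and w: "w \<in> lists nodes" "even (length w)"
    by (auto simp: even_classes_rotor)
  have rev: "rev w \<in> lists nodes" "even (length (rev w))"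
    using w by (auto simp: in_lists_conv_set)
  have "PSL_class (rotor (rev w)) \<otimes>\<^bsub>PSL2_H\<^esub> C = \<one>\<^bsub>PSL2_H\<^esub>"
    using rotor_rev[OF rev] w rev by (simp add: C PSL_class_mult rotor_in_SL2 one_PSL2_H)
  then have "inv\<^bsub>PSL2_H\<^esub> C = PSL_class (rotor (rev w))"
    using w rev by (intro group.inv_equality[OF group_PSL2_H])
      (auto simp: C carrier_PSL2_H rotor_in_SL2)
  then show "inv\<^bsub>PSL2_H\<^esub> C \<in> even_classes"
    using rev by (simp add: PSL_class_in_even_classes even_matricesI)
next
  fix C D assume "C \<in> even_classes" "D \<in> even_classes"
  then show "C \<otimes>\<^bsub>PSL2_H\<^esub> D \<in> even_classes"
    by (auto simp: even_classes_def PSL_class_mult even_matrices_subset_SL2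
        intro!: imageI even_matrices_mult)
qed

lemma mem_PSL2_I_lattice_iff: "C \<in> PSL2_I_lattice \<longleftrightarrow>
   (\<exists>S\<in>carrier SL2_H. C = PSL_class S \<and> (\<forall>i j. S $ i $ j \<in> icosians) \<and> lattice_stable S)"
proof -
  have "lattice_stable (- S) \<longleftrightarrow> lattice_stable S" for S
    by (simp add: lattice_stable_def)
  then have "(\<exists>T\<in>PSL_class S. lattice_stable T) \<longleftrightarrow> lattice_stable S" for S
    by (simp add: PSL_class_eq)
  then show ?thesis
    unfolding PSL2_I_lattice_def lattice_conditions_iff_stable by (auto simp: PSL2_I_def)
qed

lemma even_classes_subset: "even_classes \<subseteq> PSL2_I_lattice"
proof
  fix C assume "C \<in> even_classes"
  then obtain S where "C = PSL_class S" "S \<in> even_matrices" by (auto simp: even_classes_def)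
  moreover from this have "S $ i $ j \<in> icosians" for i j
    using even_matrices_icosian icosian_span_subset unfolding icosian_entries_def by blast
  ultimately show "C \<in> PSL2_I_lattice"
    unfolding mem_PSL2_I_lattice_iff
    using even_matrices_subset_SL2 even_matrices_lattice_stable by blast
qed

lemma outer_aut_eq: "outer_aut = PSL_class diag_flip"
  by (simp add: outer_aut_def diag_flip_def)

lemma outer_aut_square: "outer_aut \<otimes>\<^bsub>PSL2_H\<^esub> outer_aut = \<one>\<^bsub>PSL2_H\<^esub>"
  by (simp add: outer_aut_eq PSL_class_mult diag_flip_in_SL2 diag_flip_square one_PSL2_H)

lemma outer_aut_not_even: "outer_aut \<notin> even_classes"
proof
  assume "outer_aut \<in> even_classes"
  then have "diag_flip \<in> even_matrices" by (simp add: outer_aut_eq PSL_class_in_even_classes)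
  then obtain w where "w \<in> lists nodes" "\<And>X. act diag_flip X = A4pp.word_act w X"
    by (rule even_matrices_act) blast
  then show False using word_act_neq_diag_flip by metis
qed

text \<open>The lattice group is the union of the even words and their translates by the outer automorphism.\<close>

lemma PSL2_I_lattice_cases:
  assumes "C \<in> PSL2_I_lattice"
  obtains "C \<in> even_classes" | D where "D \<in> even_classes" "C = D \<otimes>\<^bsub>PSL2_H\<^esub> outer_aut"
proof -
  obtain S where S: "S \<in> carrier SL2_H" "C = PSL_class S" "lattice_stable S"
    using assms by (auto simp: mem_PSL2_I_lattice_iff)
  have stable: "act S X \<in> hlat" if "X \<in> hlat" for X
    using S(3) that by (simp add: lattice_stable_def)
  show ?thesis
  proof (rule lattice_matrix_cases[OF S(1) stable])
    fix w assume w: "w \<in> lists nodes" "even (length w)" and act: "\<And>X. act S X = act (rotor w) X"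
    have "C = PSL_class (rotor w)"
      unfolding S(2) by (intro PSL_class_eqI S rotor_in_SL2 w act)
    then show ?thesis using that(1) w by (auto simp: even_classes_rotor)
  next
    fix w assume w: "w \<in> lists nodes" "even (length w)"
      and act: "\<And>X. act S X = act (rotor w ** diag_flip) X"
    have "C = PSL_class (rotor w ** diag_flip)"
      unfolding S(2) by (intro PSL_class_eqI S SL2_H_mult rotor_in_SL2 diag_flip_in_SL2 w act)
    then show ?thesis
      using that(2)[of "PSL_class (rotor w)"] w
      by (auto simp: even_classes_rotor outer_aut_eq PSL_class_mult rotor_in_SL2 diag_flip_in_SL2)
  qed auto
qed


section \<open>Generation by the remaining matrices\<close>

text \<open>The factor \<open>mat2 0 1 (-1) 0\<close> is up to sign the matrix of the word \<open>[1, -1]\<close>.\<close>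

lemma off_diagonal_in_even_matrices:
  assumes "a \<in> icosian_units"
  shows "mat2 0 a (- icosian_star a) 0 \<in> even_matrices"
proof -
  have "- rotor [1, -1] \<in> even_matrices"
    by (intro even_matricesI) (simp_all add: A4pp_nodes_def)
  moreover have "- rotor [1, -1] = mat2 0 1 (-1) 0"
    by (simp add: herm_root_def simple_root_def mat2_mult mat2_uminus)
  ultimately have "mat2 a 0 0 (icosian_star a) ** mat2 0 1 (-1) 0 \<in> even_matrices"
    using weyl_unit_icosian_unit[OF assms] by (intro even_matrices_mult) (simp_all add: weyl_unit_def)
  then show ?thesis by (simp add: mat2_mult)
qed

lemma highest_root_norm: "highest_root * qcnj highest_root = 1" "qcnj highest_root * highest_root = 1"
  by (simp_all add: highest_root_eq quat_comps sigma_eq field_simps tau_mult)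

lemma icosian_unit_simple_root_3: "simple_root 3 \<in> icosian_units"
  using hurwitz_unitI(1)[of "-1" qi] by (simp add: simple_root_def icosian_units_def)

text \<open>The simple root of the node 0 is \<open>- \<theta>\<close> plus a null vector, so the product of the reflections at the
nodes 0 and \<open>-1\<close> differs from an off-diagonal matrix by the translation with \<open>\<theta>\<close>.\<close>

lemma translation_factorization:
  "mat2 1 highest_root 0 1 ** rotor [0, -1] = mat2 0 highest_root (- icosian_star highest_root) 0"
  by (simp add: herm_root_def mat2_mult highest_root_norm icosian_star_highest_root)

lemma remaining_subset_even: "remaining_matrices \<subseteq> even_matrices"
proof -
  let ?\<theta> = "highest_root"
  have "mat2 a 0 0 (icosian_star a) \<in> even_matrices" if "a \<in> icosian_units" for a
    using weyl_unit_icosian_unit[OF that] by (simp add: weyl_unit_def)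
  moreover have "mat2 1 ?\<theta> 0 1 \<in> even_matrices"
  proof -
    have "mat2 0 ?\<theta> (- icosian_star ?\<theta>) 0 ** rotor [-1, 0] = mat2 1 ?\<theta> 0 1"
      by (simp add: herm_root_def mat2_mult highest_root_norm icosian_star_highest_root)
    moreover have "rotor [-1, 0] \<in> even_matrices"
      by (intro even_matricesI) (simp_all add: A4pp_nodes_def)
    ultimately show ?thesis
      using even_matrices_mult off_diagonal_in_even_matrices icosian_units_examples(9) by metis
  qed
  ultimately show ?thesis
    using off_diagonal_in_even_matrices by (auto simp: remaining_matrices_def)
qed

text \<open>Every even word is a product of words \<open>[I, -1]\<close> and their inverses, and for each node
  \<open>I\<close> the matrix of \<open>[I, -1]\<close> is one of the remaining matrices up to sign, or for \<open>I = 0\<close>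
  a quotient of two of them.\<close>

lemma remaining_generate:
  assumes K: "subgroup K PSL2_H" and rem: "PSL_class ` remaining_matrices \<subseteq> K"
  shows "even_classes \<subseteq> K"
proof -
  interpret PSL2_H: group PSL2_H by (rule group_PSL2_H)
  interpret K: subgroup K PSL2_H by (rule K)
  have off: "PSL_class (mat2 0 a (- icosian_star a) 0) \<in> K" if "a \<in> icosian_units" for a
    using rem that by (auto simp: remaining_matrices_def)
  have base: "PSL_class (rotor [I, -1]) \<in> K" if I: "I \<in> nodes" for I
  proof -
    consider "I = -1" | "I = 0" | i where "i \<in> {Suc 0, 2, 3, 4}" "I = int i"
      using I by (auto simp: A4pp_nodes_def)
    then show ?thesis
    proof cases
      case 1
      then have "rotor [I, -1] = - mat 1"
        by (simp add: herm_root_def mat2_mult mat2_one mat2_uminus)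
      then have "PSL_class (rotor [I, -1]) = \<one>\<^bsub>PSL2_H\<^esub>"
        by (simp add: one_PSL2_H PSL_class_eq_iff)
      then show ?thesis by simp
    next
      case 2
      let ?T = "PSL_class (mat2 1 highest_root 0 1)" and ?M = "PSL_class (rotor [0, -1])"
        and ?O = "PSL_class (mat2 0 highest_root (- icosian_star highest_root) 0)"
      have T: "mat2 1 highest_root 0 1 \<in> carrier SL2_H"
        using remaining_subset_even even_matrices_subset_SL2 by (auto simp: remaining_matrices_def)
      have M: "rotor [0, -1] \<in> carrier SL2_H"
        by (intro rotor_in_SL2) (simp add: A4pp_nodes_def)
      have "?T \<otimes>\<^bsub>PSL2_H\<^esub> ?M = ?O"
        unfolding PSL_class_mult[OF T M] translation_factorization ..
      moreover have "?T \<in> carrier PSL2_H" "?M \<in> carrier PSL2_H"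
        using T M by (auto simp: carrier_PSL2_H)
      ultimately have "?M = inv\<^bsub>PSL2_H\<^esub> ?T \<otimes>\<^bsub>PSL2_H\<^esub> ?O"
        by (metis PSL2_H.inv_solve_left K.mem_carrier PSL2_H.m_closed)
      moreover have "?T \<in> K" using rem by (auto simp: remaining_matrices_def)
      moreover have "?O \<in> K" by (intro off icosian_units_examples)
      ultimately show ?thesis unfolding 2 by simp
    next
      case (3 i)
      have unit: "simple_root i \<in> icosian_units"
        using 3(1) icosian_units_examples icosian_unit_simple_root_3
        by (auto simp: simple_root_def[of "Suc 0"])
      have "rotor [I, -1] = - mat2 0 (simple_root i) (- icosian_star (simple_root i)) 0"
        using herm_root_simple[OF 3(1)] 3
        by (simp add: icosian_star_roots mat2_mult mat2_uminus herm_root_def[of "-1"])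
      then show ?thesis
        using off[OF unit] by (simp del: rotor.simps)
    qed
  qed
  have pair: "PSL_class (rotor [I, J]) \<in> K" if IJ: "I \<in> nodes" "J \<in> nodes" for I J
  proof -
    let ?X = "PSL_class (rotor [I, -1])" and ?Y = "PSL_class (rotor [J, -1])"
    have n: "[I, -1] \<in> lists nodes" "[J, -1] \<in> lists nodes" "[I, J] \<in> lists nodes"
      using IJ by (auto simp: A4pp_nodes_def)
    have "PSL_class (rotor [I, J] ** rotor [J, -1]) = ?X"
    proof (rule PSL_class_eqI)
      show "act (rotor [I, J] ** rotor [J, -1]) X = act (rotor [I, -1]) X" for X
        using n IJ A4pp.reflect_reflect[OF A4pp.root_norm[OF IJ(2)]]
        unfolding act_mult by (subst (1 2 3) act_rotor) simp_all
    qed (use n in \<open>simp_all only: SL2_H_mult rotor_in_SL2\<close>)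
    then have "PSL_class (rotor [I, J]) \<otimes>\<^bsub>PSL2_H\<^esub> ?Y = ?X"
      using n by (simp only: PSL_class_mult rotor_in_SL2)
    moreover have "PSL_class (rotor [I, J]) \<in> carrier PSL2_H"
      unfolding carrier_PSL2_H using n rotor_in_SL2 by blast
    ultimately have "PSL_class (rotor [I, J]) = ?X \<otimes>\<^bsub>PSL2_H\<^esub> inv\<^bsub>PSL2_H\<^esub> ?Y"
      using base[OF IJ(1)] base[OF IJ(2)] by (metis PSL2_H.inv_solve_right K.mem_carrier)
    then show ?thesis using base[OF IJ(1)] base[OF IJ(2)] by simp
  qed
  have "PSL_class (rotor w) \<in> K" if "w \<in> lists nodes" "even (length w)" for w
    using that
  proof (induction w rule: rotor.induct)
    case (1 I J w)
    then have IJ: "I \<in> nodes" "J \<in> nodes" "w \<in> lists nodes" and IH: "PSL_class (rotor w) \<in> K" by auto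
    have c: "rotor [I, J] \<in> carrier SL2_H" "rotor w \<in> carrier SL2_H"
      using IJ by (intro rotor_in_SL2; simp)+
    have eq: "rotor (I # J # w) = rotor [I, J] ** rotor w" by simp
    have "PSL_class (rotor (I # J # w)) = PSL_class (rotor [I, J]) \<otimes>\<^bsub>PSL2_H\<^esub> PSL_class (rotor w)"
      unfolding PSL_class_mult[OF c] eq ..
    then show ?case using K.m_closed[OF pair[OF IJ(1,2)] IH] by simp
  next
    case "2_1"
    then show ?case using K.one_closed by (simp add: one_PSL2_H)
  next
    case ("2_2" I)
    then show ?case by simp
  qed
  then show ?thesis by (auto simp: even_classes_rotor)
qed

text \<open>A subgroup \<open>K\<close> with the required properties contains the even classes, which the remaining
matrices generate. It contains nothing else, since for each even class \<open>E\<close> it contains only one of \<open>E\<close>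
and \<open>E \<cdot> outer_aut\<close>.\<close>

lemma outer_aut_removed_iff: "outer_aut_removed K \<longleftrightarrow> K = even_classes"
proof
  interpret PSL2_H: group PSL2_H by (rule group_PSL2_H)
  interpret E: subgroup even_classes PSL2_H by (rule subgroup_even_classes)
  have D: "outer_aut \<in> carrier PSL2_H"
    by (simp add: outer_aut_eq carrier_PSL2_H diag_flip_in_SL2)
  have flip: "C \<otimes>\<^bsub>PSL2_H\<^esub> outer_aut \<notin> even_classes" if "C \<in> even_classes" for C
  proof
    assume "C \<otimes>\<^bsub>PSL2_H\<^esub> outer_aut \<in> even_classes"
    then have "inv\<^bsub>PSL2_H\<^esub> C \<otimes>\<^bsub>PSL2_H\<^esub> (C \<otimes>\<^bsub>PSL2_H\<^esub> outer_aut) \<in> even_classes"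
      using that by simp
    then show False
      using outer_aut_not_even that D by (simp flip: PSL2_H.m_assoc)
  qed
  show "outer_aut_removed K" if K: "K = even_classes"
    unfolding outer_aut_removed_def K
  proof (intro conjI ballI)
    fix C assume C: "C \<in> PSL2_I_lattice"
    show "(C \<in> even_classes) = (C \<otimes>\<^bsub>PSL2_H\<^esub> outer_aut \<notin> even_classes)"
      using C
    proof (cases rule: PSL2_I_lattice_cases)
      case 1
      then show ?thesis using flip by simp
    next
      case (2 E)
      then have "C \<otimes>\<^bsub>PSL2_H\<^esub> outer_aut = E"
        using D by (simp add: PSL2_H.m_assoc outer_aut_square)
      with 2 show ?thesis using flip by simp
    qed
  next
    show "PSL_class ` remaining_matrices \<subseteq> even_classes"
      using remaining_subset_even unfolding even_classes_def by blast
  qed (rule subgroup_even_classes even_classes_subset)+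
  show "K = even_classes" if K: "outer_aut_removed K"
  proof
    show sub: "even_classes \<subseteq> K"
      using K remaining_generate by (auto simp: outer_aut_removed_def)
    show "K \<subseteq> even_classes"
    proof
      fix C assume C: "C \<in> K"
      then have "C \<in> PSL2_I_lattice" using K by (auto simp: outer_aut_removed_def)
      then show "C \<in> even_classes"
      proof (cases rule: PSL2_I_lattice_cases)
        case (2 E)
        then have "E \<in> PSL2_I_lattice" "E \<in> K" using even_classes_subset sub by auto
        then show ?thesis using K C 2 by (simp add: outer_aut_removed_def)
      qed
    qed
  qed
qed

lemma carrier_PSL2_0_I: "carrier PSL2_0_I = even_classes"
  by (simp add: PSL2_0_I_def outer_aut_removed_iff)

lemma mult_PSL2_0_I: "mult PSL2_0_I = mult PSL2_H"
  by (simp add: PSL2_0_I_def)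


section \<open>Discreteness\<close>

lemma continuous_on_quat_comps:
  assumes "continuous_on A f"
  shows "continuous_on A (\<lambda>x. qRe (f x))" "continuous_on A (\<lambda>x. qIm1 (f x))"
    "continuous_on A (\<lambda>x. qIm2 (f x))" "continuous_on A (\<lambda>x. qIm3 (f x))"
proof -
  have eqs: "qRe y = inner y (Quat 1 0 0 0)" "qIm1 y = inner y (Quat 0 1 0 0)"
    "qIm2 y = inner y (Quat 0 0 1 0)" "qIm3 y = inner y (Quat 0 0 0 1)" for y
    by (simp_all add: inner_quat_def)
  show "continuous_on A (\<lambda>x. qRe (f x))" "continuous_on A (\<lambda>x. qIm1 (f x))"
    "continuous_on A (\<lambda>x. qIm2 (f x))" "continuous_on A (\<lambda>x. qIm3 (f x))"
    unfolding eqs by (intro continuous_intros assms)+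
qed

lemma continuous_on_hform_act: "continuous_on A (\<lambda>S. hform (act S X) Y)"
proof -
  obtain p z r q w s where XY: "X = (p, z, r)" "Y = (q, w, s)" by (cases X; cases Y)
  have comps: "qRe (x * y) = qRe x * qRe y - qIm1 x * qIm1 y - qIm2 x * qIm2 y - qIm3 x * qIm3 y"
    "qIm1 (x * y) = qRe x * qIm1 y + qIm1 x * qRe y + qIm2 x * qIm3 y - qIm3 x * qIm2 y"
    "qIm2 (x * y) = qRe x * qIm2 y - qIm1 x * qIm3 y + qIm2 x * qRe y + qIm3 x * qIm1 y"
    "qIm3 (x * y) = qRe x * qIm3 y + qIm1 x * qIm2 y - qIm2 x * qIm1 y + qIm3 x * qRe y"
    "qRe (x + y) = qRe x + qRe y" "qIm1 (x + y) = qIm1 x + qIm1 y"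
    "qIm2 (x + y) = qIm2 x + qIm2 y" "qIm3 (x + y) = qIm3 x + qIm3 y"
    "qRe (qcnj x) = qRe x" "qIm1 (qcnj x) = - qIm1 x" "qIm2 (qcnj x) = - qIm2 x"
    "qIm3 (qcnj x) = - qIm3 x" "qRe (k *\<^sub>R x) = k * qRe x" "qIm1 (k *\<^sub>R x) = k * qIm1 x"
    "qIm2 (k *\<^sub>R x) = k * qIm2 x" "qIm3 (k *\<^sub>R x) = k * qIm3 x" for x y k
    by (simp_all add: times_quat_def plus_quat_def qcnj_def scaleR_quat_def)
  show ?thesis
    unfolding XY act_def Let_def prod.case herm_simps inner_quat_def comps
    by (intro continuous_intros continuous_on_quat_comps)
qed

lemma open_hform_act_near: "open {S. \<bar>hform (act S X) Y - c\<bar> < 1}"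
  by (intro open_Collect_less continuous_intros continuous_on_hform_act)

text \<open>The numbers \<open>hform (act S (herm_root I)) (herm_root J)\<close> of the action are integers
  that depend continuously on \<open>S\<close>, and they determine \<open>S\<close> up to sign. The ball
  separates \<open>S\<close> from \<open>- S\<close>.\<close>

lemma discrete_even_matrices: "discrete even_matrices"
proof (rule discreteI)
  fix S assume S: "S \<in> even_matrices"
  define b where "b U I J = hform (act U (herm_root I)) (herm_root J)" for U I J
  let ?T = "(\<Inter>I\<in>nodes. \<Inter>J\<in>nodes. {U. \<bar>b U I J - b S I J\<bar> < 1}) \<inter> ball S (norm S)"
  have fin: "finite nodes" by (simp add: A4pp_nodes_def)
  have "open ?T"
    unfolding b_def by (intro open_Int open_INT fin ballI open_hform_act_near open_ball)
  moreover have "S \<noteq> 0"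
  proof
    assume "S = 0"
    then have "act S (1, 0, 1) = 0"
      by (simp add: act_def zero_prod_def)
    then show False
      using even_matrices_subset_SL2[OF S] by (simp add: SL2_H_iff zero_prod_def)
  qed
  then have "S \<in> ?T" by simp
  moreover have "U = S" if U: "U \<in> even_matrices" "U \<in> ?T" for U
  proof -
    have int: "b V I J \<in> \<int>" if "V \<in> even_matrices" "I \<in> nodes" "J \<in> nodes" for V I J
      using even_matrices_lattice_stable[OF that(1)] that
      unfolding b_def lattice_stable_def by (intro hform_hlat_Ints) (auto intro: herm_root_in_hlat)
    have "b U I J = b S I J" if IJ: "I \<in> nodes" "J \<in> nodes" for I J
    proof -
      have "b U I J - b S I J \<in> \<int>" using int U(1) S IJ by simp
      moreover have "\<bar>b U I J - b S I J\<bar> < 1" using U(2) IJ by blast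
      ultimately have "b U I J - b S I J = 0"
        using Ints_nonzero_abs_ge1 linorder_not_less by blast
      then show ?thesis by simp
    qed
    then have "root_coef (act U (herm_root I)) = root_coef (act S (herm_root I))" if "I \<in> nodes" for I
      using that unfolding b_def by (auto simp: root_coef_def A4pp_nodes_def fun_eq_iff)
    then have "act U (herm_root I) = act S (herm_root I)" if "I \<in> nodes" for I
      using that root_sum_coef by metis
    then have "act U X = act S X" for X
      by (rule linear_eq_on_roots[OF linear_act linear_act])
    then have "PSL_class U = PSL_class S"
      using U(1) S even_matrices_subset_SL2 by (intro PSL_class_eqI) auto
    moreover have "U \<noteq> - S"
    proof
      assume neg: "U = - S"
      have "dist S U = 2 * norm S"
        using norm_scaleR[of 2 S] by (simp add: neg dist_norm scaleR_2)
      moreover have "dist S U < norm S" using U(2) by simp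
      ultimately show False using norm_ge_zero[of S] by linarith
    qed
    ultimately show ?thesis by (auto simp: PSL_class_eq_iff)
  qed
  ultimately show "S isolated_in even_matrices"
    unfolding isolated_in_def using S by (intro conjI exI[of _ ?T]) auto
qed


section \<open>The isomorphism\<close>

lemma PSL_class_rotor_eq_iff:
  assumes "u \<in> lists nodes" "even (length u)" "v \<in> lists nodes" "even (length v)"
  shows "PSL_class (rotor u) = PSL_class (rotor v) \<longleftrightarrow> weyl_eq nodes A4pp_cartan u v"
proof
  assume "PSL_class (rotor u) = PSL_class (rotor v)"
  then have "act (rotor u) X = act (rotor v) X" for X
    by (auto simp: PSL_class_eq_iff)
  then have "A4pp.word_act u = A4pp.word_act v"
    using assms by (simp add: act_rotor fun_eq_iff del: split_paired_All)
  then show "weyl_eq nodes A4pp_cartan u v"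
    using A4pp.weyl_eq_iff_word_act[OF assms(1,3)] by blast
next
  assume "weyl_eq nodes A4pp_cartan u v"
  then have "A4pp.word_act u = A4pp.word_act v" by (rule A4pp.word_act_cong)
  then show "PSL_class (rotor u) = PSL_class (rotor v)"
    using act_rotor[OF assms(1,2)] act_rotor[OF assms(3,4)]
    by (intro PSL_class_eqI rotor_in_SL2 assms) simp
qed

lemma weyl_class_eq_iff:
  assumes "u \<in> lists N" "v \<in> lists N"
  shows "weyl_class N A u = weyl_class N A v \<longleftrightarrow> weyl_eq N A u v"
proof
  assume "weyl_class N A u = weyl_class N A v"
  moreover have "v \<in> weyl_class N A v" using assms by (simp add: weyl_class_def weyl_eq.refl)
  ultimately show "weyl_eq N A u v" by (simp add: weyl_class_def set_eq_iff)
next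
  assume eq: "weyl_eq N A u v"
  have "weyl_eq N A u w \<longleftrightarrow> weyl_eq N A v w" for w
    by (rule iffI; erule weyl_eq.trans[OF weyl_eq.sym[OF eq]] weyl_eq.trans[OF eq])
  then show "weyl_class N A u = weyl_class N A v" by (simp add: weyl_class_def)
qed

lemma weyl_class_mult:
  assumes "u \<in> lists N" "v \<in> lists N"
  shows "weyl_class N A u \<otimes>\<^bsub>even_weyl_group N A\<^esub> weyl_class N A v = weyl_class N A (u @ v)"
proof -
  have "(\<exists>u'\<in>weyl_class N A u. \<exists>v'\<in>weyl_class N A v. weyl_eq N A (u' @ v') w) \<longleftrightarrow>
      weyl_eq N A (u @ v) w" for w
  proof
    assume "weyl_eq N A (u @ v) w"
    then show "\<exists>u'\<in>weyl_class N A u. \<exists>v'\<in>weyl_class N A v. weyl_eq N A (u' @ v') w"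
      using weyl_eq.refl[OF assms(1)] weyl_eq.refl[OF assms(2)] by (auto simp: weyl_class_def)
  next
    assume "\<exists>u'\<in>weyl_class N A u. \<exists>v'\<in>weyl_class N A v. weyl_eq N A (u' @ v') w"
    then obtain u' v' where uv: "weyl_eq N A u u'" "weyl_eq N A v v'" "weyl_eq N A (u' @ v') w"
      by (auto simp: weyl_class_def)
    show "weyl_eq N A (u @ v) w"
      by (rule weyl_eq.trans[OF weyl_eq.append[OF uv(1,2)] uv(3)])
  qed
  then show ?thesis
    by (simp add: even_weyl_group_def weyl_group_def weyl_class_def)
qed

text \<open>The isomorphism sends the class of an even word to the class of its matrix.\<close>

theorem even_weyl_group_iso: "even_weyl_group nodes A4pp_cartan \<cong> PSL2_0_I"
proof -
  let ?E = "{w \<in> lists nodes. even (length w)}"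
  let ?G = "even_weyl_group nodes A4pp_cartan"
  let ?cls = "weyl_class nodes A4pp_cartan"
  define \<Phi> where "\<Phi> X = PSL_class (rotor (SOME w. w \<in> ?E \<and> X = ?cls w))" for X
  have \<Phi>: "\<Phi> (?cls w) = PSL_class (rotor w)" if w: "w \<in> ?E" for w
  proof -
    define v where "v = (SOME v. v \<in> ?E \<and> ?cls w = ?cls v)"
    have "v \<in> ?E \<and> ?cls w = ?cls v"
      unfolding v_def by (rule someI[of _ w]) (use w in simp)
    then have v: "v \<in> lists nodes" "even (length v)" "?cls v = ?cls w" by simp_all
    have w: "w \<in> lists nodes" "even (length w)" using w by simp_all
    have "weyl_eq nodes A4pp_cartan v w"
      using v(3) weyl_class_eq_iff[OF v(1) w(1)] by simp
    then have "PSL_class (rotor v) = PSL_class (rotor w)"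
      using PSL_class_rotor_eq_iff[OF v(1,2) w] by simp
    then show ?thesis by (simp add: \<Phi>_def v_def)
  qed
  have carrier: "carrier ?G = ?cls ` ?E"
    by (simp add: even_weyl_group_def)
  have "\<Phi> \<in> hom ?G PSL2_0_I"
  proof (rule homI)
    fix X assume "X \<in> carrier ?G"
    then show "\<Phi> X \<in> carrier PSL2_0_I"
      unfolding carrier carrier_PSL2_0_I even_classes_rotor using \<Phi> by auto
  next
    fix X Y assume "X \<in> carrier ?G" "Y \<in> carrier ?G"
    then obtain u v where u: "u \<in> ?E" "X = ?cls u" and v: "v \<in> ?E" "Y = ?cls v"
      unfolding carrier by blast
    have uv: "u @ v \<in> ?E" using u(1) v(1) by auto
    have "X \<otimes>\<^bsub>?G\<^esub> Y = ?cls (u @ v)"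
      unfolding u(2) v(2) using u(1) v(1) by (intro weyl_class_mult) simp_all
    then have "\<Phi> (X \<otimes>\<^bsub>?G\<^esub> Y) = PSL_class (rotor u ** rotor v)"
      using u(1) by (simp only: \<Phi>[OF uv]) (simp add: rotor_append)
    also have "\<dots> = PSL_class (rotor u) \<otimes>\<^bsub>PSL2_H\<^esub> PSL_class (rotor v)"
      using u(1) v(1) by (intro PSL_class_mult[symmetric] rotor_in_SL2) simp_all
    finally show "\<Phi> (X \<otimes>\<^bsub>?G\<^esub> Y) = \<Phi> X \<otimes>\<^bsub>PSL2_0_I\<^esub> \<Phi> Y"
      unfolding mult_PSL2_0_I u(2) v(2) \<Phi>[OF u(1)] \<Phi>[OF v(1)] .
  qed
  moreover have "bij_betw \<Phi> (carrier ?G) (carrier PSL2_0_I)"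
    unfolding bij_betw_def
  proof
    show "inj_on \<Phi> (carrier ?G)"
    proof (rule inj_onI)
      fix X Y assume "X \<in> carrier ?G" "Y \<in> carrier ?G" and eq: "\<Phi> X = \<Phi> Y"
      then obtain u v where u: "u \<in> ?E" "X = ?cls u" and v: "v \<in> ?E" "Y = ?cls v"
        unfolding carrier by blast
      have "weyl_eq nodes A4pp_cartan u v"
        using eq u(1) v(1) PSL_class_rotor_eq_iff[of u v]
        unfolding u(2) v(2) \<Phi>[OF u(1)] \<Phi>[OF v(1)] by simp
      then show "X = Y"
        unfolding u(2) v(2) using u(1) v(1) weyl_class_eq_iff[of u nodes v] by simp
    qed
    show "\<Phi> ` carrier ?G = carrier PSL2_0_I"
      unfolding carrier carrier_PSL2_0_I even_classes_rotor image_image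
      by (rule image_cong[OF HOL.refl \<Phi>])
  qed
  ultimately have "\<Phi> \<in> iso ?G PSL2_0_I" by (simp add: iso_def)
  then show ?thesis by (auto simp: is_iso_def)
qed

theorem proposition13:
  shows "(\<exists>!K. outer_aut_removed K) \<and>
         discrete (\<Union> (carrier PSL2_0_I)) \<and>
         even_weyl_group A4pp_nodes A4pp_cartan \<cong> PSL2_0_I"
proof (intro conjI)
  show "\<exists>!K. outer_aut_removed K" by (simp add: outer_aut_removed_iff)
  show "discrete (\<Union> (carrier PSL2_0_I))"
    by (simp add: carrier_PSL2_0_I Union_even_classes discrete_even_matrices)
qed (rule even_weyl_group_iso)

end
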